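(* Let $0<T<\infty$ and suppose that $f_0$ and $g_0$ are tagged-admissible and background-admissible probability densities on $U\times\mathbb{R}^3$ respectively. Then for every $\varepsilon\ge 0$ there exists a solution $P^\varepsilon:[0,T]\to L^1(\mathcal{MT})$ of the idealised equation $$\partial_tP_t(\Phi)=\mathcal{Q}^{\varepsilon,+}_t[P_t](\Phi)-\mathcal{Q}^{\varepsilon,-}_t[P_t](\Phi),\qquad P_0(\Phi)=f_0(x_0,v_0)\mathbb{1}_{n(\Phi)=0},$$ such that for all $t\in[0,T]$, $P^\varepsilon_t$ is (the density of) a probability measure on $\mathcal{MT}$. Furthermore: (i) there exists $K>0$, independent of $\varepsilon$, such that for any $t\in[0,T]$, $\int_{\mathcal{MT}}P^\varepsilon_t(\Phi)(1+|v(\tau)|)\,d\Phi\le K<\infty$; (ii) for any $\varepsilon\ge 0$, $t\in[0,T]$ and any measurable $\Omega\subset U\times\mathbb{R}^3$, $$\int_\Omega f^\varepsilon_t(x,v)\,dx\,dv=\int_{S_t(\Omega)}P^\varepsilon_t(\Phi)\,d\Phi,$$ where $f^\varepsilon_t$ is a solution of the $\varepsilon$-dependent non-autonomous linear Boltzmann equation $\partial_tf^\varepsilon_t=-v\cdot\partial_xf^\varepsilon_t+Q^\varepsilon_t[f^\varepsilon_t]$, $f^\varepsilon_{t=0}=f_0$; (iii) uniformly for $t\in[0,T]$, $\lim_{\varepsilon\to0}\int_{\mathcal{MT}}|P^0_t(\Phi)-P^\varepsilon_t(\Phi)|\,d\Phi=0$.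
   Context: $U=[0,1]^3$ with periodic boundary conditions (the torus $\mathbb{R}^3/\mathbb{Z}^3$); $[a]_+=\max(a,0)$. Admissibility. A probability density $f_0\in L^1(U\times\mathbb{R}^3)$ is tagged-admissible if $\int_{U\times\mathbb{R}^3} f_0(x,v)(1+|v|^2)\,dx\,dv<\infty$. For a probability density $g_0\in L^1(U\times\mathbb{R}^3)$ put $\bar g(v)=\operatorname{ess\,sup}_{x\in U}g_0(x,v)$. Then $g_0$ is background-admissible if: $\int_{\mathbb{R}^3}\bar g(v)(1+|v|^2)\,dv<\infty$; $\operatorname{ess\,sup}_{v}\bar g(v)(1+|v|)<\infty$; for almost all $v$, $g_0(\cdot,v)\in W^{1,1}(U)$, and $\operatorname{ess\,sup}_{x\in U}\int_{\mathbb{R}^3}|\partial_x g_0(x,v)|(1+|v|)\,dv<\infty$; and there are $M>0$ and $0<\alpha\le 1$ such that for almost all $v$ and all $x,y\in U$, $|g_0(x,v)-g_0(y,v)|<M|x-y|^\alpha$. Put $g_t(x,v)=g_0(x-tv,v)$. Trees. $\mathcal{MT}$ is the set of all $\Phi=((x_0,v_0),(t_1,\nu_1,v_1),\dots,(t_n,\nu_n,v_n))$ with $n=n(\Phi)\in\mathbb{N}\cup\{0\}$, $(x_0,v_0)\in U\times\mathbb{R}^3$, $(t_j,\nu_j,v_j)\in[0,T]\times\mathbb{S}^2\times\mathbb{R}^3$, $t_1<\dots<t_n$. $d\Phi$ is Lebesgue measure (surface measure on $\mathbb{S}^2$) on each component $\{n(\Phi)=n\}\subset U\times\mathbb{R}^3\times([0,T]\times\mathbb{S}^2\times\mathbb{R}^3)^n$.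 $\tau=\tau(\Phi)=0$ if $n=0$ and $\tau=t_n$ if $n\ge1$; for $n\ge 1$ write $(\tau,\nu,v')=(t_n,\nu_n,v_n)$, and let $\bar\Phi$ be $\Phi$ with the last collision removed. A tree determines the root trajectory $(x(t),v(t))$, $t\in[0,T]$: $x(0)=x_0$, initial velocity $v_0$, $\dot x=v$, $v$ constant between the $t_j$, and $v(t_j)=v(t_j^-)-\big(\nu_j\cdot(v(t_j^-)-v_j)\big)\nu_j$. For $\Omega\subset U\times\mathbb{R}^3$, $S_t(\Omega)=\{\Phi\in\mathcal{MT}:(x(t),v(t))\in\Omega\}$. Idealised equation. $\mathcal{Q}^{\varepsilon,-}_t[P_t](\Phi)=P_t(\Phi)L^\varepsilon_t(\Phi)$ with $L^\varepsilon_t(\Phi)=\int_{\mathbb{S}^2}\int_{\mathbb{R}^3}g_t(x(t)+\varepsilon\nu,\bar v)[(v(t)-\bar v)\cdot\nu]_+\,d\bar v\,d\nu$, and $\mathcal{Q}^{\varepsilon,+}_t[P_t](\Phi)=\delta(t-\tau)P_\tau(\bar\Phi)g_\tau(x(\tau)+\varepsilon\nu,v')[(v(\tau^-)-v')\cdot\nu]_+$ if $n\ge1$, and $0$ if $n=0$. Being a solution means: for $n=0$, $P_0(\Phi)=f_0(x_0,v_0)$ and $\partial_tP_t(\Phi)=-L^\varepsilon_t(\Phi)P_t(\Phi)$; for $n\ge1$, $P_t(\Phi)=0$ for $t<\tau$, $P_\tau(\Phi)=P_\tau(\bar\Phi)g_\tau(x(\tau)+\varepsilon\nu,v')[(v(\tau^-)-v')\cdot\nu]_+$,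 and $\partial_tP_t(\Phi)=-L^\varepsilon_t(\Phi)P_t(\Phi)$ for $t>\tau$. $\varepsilon$-dependent linear Boltzmann equation. $Q^\varepsilon_t=Q^{\varepsilon,+}_t-Q^{\varepsilon,-}_t$, $Q^{\varepsilon,-}_t[f](x,v)=f(x,v)\Sigma^\varepsilon_t(x,v)$, $\Sigma^\varepsilon_t(x,v)=\int_{\mathbb{S}^2}\int_{\mathbb{R}^3}g_t(x+\varepsilon\nu,\bar v)[(v-\bar v)\cdot\nu]_+\,d\bar v\,d\nu$, and $$Q^{\varepsilon,+}_t[f](x,v)=\int_{\mathbb{S}^2}\int_{\mathbb{R}^3}f(x,v')g_t(x+\varepsilon\nu,\bar v')[(v-\bar v)\cdot\nu]_+\,d\bar v\,d\nu,$$ where $v'=v+(\nu\cdot(\bar v-v))\nu$, $\bar v'=\bar v-(\nu\cdot(\bar v-v))\nu$. Solutions are in the evolution-system (mild) sense: with $(U^\varepsilon(t,s)f)(x,v)=\exp\big(-\int_s^t\Sigma^\varepsilon_\sigma(x-(t-\sigma)v,v)\,d\sigma\big)f(x-(t-s)v,v)$, $f^\varepsilon_t=U^\varepsilon(t,0)f_0+\int_0^tU^\varepsilon(t,s)Q^{\varepsilon,+}_s[f^\varepsilon_s]\,ds$.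
   Formalization: In the gain term Q^{ε,+} the background is evaluated at x−εν instead of the printed x+εν (with which mass is not conserved for ε>0 and (ii) fails); the strict Hölder inequality for g_0 is required only for x≠y, since at x=y it reads 0<0. *)

theory Defs
  imports "HOL-Analysis.Analysis" "HOL-Probability.Essential_Supremum"
begin

section \<open>Phase space over the torus\<close>

text \<open>
  Functions on the torus are represented by their periodic lifts to the whole space, integrals over
  the torus by integrals over the fundamental domain \<open>cell\<close>. Elements of \<open>L\<^sup>1\<close> are represented by
  Borel functions.
\<close>

type_synonym r3 = "real^3"
type_synonym phase = "r3 \<times> r3"

definition cell :: "r3 set" where
  "cell = {x. \<forall>i. 0 \<le> x $ i \<and> x $ i < 1}"

definition torus_rep :: "r3 \<Rightarrow> r3" where
  "torus_rep x = (\<chi> i. frac (x $ i))"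

definition lattice :: "r3 set" where
  "lattice = {k. \<forall>i. k $ i \<in> \<int>}"

definition periodic :: "(r3 \<Rightarrow> 'a) \<Rightarrow> bool" where
  "periodic h \<longleftrightarrow> (\<forall>x. \<forall>k\<in>lattice. h (x + k) = h x)"

definition x_periodic :: "(phase \<Rightarrow> 'a) \<Rightarrow> bool" where
  "x_periodic h \<longleftrightarrow> (\<forall>v. periodic (\<lambda>x. h (x, v)))"

definition cell_measure :: "r3 measure" where
  "cell_measure = restrict_space lborel cell"

definition phase_measure :: "phase measure" where
  "phase_measure = restrict_space lborel (cell \<times> UNIV)"

text \<open>Surface measure on the unit sphere: three times the volume of the cone over a set.\<close>

definition sphere_measure :: "r3 measure" where
  "sphere_measure = scale_measure 3
     (distr (restrict_space lborel (cball 0 1 - {0})) (restrict_space borel (sphere 0 1))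
        (\<lambda>x. x /\<^sub>R norm x))"

lemma sphere_map_measurable:
  "(\<lambda>x::r3. x /\<^sub>R norm x) \<in> restrict_space lborel (cball 0 1 - {0}) \<rightarrow>\<^sub>M restrict_space borel (sphere 0 1)"
  by (intro measurable_restrict_space2 measurable_restrict_space1) (auto simp: space_restrict_space)

lemma emeasure_sphere_measure: "emeasure sphere_measure (space sphere_measure) = ennreal (4 * pi)"
proof -
  have "emeasure lborel (cball (0::r3) 1 - {0}) = emeasure lborel (cball (0::r3) 1)"
    by (subst emeasure_Diff) (auto simp: emeasure_lborel_cball_finite)
  also have "\<dots> = ennreal (4/3 * pi)"
    using emeasure_cball[of 1 "0::r3"] by (simp add: unit_ball_vol_numeral fact_numeral)
  finally have *: "emeasure lborel (cball (0::r3) 1 - {0}) = ennreal (4/3 * pi)" .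
  have "(\<lambda>x::r3. x /\<^sub>R norm x) -` sphere 0 1 \<inter> (cball 0 1 - {0}) = cball 0 1 - {0}"
    by auto
  moreover have three: "3 * ennreal (4 * pi / 3) = ennreal (4 * pi)"
    using ennreal_mult''[of "4*pi/3" 3] by simp
  ultimately show ?thesis
    unfolding sphere_measure_def
    by (simp add: space_scale_measure emeasure_distr[OF sphere_map_measurable] sets_restrict_space_iff
         space_restrict_space emeasure_restrict_space * three)
qed

definition prob_density :: "'a measure \<Rightarrow> ('a \<Rightarrow> real) \<Rightarrow> bool" where
  "prob_density M h \<longleftrightarrow>
     integrable M h \<and> (AE z in M. 0 \<le> h z) \<and> (\<integral>z. h z \<partial>M) = 1"


section \<open>Admissible initial data\<close>

definition tagged_admissible :: "(phase \<Rightarrow> real) \<Rightarrow> bool" where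
  "tagged_admissible f0 \<longleftrightarrow>
     x_periodic f0 \<and> prob_density phase_measure f0 \<and>
     integrable phase_measure (\<lambda>(x, v). f0 (x, v) * (1 + (norm v)\<^sup>2))"

text \<open>\<open>D is\<close> is the iterated partial derivative of \<open>\<phi>\<close> in the directions listed in \<open>is\<close>.\<close>

definition smooth_with_partials :: "(r3 \<Rightarrow> real) \<Rightarrow> (3 list \<Rightarrow> r3 \<Rightarrow> real) \<Rightarrow> bool" where
  "smooth_with_partials \<phi> D \<longleftrightarrow>
     D [] = \<phi> \<and>
     (\<forall>is x. (D is has_derivative (\<lambda>h. \<Sum>i\<in>UNIV. D (i # is) x * h $ i)) (at x))"

text \<open>\<open>u\<close> lies in \<open>W\<^sup>1\<^sup>,\<^sup>1\<close> of the torus, with weak gradient \<open>w\<close>. Test functions are the smooth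
  functions on the torus, so no boundary terms arise.\<close>

definition W11_with_gradient :: "(r3 \<Rightarrow> real) \<Rightarrow> (r3 \<Rightarrow> r3) \<Rightarrow> bool" where
  "W11_with_gradient u w \<longleftrightarrow>
     integrable cell_measure u \<and> integrable cell_measure w \<and>
     (\<forall>\<phi> D i. periodic \<phi> \<and> smooth_with_partials \<phi> D \<longrightarrow>
        (\<integral>x. u x * D [i] x \<partial>cell_measure) = - (\<integral>x. w x $ i * \<phi> x \<partial>cell_measure))"

definition gbar :: "(phase \<Rightarrow> real) \<Rightarrow> r3 \<Rightarrow> ennreal" where
  "gbar g0 v = esssup cell_measure (\<lambda>x. ennreal (g0 (x, v)))"

text \<open>
  \<open>Dg\<close> is a jointly measurable version of the weak gradient in \<open>x\<close>. The Hoelder condition, imposed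
  on the periodic lift for all points of the whole space, is the Hoelder condition for the distance
  on the torus. The case \<open>x = y\<close> has to be excluded because the inequality is strict.
\<close>

definition background_admissible :: "(phase \<Rightarrow> real) \<Rightarrow> bool" where
  "background_admissible g0 \<longleftrightarrow>
     x_periodic g0 \<and> prob_density phase_measure g0 \<and>
     (\<integral>\<^sup>+v. gbar g0 v * ennreal (1 + (norm v)\<^sup>2) \<partial>lborel) < \<infinity> \<and>
     esssup lborel (\<lambda>v. gbar g0 v * ennreal (1 + norm v)) < \<infinity> \<and>
     (\<exists>Dg \<in> borel_measurable phase_measure.
        (AE v in lborel. W11_with_gradient (\<lambda>x. g0 (x, v)) (\<lambda>x. Dg (x, v))) \<and>
        esssup cell_measure (\<lambda>x. \<integral>\<^sup>+v. ennreal (norm (Dg (x, v)) * (1 + norm v)) \<partial>lborel) < \<infinity>) \<and>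
     (\<exists>M>0. \<exists>\<alpha>>0. \<alpha> \<le> 1 \<and>
        (AE v in lborel. \<forall>x y. x \<noteq> y \<longrightarrow> \<bar>g0 (x, v) - g0 (y, v)\<bar> < M * norm (x - y) powr \<alpha>))"

definition transport :: "(phase \<Rightarrow> real) \<Rightarrow> real \<Rightarrow> phase \<Rightarrow> real" where
  "transport g0 t = (\<lambda>(x, v). g0 (x - t *\<^sub>R v, v))"


section \<open>Collision trees\<close>

type_synonym collision = "real \<times> r3 \<times> r3"
type_synonym tree = "phase \<times> collision list"

definition trees :: "real \<Rightarrow> tree set" where
  "trees T = {(z, cs). z \<in> cell \<times> UNIV \<and> set cs \<subseteq> {0..T} \<times> sphere 0 1 \<times> UNIV \<and>
                sorted_wrt (<) (map fst cs)}"

definition ncoll :: "tree \<Rightarrow> nat" where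
  "ncoll \<Phi> = length (snd \<Phi>)"

definition tau :: "tree \<Rightarrow> real" where
  "tau \<Phi> = (if ncoll \<Phi> = 0 then 0 else fst (last (snd \<Phi>)))"

definition prune :: "tree \<Rightarrow> tree" where
  "prune \<Phi> = (fst \<Phi>, butlast (snd \<Phi>))"

definition collision_measure :: "real \<Rightarrow> collision measure" where
  "collision_measure T = restrict_space lborel {0..T} \<Otimes>\<^sub>M (sphere_measure \<Otimes>\<^sub>M lborel)"

definition component_measure :: "real \<Rightarrow> nat \<Rightarrow> (phase \<times> (nat \<Rightarrow> collision)) measure" where
  "component_measure T n = phase_measure \<Otimes>\<^sub>M PiM {..<n} (\<lambda>_. collision_measure T)"

definition mk_tree :: "nat \<Rightarrow> phase \<times> (nat \<Rightarrow> collision) \<Rightarrow> tree" where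
  "mk_tree n = (\<lambda>(z, c). (z, map c [0..<n]))"

definition tree_sets :: "real \<Rightarrow> tree set set" where
  "tree_sets T = {A. A \<subseteq> trees T \<and>
     (\<forall>n. mk_tree n -` A \<inter> space (component_measure T n) \<in> sets (component_measure T n))}"

definition tree_measure :: "real \<Rightarrow> tree measure" where
  "tree_measure T = measure_of (trees T) (tree_sets T)
     (\<lambda>A. \<Sum>n. emeasure (component_measure T n)
                  (mk_tree n -` A \<inter> space (component_measure T n)))"

lemma mk_tree_in_trees_iff:
  assumes "x \<in> space (component_measure T n)"
  shows "mk_tree n x \<in> trees T \<longleftrightarrow> (\<forall>i<n. \<forall>j<n. i < j \<longrightarrow> fst (snd x i) < fst (snd x j))"
  using assms
  by (auto simp: component_measure_def mk_tree_def trees_def space_pair_measure phase_measure_def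
      space_restrict_space space_PiM collision_measure_def sphere_measure_def space_scale_measure PiE_def Pi_def
      sorted_wrt_iff_nth_less split: prod.splits)

lemma trees_in_tree_sets: "trees T \<in> tree_sets T"
proof -
  have "mk_tree n -` trees T \<inter> space (component_measure T n) \<in> sets (component_measure T n)" for n
  proof -
    have eq: "mk_tree n -` trees T \<inter> space (component_measure T n) =
       {x \<in> space (component_measure T n). \<forall>i\<in>{..<n}. \<forall>j\<in>{..<n}. i < j \<longrightarrow> fst (snd x i) < fst (snd x j)}"
      by (rule set_eqI) (use mk_tree_in_trees_iff[of _ T n] in \<open>simp add: Ball_def, blast\<close>)
    have m: "(\<lambda>x. fst (snd x i)) \<in> borel_measurable (component_measure T n)" if "i < n" for i
    proof -
      have "(\<lambda>x. snd x i) \<in> component_measure T n \<rightarrow>\<^sub>M collision_measure T"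
        unfolding component_measure_def using that
        by (intro measurable_compose[OF measurable_snd measurable_component_singleton]) auto
      moreover have "fst \<in> borel_measurable (collision_measure T)"
      proof -
        have "(\<lambda>x::real. x) \<in> borel_measurable (restrict_space lborel {0..T})"
          by (intro measurable_restrict_space1) auto
        moreover have "fst \<in> collision_measure T \<rightarrow>\<^sub>M restrict_space lborel {0..T}"
          unfolding collision_measure_def by simp
        ultimately show ?thesis using measurable_compose by blast
      qed
      ultimately show ?thesis using measurable_compose by blast
    qed
    show ?thesis unfolding eq
      using m by (intro sets.sets_Collect_finite_All sets.sets_Collect_imp borel_measurable_less
                   sets.sets_Collect) auto
  qed
  then show ?thesis by (simp add: tree_sets_def)
qed

lemma sigma_algebra_tree_sets: "sigma_algebra (trees T) (tree_sets T)"
unfolding sigma_algebra_iff2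
proof (intro conjI ballI allI impI)
  show "tree_sets T \<subseteq> Pow (trees T)" by (auto simp: tree_sets_def)
  show "{} \<in> tree_sets T" by (simp add: tree_sets_def)
  fix A assume A: "A \<in> tree_sets T"
  have "mk_tree n -` (trees T - A) \<inter> space (component_measure T n) =
     (mk_tree n -` trees T \<inter> space (component_measure T n)) - (mk_tree n -` A \<inter> space (component_measure T n))" for n
    by auto
  then show "trees T - A \<in> tree_sets T" using A trees_in_tree_sets[of T] by (auto simp: tree_sets_def)
next
  fix A :: "nat \<Rightarrow> tree set" assume "range A \<subseteq> tree_sets T"
  then have "mk_tree n -` A x \<inter> space (component_measure T n) \<in> sets (component_measure T n)" "A x \<subseteq> trees T" for x n
    by (auto simp: tree_sets_def)
  moreover have "mk_tree n -` \<Union> (range A) \<inter> space (component_measure T n) = (\<Union>x. mk_tree n -` A x \<inter> space (component_measure T n))" for n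
    by auto
  ultimately show "\<Union> (range A) \<in> tree_sets T"
    unfolding tree_sets_def by (auto simp del: UN_simps)
qed

text \<open>The measure on trees is genuine: \<open>measure_of\<close> does not degenerate.\<close>

lemma tree_measure:
  "space (tree_measure T) = trees T" "sets (tree_measure T) = tree_sets T"
  "A \<in> tree_sets T \<Longrightarrow> emeasure (tree_measure T) A =
    (\<Sum>n. emeasure (component_measure T n) (mk_tree n -` A \<inter> space (component_measure T n)))"
proof -
  interpret sigma_algebra "trees T" "tree_sets T" by (rule sigma_algebra_tree_sets)
  show "space (tree_measure T) = trees T" "sets (tree_measure T) = tree_sets T"
    by (simp_all add: tree_measure_def space_measure_of_conv)
  let ?m = "\<lambda>A. \<Sum>n. emeasure (component_measure T n) (mk_tree n -` A \<inter> space (component_measure T n))"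
  have "countably_additive (tree_sets T) ?m"
  proof (rule countably_additiveI)
    fix A :: "nat \<Rightarrow> tree set" assume A: "range A \<subseteq> tree_sets T" "disjoint_family A"
    have "emeasure (component_measure T n) (mk_tree n -` \<Union> (range A) \<inter> space (component_measure T n)) =
      (\<Sum>i. emeasure (component_measure T n) (mk_tree n -` A i \<inter> space (component_measure T n)))" for n
    proof (subst suminf_emeasure)
      show "range (\<lambda>i. mk_tree n -` A i \<inter> space (component_measure T n)) \<subseteq> sets (component_measure T n)"
        using A(1) by (auto simp: tree_sets_def)
      show "disjoint_family (\<lambda>i. mk_tree n -` A i \<inter> space (component_measure T n))"
        using A(2) by (fastforce simp: disjoint_family_on_def)
    qed (auto intro!: arg_cong[where f="emeasure _"])
    then show "(\<Sum>i. ?m (A i)) = ?m (\<Union> (range A))"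
      using nn_integral_suminf[of "\<lambda>n i. emeasure (component_measure T i) (mk_tree i -` A n \<inter> space (component_measure T i))" "count_space UNIV"] by (simp add: nn_integral_count_space_nat)
  qed
  moreover have "positive (tree_sets T) ?m" by (simp add: positive_def)
  ultimately show "emeasure (tree_measure T) A = ?m A" if "A \<in> tree_sets T"
    unfolding tree_measure_def using that sigma_algebra_axioms by (intro emeasure_measure_of_sigma) auto
qed

text \<open>
  \<open>trajectory (x, v) s cs t\<close> is the state at time \<open>t\<close> of the root started in \<open>(x, v)\<close> at time \<open>s\<close>
  with remaining collisions \<open>cs\<close>. It is right continuous in \<open>t\<close>. Positions are not reduced to the
  fundamental domain.
\<close>

fun trajectory :: "phase \<Rightarrow> real \<Rightarrow> collision list \<Rightarrow> real \<Rightarrow> phase" where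
  "trajectory (x, v) s [] t = (x + (t - s) *\<^sub>R v, v)"
| "trajectory (x, v) s ((t1, \<nu>, w) # cs) t =
     (if t < t1 then (x + (t - s) *\<^sub>R v, v)
      else trajectory (x + (t1 - s) *\<^sub>R v, v - (\<nu> \<bullet> (v - w)) *\<^sub>R \<nu>) t1 cs t)"

definition root :: "tree \<Rightarrow> real \<Rightarrow> phase" where
  "root \<Phi> t = trajectory (fst \<Phi>) 0 (snd \<Phi>) t"

definition root_pos :: "tree \<Rightarrow> real \<Rightarrow> r3" where
  "root_pos \<Phi> t = fst (root \<Phi> t)"

definition root_vel :: "tree \<Rightarrow> real \<Rightarrow> r3" where
  "root_vel \<Phi> t = snd (root \<Phi> t)"

definition S_set :: "real \<Rightarrow> real \<Rightarrow> phase set \<Rightarrow> tree set" where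
  "S_set T t \<Omega> = {\<Phi> \<in> trees T. (torus_rep (root_pos \<Phi> t), root_vel \<Phi> t) \<in> \<Omega>}"


section \<open>The idealised equation\<close>

definition loss_rate :: "(phase \<Rightarrow> real) \<Rightarrow> real \<Rightarrow> real \<Rightarrow> tree \<Rightarrow> real" where
  "loss_rate g0 \<epsilon> t \<Phi> =
     (\<integral>(\<nu>, w). transport g0 t (root_pos \<Phi> t + \<epsilon> *\<^sub>R \<nu>, w) * max ((root_vel \<Phi> t - w) \<bullet> \<nu>) 0
        \<partial>(sphere_measure \<Otimes>\<^sub>M lborel))"

definition tree_loss :: "(phase \<Rightarrow> real) \<Rightarrow> real \<Rightarrow> real \<Rightarrow> (tree \<Rightarrow> real) \<Rightarrow> tree \<Rightarrow> real" where
  "tree_loss g0 \<epsilon> t p \<Phi> = p \<Phi> * loss_rate g0 \<epsilon> t \<Phi>"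

text \<open>
  The factor of \<open>\<delta>(t - \<tau>)\<close> in the gain term, for \<open>n \<ge> 1\<close>. The pre-collisional velocity \<open>v(\<tau>-)\<close> is the
  velocity of the pruned tree at time \<open>\<tau>\<close>; this also covers \<open>\<tau> = 0\<close>, where it is the initial velocity.
\<close>

definition tree_gain :: "(phase \<Rightarrow> real) \<Rightarrow> real \<Rightarrow> (tree \<Rightarrow> real) \<Rightarrow> tree \<Rightarrow> real" where
  "tree_gain g0 \<epsilon> p \<Phi> =
     (case last (snd \<Phi>) of (\<tau>, \<nu>, w) \<Rightarrow>
        p (prune \<Phi>) * transport g0 \<tau> (root_pos \<Phi> \<tau> + \<epsilon> *\<^sub>R \<nu>, w)
          * max ((root_vel (prune \<Phi>) \<tau> - w) \<bullet> \<nu>) 0)"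

text \<open>
  The derivative is one-sided at the end points of \<open>[\<tau>, T]\<close>; at \<open>\<tau>\<close> this ties the evolution to the
  value prescribed there. The initial condition on all of \<open>trees T\<close> only holds almost everywhere,
  because trees with \<open>n = 1\<close> and \<open>\<tau> = 0\<close> carry the value prescribed by the gain term.
\<close>

definition idealised_solution ::
    "real \<Rightarrow> real \<Rightarrow> (phase \<Rightarrow> real) \<Rightarrow> (phase \<Rightarrow> real) \<Rightarrow> (real \<Rightarrow> tree \<Rightarrow> real) \<Rightarrow> bool" where
  "idealised_solution T \<epsilon> f0 g0 P \<longleftrightarrow>
     (\<forall>t\<in>{0..T}. integrable (tree_measure T) (P t)) \<and>
     (AE \<Phi> in tree_measure T. P 0 \<Phi> = (if ncoll \<Phi> = 0 then f0 (fst \<Phi>) else 0)) \<and>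
     (\<forall>\<Phi>\<in>trees T.
        (ncoll \<Phi> = 0 \<longrightarrow> P 0 \<Phi> = f0 (fst \<Phi>)) \<and>
        (ncoll \<Phi> \<ge> 1 \<longrightarrow> (\<forall>t\<in>{0..<tau \<Phi>}. P t \<Phi> = 0) \<and>
                         P (tau \<Phi>) \<Phi> = tree_gain g0 \<epsilon> (P (tau \<Phi>)) \<Phi>) \<and>
        (\<forall>t\<in>{tau \<Phi>..T}. ((\<lambda>s. P s \<Phi>) has_real_derivative - tree_loss g0 \<epsilon> t (P t) \<Phi>)
                           (at t within {tau \<Phi>..T})))"


section \<open>The \<open>\<epsilon>\<close>-dependent linear Boltzmann equation\<close>

definition Sigma_rate :: "(phase \<Rightarrow> real) \<Rightarrow> real \<Rightarrow> real \<Rightarrow> phase \<Rightarrow> real" where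
  "Sigma_rate g0 \<epsilon> t = (\<lambda>(x, v).
     \<integral>(\<nu>, w). transport g0 t (x + \<epsilon> *\<^sub>R \<nu>, w) * max ((v - w) \<bullet> \<nu>) 0
        \<partial>(sphere_measure \<Otimes>\<^sub>M lborel))"

text \<open>
  In the gain term \<open>v, w\<close> are the post-collisional velocities, and \<open>(v - w) \<bullet> \<nu> > 0\<close>. The
  pre-collisional velocities \<open>v', w'\<close> satisfy \<open>(v' - w') \<bullet> (- \<nu>) = (v - w) \<bullet> \<nu>\<close>, so the collision
  direction in the convention used for trees and for the loss term is \<open>- \<nu>\<close>, and the background
  particle sits at \<open>x - \<epsilon> \<nu>\<close>. With \<open>x + \<epsilon> \<nu>\<close> instead, gain and loss would not balance when \<open>\<epsilon> > 0\<close>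
  and the equation would not conserve mass. For \<open>\<epsilon> = 0\<close> there is no difference.
\<close>

definition boltzmann_gain_integrand ::
    "(phase \<Rightarrow> real) \<Rightarrow> real \<Rightarrow> real \<Rightarrow> (phase \<Rightarrow> real) \<Rightarrow> phase \<Rightarrow> r3 \<times> r3 \<Rightarrow> real" where
  "boltzmann_gain_integrand g0 \<epsilon> t f = (\<lambda>(x, v) (\<nu>, w).
     (let v' = v + (\<nu> \<bullet> (w - v)) *\<^sub>R \<nu>; w' = w - (\<nu> \<bullet> (w - v)) *\<^sub>R \<nu>
      in f (x, v') * transport g0 t (x - \<epsilon> *\<^sub>R \<nu>, w') * max ((v - w) \<bullet> \<nu>) 0))"

definition boltzmann_gain ::
    "(phase \<Rightarrow> real) \<Rightarrow> real \<Rightarrow> real \<Rightarrow> (phase \<Rightarrow> real) \<Rightarrow> phase \<Rightarrow> real" where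
  "boltzmann_gain g0 \<epsilon> t f z =
     (\<integral>q. boltzmann_gain_integrand g0 \<epsilon> t f z q \<partial>(sphere_measure \<Otimes>\<^sub>M lborel))"

definition evolution ::
    "(phase \<Rightarrow> real) \<Rightarrow> real \<Rightarrow> real \<Rightarrow> real \<Rightarrow> (phase \<Rightarrow> real) \<Rightarrow> phase \<Rightarrow> real" where
  "evolution g0 \<epsilon> t s f = (\<lambda>(x, v).
     exp (- (LINT \<sigma>:{s..t}|lborel. Sigma_rate g0 \<epsilon> \<sigma> (x - (t - \<sigma>) *\<^sub>R v, v)))
       * f (x - (t - s) *\<^sub>R v, v))"

text \<open>
  Mild solutions with values in \<open>L\<^sup>1\<close>. The two middle conditions make the collision integral and the
  \<open>L\<^sup>1\<close>-valued time integral meaningful.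
\<close>

definition mild_solution ::
    "real \<Rightarrow> real \<Rightarrow> (phase \<Rightarrow> real) \<Rightarrow> (phase \<Rightarrow> real) \<Rightarrow> (real \<Rightarrow> phase \<Rightarrow> real) \<Rightarrow> bool" where
  "mild_solution T \<epsilon> f0 g0 f \<longleftrightarrow>
     (\<forall>t\<in>{0..T}. x_periodic (f t) \<and> integrable phase_measure (f t)) \<and>
     (AE (s, z) in restrict_space lborel {0..T} \<Otimes>\<^sub>M phase_measure.
        integrable (sphere_measure \<Otimes>\<^sub>M lborel) (boltzmann_gain_integrand g0 \<epsilon> s (f s) z)) \<and>
     integrable (restrict_space lborel {0..T} \<Otimes>\<^sub>M phase_measure)
        (\<lambda>(s, z). boltzmann_gain g0 \<epsilon> s (f s) z) \<and>
     (\<forall>t\<in>{0..T}. AE z in phase_measure.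
        f t z = evolution g0 \<epsilon> t 0 f0 z
              + (LINT s:{0..t}|lborel. evolution g0 \<epsilon> t s (boltzmann_gain g0 \<epsilon> s (f s)) z))"

end

theory Submission
  imports Defs
begin

text \<open>The rates see a tree only through the state of its root. Hence the trees with exactly \<open>n\<close>
  collisions push forward under the root trajectory to a density on phase space that satisfies
  Duhamel's recursion for the linear Boltzmann equation; collisions are reversed by a measure
  preserving involution. The sum over \<open>n\<close> is a mild solution.

  The mass missing on the trees with at most \<open>n\<close> collisions is the integrated flux out of the trees
  with \<open>n\<close> collisions. The collision rate is at most \<open>C (1 + \<bar>v\<bar>)\<close>, and since energy is conserved in a
  collision, the mean gain of speed per unit of time is bounded, so the first moment of the velocity
  grows at most linearly. Therefore the fluxes are summable in \<open>n\<close>, and no mass is lost.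

  For a fixed time the densities converge almost everywhere as \<open>\<epsilon>\<close> tends to 0, hence in \<open>L\<^sup>1\<close> by
  Scheffe's lemma. The convergence is uniform in time because the solutions are Lipschitz in time
  with values in \<open>L\<^sup>1\<close>, uniformly in \<open>\<epsilon>\<close>.\<close>

section \<open>The torus, the sphere and collisions\<close>

text \<open>The densities, the gain term and the series over the number of collisions live in
  \<open>ennreal\<close>. All exchanges of sums and integrals are then free, and finiteness almost
  everywhere is read off afterwards from the total mass. The obstacle is that the collision rate is
  unbounded in the velocity, so a series over finitely many collisions might lose mass. It is
  controlled by testing: densities are paired with periodic functions, and the adjoint operators
  \<open>scatter\<close> (a collision) and \<open>propagate\<close> (free flight with survival) move
  the dynamics onto the test function. With the test function 1, gain and loss telescope in n. With
  1 + |v| they telescope up to an error, which (|v| + |w|) (|v'| - |v|) \<le> |w|^2 bounds through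
  the second moment of the background. Hence the constant 4 pi C0: the area of the sphere times a
  bound for the integral of G(w) (1 + |w|^2). Integrating out the last collision of a tree produces
  the same adjoint recursion. So trees and densities are compared by induction on n for all test
  functions at once, with no change of variables on trees.\<close>

lemma borel_measurable_fst_comp [measurable (raw)]:
  fixes f :: "'a \<Rightarrow> 'b::second_countable_topology \<times> 'c::second_countable_topology"
  assumes "f \<in> borel_measurable M"
  shows "(\<lambda>x. fst (f x)) \<in> borel_measurable M"
  by (rule measurable_compose[OF assms]) (intro borel_measurable_continuous_onI continuous_intros)

lemma borel_measurable_snd_comp [measurable (raw)]:
  fixes f :: "'a \<Rightarrow> 'b::second_countable_topology \<times> 'c::second_countable_topology"
  assumes "f \<in> borel_measurable M"
  shows "(\<lambda>x. snd (f x)) \<in> borel_measurable M"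
  by (rule measurable_compose[OF assms]) (intro borel_measurable_continuous_onI continuous_intros)

section \<open>Measure preserving maps of velocity space\<close>

lemma nn_integral_lborel_shift:
  fixes h :: "'a::euclidean_space \<Rightarrow> ennreal"
  assumes [measurable]: "h \<in> borel_measurable borel"
  shows "(\<integral>\<^sup>+x. h (x + a) \<partial>lborel) = (\<integral>\<^sup>+x. h x \<partial>lborel)"
proof -
  have "(\<integral>\<^sup>+x. h x \<partial>lborel) = (\<integral>\<^sup>+x. h x \<partial>distr lborel borel ((+) a))"
    by (simp add: lborel_distr_plus)
  also have "\<dots> = (\<integral>\<^sup>+x. h (a + x) \<partial>lborel)"
    by (subst nn_integral_distr) auto
  finally show ?thesis by (simp add: add.commute)
qed

text \<open>Being an involution makes the preimage of a box equal to its image, and orthogonal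
  images keep Lebesgue measure; boxes determine \<open>lborel\<close>.\<close>

lemma distr_lborel_linear_involution:
  fixes f :: "r3 \<Rightarrow> r3"
  assumes f: "orthogonal_transformation f" and inv: "\<And>x. f (f x) = x"
  shows "distr lborel borel f = lborel"
proof (rule lborel_eqI[symmetric])
  have "linear f" using f by (rule orthogonal_transformation_linear)
  then have [measurable]: "f \<in> borel_measurable borel"
    by (intro borel_measurable_continuous_onI linear_continuous_on) (simp add: linear_conv_bounded_linear)
  fix l u :: r3 assume lu: "\<And>b. b \<in> Basis \<Longrightarrow> l \<bullet> b \<le> u \<bullet> b"
  have pre: "f -` box l u = f ` box l u"
    by (auto simp: inv intro!: image_eqI[where f=f, OF inv[symmetric]])
  have "box l u \<in> lmeasurable" by simp
  note m = measurable_orthogonal_image[OF f this] measure_orthogonal_image[OF f this]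
  have "f -` box l u \<in> sets borel"
    using measurable_sets[of f borel borel "box l u"] by simp
  then have "emeasure (distr lborel borel f) (box l u) = emeasure lebesgue (f -` box l u)"
    by (subst emeasure_distr) (auto simp: emeasure_completion main_part_sets)
  also have "\<dots> = ennreal (measure lebesgue (f ` box l u))"
    unfolding pre using m(1) by (simp add: emeasure_eq_measure2)
  also have "\<dots> = emeasure lebesgue (box l u)"
    using m(2) \<open>box l u \<in> lmeasurable\<close> by (simp add: emeasure_eq_measure2)
  also have "\<dots> = (\<Prod>b\<in>Basis. (u - l) \<bullet> b)"
    using lu by (simp add: emeasure_lborel_box)
  finally show "emeasure (distr lborel borel f) (box l u) = (\<Prod>b\<in>Basis. (u - l) \<bullet> b)" .
qed simp

text \<open>The Householder reflection. A collision acts in this way on the relative velocity of the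
  pair.\<close>

definition reflect :: "r3 \<Rightarrow> r3 \<Rightarrow> r3" where
  "reflect \<nu> u = u - (2 * (\<nu> \<bullet> u)) *\<^sub>R \<nu>"

lemma reflect_involution:
  assumes "norm \<nu> = 1" shows "reflect \<nu> (reflect \<nu> u) = u"
  using assms by (simp add: reflect_def inner_diff_right norm_eq_1 algebra_simps)

lemma orthogonal_reflect:
  assumes "norm \<nu> = 1" shows "orthogonal_transformation (reflect \<nu>)"
  using assms unfolding orthogonal_transformation_def
  by (auto simp: reflect_def inner_diff_right inner_diff_left norm_eq_1 algebra_simps inner_commute intro!: linearI)

lemma nn_integral_reflect:
  assumes "norm \<nu> = 1" and [measurable]: "h \<in> borel_measurable borel"
  shows "(\<integral>\<^sup>+u. h (reflect \<nu> u) \<partial>lborel) = (\<integral>\<^sup>+u. h u \<partial>lborel)"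
proof -
  have [measurable]: "reflect \<nu> \<in> borel_measurable borel" unfolding reflect_def by measurable
  have "(\<integral>\<^sup>+u. h u \<partial>lborel) = (\<integral>\<^sup>+u. h u \<partial>distr lborel borel (reflect \<nu>))"
    by (subst distr_lborel_linear_involution) (use assms orthogonal_reflect reflect_involution in auto)
  also have "\<dots> = (\<integral>\<^sup>+u. h (reflect \<nu> u) \<partial>lborel)"
    by (subst nn_integral_distr) auto
  finally show ?thesis by simp
qed

lemma nn_integral_lborel_uminus:
  fixes h :: "r3 \<Rightarrow> ennreal"
  assumes [measurable]: "h \<in> borel_measurable borel"
  shows "(\<integral>\<^sup>+u. h (- u) \<partial>lborel) = (\<integral>\<^sup>+u. h u \<partial>lborel)"
proof -
  have "(\<integral>\<^sup>+u. h u \<partial>lborel) = (\<integral>\<^sup>+u. h u \<partial>distr lborel borel uminus)"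
    by (subst distr_lborel_linear_involution)
       (auto simp: orthogonal_transformation_def intro!: linearI)
  also have "\<dots> = (\<integral>\<^sup>+u. h (- u) \<partial>lborel)"
    by (subst nn_integral_distr) auto
  finally show ?thesis by simp
qed

section \<open>The cell as a fundamental domain of the lattice\<close>

lemma countable_lattice: "countable lattice"
proof -
  have "k \<in> range (\<lambda>f::3 \<Rightarrow> int. \<chi> i. of_int (f i))" if "k \<in> lattice" for k
  proof -
    have "k = (\<chi> i. of_int \<lfloor>k $ i\<rfloor>)"
      using that by (auto simp: lattice_def vec_eq_iff)
    then show ?thesis by (rule range_eqI[of k "\<lambda>f::3 \<Rightarrow> int. \<chi> i. of_int (f i)"])
  qed
  then have "lattice \<subseteq> range (\<lambda>f::3 \<Rightarrow> int. \<chi> i. of_int (f i))" by blast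
  then show ?thesis by (rule countable_subset) simp
qed

lemma lattice_torus_rep: "x - torus_rep x \<in> lattice"
  by (simp add: lattice_def torus_rep_def frac_def)

lemma torus_rep_in_cell: "torus_rep x \<in> cell"
  by (simp add: cell_def torus_rep_def frac_lt_1)

lemma cell_unique_shift:
  assumes "k \<in> lattice" "x - k \<in> cell" shows "k = x - torus_rep x"
proof (subst vec_eq_iff, rule allI)
  fix i
  obtain m where m: "k $ i = of_int m" using assms(1) by (auto simp: lattice_def elim: Ints_cases)
  have "0 \<le> x $ i - of_int m" "x $ i - of_int m < 1" using assms(2) m by (auto simp: cell_def dest!: spec[of _ i])
  then have "\<lfloor>x $ i\<rfloor> = m" by linarith
  then show "k $ i = (x - torus_rep x) $ i" by (simp add: torus_rep_def frac_def m)
qed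

lemma periodic_torus_rep: "periodic h \<Longrightarrow> h (torus_rep x) = h x"
  using lattice_torus_rep[of x] unfolding periodic_def
  by (metis add.commute diff_add_cancel)

lemma lattice_uminus: "k \<in> lattice \<Longrightarrow> - k \<in> lattice"
  by (simp add: lattice_def)

lemma torus_rep_shift: "k \<in> lattice \<Longrightarrow> torus_rep (x + k) = torus_rep x"
  by (auto simp: torus_rep_def vec_eq_iff lattice_def frac_def elim!: Ints_cases dest!: spec)

text \<open>The translates of the half-open cell tile the space, so exactly one term of the sum is
  1. This partition of unity serves to unfold integrals over the torus.\<close>

lemma nn_integral_cell_count:
  "(\<integral>\<^sup>+k. indicator cell (x - k) \<partial>count_space lattice) = 1"
proof -
  have "(\<integral>\<^sup>+k. indicator cell (x - k) \<partial>count_space lattice) =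
     (\<integral>\<^sup>+k. indicator {x - torus_rep x} k \<partial>count_space lattice)"
    by (intro nn_integral_cong)
       (auto simp: indicator_def torus_rep_in_cell dest: cell_unique_shift)
  also have "\<dots> = 1"
    using lattice_torus_rep[of x] by (subst nn_integral_indicator) (auto simp: emeasure_count_space)
  finally show ?thesis .
qed

lemma nn_integral_cell_count':
  "(\<integral>\<^sup>+k. indicator cell (x + k) \<partial>count_space lattice) = 1"
proof -
  have "bij_betw uminus lattice lattice"
    by (rule bij_betw_byWitness[where f'=uminus]) (auto simp: lattice_uminus)
  from nn_integral_bij_count_space[OF this, of "\<lambda>k. indicator cell (x - k)"]
  show ?thesis by (simp add: nn_integral_cell_count)
qed

lemma borel_cell [measurable]: "cell \<in> sets borel"
proof -
  have "cell = (\<Inter>i. {x. 0 \<le> x $ i} \<inter> {x. x $ i < 1})" by (auto simp: cell_def)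
  also have "\<dots> \<in> sets borel" by measurable
  finally show ?thesis .
qed

lemma borel_measurable_torus_rep [measurable]: "torus_rep \<in> borel_measurable borel"
proof (subst borel_measurable_euclidean_space, rule ballI)
  fix b :: r3 assume "b \<in> Basis"
  then obtain i where b: "b = axis i 1" by (auto simp: Basis_vec_def)
  show "(\<lambda>x. torus_rep x \<bullet> b) \<in> borel_measurable borel"
    unfolding b by (simp add: torus_rep_def inner_axis frac_def) 
qed

text \<open>Translation invariance on the torus. The shift is moved from \<open>h\<close> to the
  cell, the partition of unity is inserted, and each term is translated by its lattice vector, which
  \<open>h\<close> does not notice. This exchanges the roles of the cell and the shifted cell, and
  summing again removes the shifted one.\<close>

lemma nn_integral_cell_shift:
  assumes per: "periodic h" and [measurable]: "h \<in> borel_measurable borel"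
  shows "(\<integral>\<^sup>+x. h (x + a) * indicator cell x \<partial>lborel) = (\<integral>\<^sup>+x. h x * indicator cell x \<partial>lborel)"
proof -
  have "(\<integral>\<^sup>+x. h (x + a) * indicator cell x \<partial>lborel) = (\<integral>\<^sup>+x. h x * indicator cell (x - a) \<partial>lborel)"
    using nn_integral_lborel_shift[of "\<lambda>x. h x * indicator cell (x - a)" a] by simp
  also have "\<dots> = (\<integral>\<^sup>+x. (\<integral>\<^sup>+k. h x * indicator cell (x - a) * indicator cell (x - k) \<partial>count_space lattice) \<partial>lborel)"
    by (subst nn_integral_cmult) (auto simp: nn_integral_cell_count)
  also have "\<dots> = (\<integral>\<^sup>+k. (\<integral>\<^sup>+x. h x * indicator cell (x - a) * indicator cell (x - k) \<partial>lborel) \<partial>count_space lattice)"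
    by (rule nn_integral_count_space_nn_integral) (auto simp: countable_lattice)
  also have "\<dots> = (\<integral>\<^sup>+k. (\<integral>\<^sup>+x. h x * indicator cell (x - a + k) * indicator cell x \<partial>lborel) \<partial>count_space lattice)"
  proof (rule nn_integral_cong)
    fix k assume "k \<in> space (count_space lattice)"
    then have "h (x + k) = h x" for x using per by (auto simp: periodic_def)
    then show "(\<integral>\<^sup>+x. h x * indicator cell (x - a) * indicator cell (x - k) \<partial>lborel) =
      (\<integral>\<^sup>+x. h x * indicator cell (x - a + k) * indicator cell x \<partial>lborel)"
      using nn_integral_lborel_shift[of "\<lambda>x. h x * indicator cell (x - a) * indicator cell (x - k)" k, symmetric]
      by (simp add: algebra_simps)
  qed
  also have "\<dots> = (\<integral>\<^sup>+x. (\<integral>\<^sup>+k. h x * indicator cell (x - a + k) * indicator cell x \<partial>count_space lattice) \<partial>lborel)"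
    by (rule nn_integral_count_space_nn_integral[symmetric]) (auto simp: countable_lattice)
  also have "\<dots> = (\<integral>\<^sup>+x. (\<integral>\<^sup>+k. h x * indicator cell x * indicator cell (x - a + k) \<partial>count_space lattice) \<partial>lborel)"
    by (simp add: mult_ac)
  also have "\<dots> = (\<integral>\<^sup>+x. h x * indicator cell x \<partial>lborel)"
    by (subst nn_integral_cmult) (auto simp: nn_integral_cell_count')
  finally show ?thesis .
qed

text \<open>Versions of \<open>sphere_measure\<close> and \<open>phase_measure\<close> on the Borel sets of the whole space, so that
  all functions below only have to be Borel measurable.\<close>

definition sph :: "r3 measure" where
  "sph = distr sphere_measure borel (\<lambda>x. x)"

definition ph :: "phase measure" where
  "ph = density lborel (indicator (cell \<times> UNIV))"

lemma sets_sph [simp, measurable_cong]: "sets sph = sets borel" by (simp add: sph_def)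
lemma space_sph [simp]: "space sph = UNIV" by (simp add: sph_def)
lemma sets_ph [simp, measurable_cong]: "sets ph = sets borel" by (simp add: ph_def)
lemma space_ph [simp]: "space ph = UNIV" by (simp add: ph_def)

lemma sets_sphere_measure: "sets sphere_measure = sets (restrict_space borel (sphere 0 1))"
  by (simp add: sphere_measure_def)

lemma space_sphere_measure [simp]: "space sphere_measure = sphere 0 1"
  by (simp add: sphere_measure_def space_scale_measure space_restrict_space)

lemma sphere_measure_ident [simp]: "(\<lambda>x. x) \<in> sphere_measure \<rightarrow>\<^sub>M borel"
  unfolding measurable_cong_sets[OF sets_sphere_measure refl] by (rule measurable_restrict_space1) simp

lemma phase_measure_ident [simp]: "(\<lambda>x. x) \<in> phase_measure \<rightarrow>\<^sub>M borel"
  unfolding phase_measure_def by (rule measurable_restrict_space1) simp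

lemma finite_sphere_measure: "finite_measure sphere_measure"
  by (rule finite_measureI) (metis emeasure_sphere_measure ennreal_neq_top infinity_ennreal_def)

lemma emeasure_sph: "emeasure sph UNIV = ennreal (4 * pi)"
  using emeasure_sphere_measure by (simp add: sph_def emeasure_distr del: space_sphere_measure)

lemma finite_sph: "finite_measure sph"
  by (rule finite_measureI) (simp add: emeasure_sph)

interpretation sph: finite_measure sph by (rule finite_sph)
interpretation sphere_measure: finite_measure sphere_measure by (rule finite_sphere_measure)

lemma nn_integral_sph:
  "h \<in> borel_measurable borel \<Longrightarrow> (\<integral>\<^sup>+x. h x \<partial>sph) = (\<integral>\<^sup>+x. h x \<partial>sphere_measure)"
  by (simp add: sph_def nn_integral_distr)

lemma nn_integral_sph_cone:
  assumes [measurable]: "h \<in> borel_measurable borel"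
  shows "(\<integral>\<^sup>+x. h x \<partial>sph) =
    3 * (\<integral>\<^sup>+x. h (x /\<^sub>R norm x) * indicator (cball 0 1 - {0}) x \<partial>lborel)"
proof -
  have *: "h \<in> borel_measurable (restrict_space borel (sphere 0 1))"
    by (rule measurable_restrict_space1) simp
  show ?thesis
    unfolding nn_integral_sph[OF assms] sphere_measure_def using *
    by (simp add: nn_integral_scale_measure nn_integral_distr[OF sphere_map_measurable] nn_integral_restrict_space)
qed

text \<open>The cone map commutes with the point reflection, which preserves Lebesgue measure on the
  ball.\<close>

lemma nn_integral_sph_uminus:
  assumes [measurable]: "h \<in> borel_measurable borel"
  shows "(\<integral>\<^sup>+x. h (- x) \<partial>sph) = (\<integral>\<^sup>+x. h x \<partial>sph)"
proof -
  have "(\<integral>\<^sup>+x. h (- (x /\<^sub>R norm x)) * indicator (cball 0 1 - {0}) x \<partial>lborel) =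
    (\<integral>\<^sup>+x. h (x /\<^sub>R norm x) * indicator (cball 0 1 - {0}) x \<partial>lborel)"
    using nn_integral_lborel_uminus[of "\<lambda>x. h (x /\<^sub>R norm x) * indicator (cball 0 1 - {0}) x"]
    by (simp add: indicator_def)
  then show ?thesis by (simp add: nn_integral_sph_cone)
qed

lemma AE_sph: "AE \<nu> in sph. norm \<nu> = 1"
  unfolding sph_def by (subst AE_distr_iff) auto

lemma cell_UNIV [measurable]: "cell \<times> UNIV \<in> sets (borel :: phase measure)"
  unfolding borel_prod[symmetric] by measurable

lemma sigma_finite_ph: "sigma_finite_measure ph"
  unfolding ph_def by (subst sigma_finite_measure.sigma_finite_iff_density_finite[OF lborel.sigma_finite_measure_axioms]) (auto simp: indicator_def)

interpretation ph: sigma_finite_measure ph by (rule sigma_finite_ph)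
interpretation ph_sph: pair_sigma_finite ph sph ..
interpretation lborel_sph: pair_sigma_finite lborel sph ..
interpretation sph_lborel: pair_sigma_finite sph "lborel :: r3 measure" ..
interpretation sphere_lborel: pair_sigma_finite sphere_measure "lborel :: r3 measure" ..
interpretation ph_sph_lborel: pair_sigma_finite ph "sph \<Otimes>\<^sub>M (lborel :: r3 measure)" ..

lemma distr_phase_measure: "distr phase_measure borel (\<lambda>x. x) = ph"
proof (rule measure_eqI)
  fix A assume "A \<in> sets (distr phase_measure borel (\<lambda>x. x))"
  then have [measurable]: "A \<in> sets borel" by simp
  have "emeasure (distr phase_measure borel (\<lambda>x. x)) A = (\<integral>\<^sup>+x. indicator A x \<partial>phase_measure)"
    by (subst nn_integral_indicator[symmetric]) (simp, subst nn_integral_distr, auto)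
  also have "\<dots> = emeasure ph A"
    by (simp add: phase_measure_def nn_integral_restrict_space ph_def emeasure_density mult.commute)
  finally show "emeasure (distr phase_measure borel (\<lambda>x. x)) A = emeasure ph A" .
qed simp

lemma nn_integral_phase: "h \<in> borel_measurable borel \<Longrightarrow> (\<integral>\<^sup>+x. h x \<partial>phase_measure) = (\<integral>\<^sup>+x. h x \<partial>ph)"
  by (simp add: distr_phase_measure[symmetric] nn_integral_distr)

lemma AE_phaseI: "AE z in ph. P z \<Longrightarrow> AE z in phase_measure. P z"
  unfolding distr_phase_measure[symmetric] by (drule AE_distrD[rotated]) simp_all

lemma distr_sphere_lborel:
  "distr (sphere_measure \<Otimes>\<^sub>M lborel) (borel \<Otimes>\<^sub>M borel) (\<lambda>x. x) = sph \<Otimes>\<^sub>M (lborel :: r3 measure)"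
proof -
  have "sph \<Otimes>\<^sub>M distr (lborel :: r3 measure) borel (\<lambda>x. x) = distr (sphere_measure \<Otimes>\<^sub>M lborel) (borel \<Otimes>\<^sub>M borel) (\<lambda>(x, y). (x, y))"
    unfolding sph_def by (rule pair_measure_distr) (simp_all add: distr_id2 lborel.sigma_finite_measure_axioms)
  then show ?thesis by (simp add: distr_id2 id_def)
qed

lemma sphere_lborel_ident: "(\<lambda>x. x) \<in> sphere_measure \<Otimes>\<^sub>M (lborel :: r3 measure) \<rightarrow>\<^sub>M borel \<Otimes>\<^sub>M borel"
proof -
  have "(\<lambda>x. (fst x, snd x)) \<in> sphere_measure \<Otimes>\<^sub>M (lborel :: r3 measure) \<rightarrow>\<^sub>M borel \<Otimes>\<^sub>M borel"
    using measurable_compose[OF measurable_fst sphere_measure_ident, of lborel]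
    by (intro measurable_Pair) (simp_all add: comp_def)
  then show ?thesis by simp
qed

lemma nn_integral_sphere_lborel:
  assumes "h \<in> borel_measurable (borel \<Otimes>\<^sub>M borel)"
  shows "(\<integral>\<^sup>+x. h x \<partial>(sphere_measure \<Otimes>\<^sub>M lborel)) = (\<integral>\<^sup>+x. h x \<partial>(sph \<Otimes>\<^sub>M (lborel :: r3 measure)))"
  unfolding distr_sphere_lborel[symmetric] using assms sphere_lborel_ident
  by (subst nn_integral_distr) simp_all

lemma nn_integral_ph:
  assumes [measurable]: "h \<in> borel_measurable borel"
  shows "(\<integral>\<^sup>+z. h z \<partial>ph) = (\<integral>\<^sup>+v. (\<integral>\<^sup>+x. h (x, v) * indicator cell x \<partial>lborel) \<partial>lborel)"
proof -
  have ind: "indicator (cell \<times> UNIV) z = (indicator cell (fst z) :: ennreal)" for z :: phase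
    by (cases z) (simp add: indicator_def)
  have "(\<integral>\<^sup>+z. h z \<partial>ph) = (\<integral>\<^sup>+z. h z * indicator cell (fst z) \<partial>(lborel \<Otimes>\<^sub>M lborel))"
    by (simp add: ph_def nn_integral_density lborel_prod ind mult.commute)
  also have "\<dots> = (\<integral>\<^sup>+v. (\<integral>\<^sup>+x. h (x, v) * indicator cell x \<partial>lborel) \<partial>lborel)"
    by (subst lborel_pair.nn_integral_snd[symmetric]) (simp_all add: lborel_prod)
  finally show ?thesis .
qed

text \<open>For fixed velocity the displacement is a translation of the torus. Free flight is the
  case of interest.\<close>

lemma nn_integral_ph_shift:
  assumes [measurable]: "h \<in> borel_measurable borel" "a \<in> borel_measurable borel" and per: "x_periodic h"
  shows "(\<integral>\<^sup>+z. h (fst z + a (snd z), snd z) \<partial>ph) = (\<integral>\<^sup>+z. h z \<partial>ph)"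
proof -
  have "(\<integral>\<^sup>+x. h (x + a v, v) * indicator cell x \<partial>lborel) = (\<integral>\<^sup>+x. h (x, v) * indicator cell x \<partial>lborel)" for v
    using per by (intro nn_integral_cell_shift[of "\<lambda>x. h (x, v)"]) (auto simp: x_periodic_def)
  then show ?thesis by (simp add: nn_integral_ph)
qed


text \<open>The collision map from post- to pre-collisional data. With the sign of \<open>\<nu>\<close> reversed it is an
  involution that preserves \<open>((v - w) \<bullet> \<nu>)\<close>, which turns the gain term into the adjoint of the
  collision step of the trees.\<close>

definition coll :: "phase \<times> (r3 \<times> r3) \<Rightarrow> phase \<times> (r3 \<times> r3)" where
  "coll = (\<lambda>((x, v), (\<nu>, w)).
     ((x, v + (\<nu> \<bullet> (w - v)) *\<^sub>R \<nu>), (- \<nu>, w - (\<nu> \<bullet> (w - v)) *\<^sub>R \<nu>)))"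

text \<open>In the variables v and u = w - v, a collision translates v by the normal part of u and
  reflects u. Each of these maps preserves Lebesgue measure when the other variable is held fixed,
  so Fubini separates them.\<close>

lemma nn_integral_collide:
  assumes \<nu>: "norm \<nu> = 1" and [measurable]: "case_prod h \<in> borel_measurable (borel \<Otimes>\<^sub>M borel)"
  shows "(\<integral>\<^sup>+v. (\<integral>\<^sup>+w. h (v + (\<nu> \<bullet> (w - v)) *\<^sub>R \<nu>) (w - (\<nu> \<bullet> (w - v)) *\<^sub>R \<nu>) \<partial>lborel) \<partial>lborel) =
    (\<integral>\<^sup>+v. (\<integral>\<^sup>+w. h v (w :: r3) \<partial>lborel) \<partial>lborel)"
proof -
  have "(\<integral>\<^sup>+v. (\<integral>\<^sup>+w. h (v + (\<nu> \<bullet> (w - v)) *\<^sub>R \<nu>) (w - (\<nu> \<bullet> (w - v)) *\<^sub>R \<nu>) \<partial>lborel) \<partial>lborel) =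
     (\<integral>\<^sup>+v. (\<integral>\<^sup>+u. h (v + (\<nu> \<bullet> u) *\<^sub>R \<nu>) (u + v - (\<nu> \<bullet> u) *\<^sub>R \<nu>) \<partial>lborel) \<partial>lborel)"
  proof (rule nn_integral_cong)
    fix v
    show "(\<integral>\<^sup>+w. h (v + (\<nu> \<bullet> (w - v)) *\<^sub>R \<nu>) (w - (\<nu> \<bullet> (w - v)) *\<^sub>R \<nu>) \<partial>lborel) =
      (\<integral>\<^sup>+u. h (v + (\<nu> \<bullet> u) *\<^sub>R \<nu>) (u + v - (\<nu> \<bullet> u) *\<^sub>R \<nu>) \<partial>lborel)"
      using nn_integral_lborel_shift[of "\<lambda>w. h (v + (\<nu> \<bullet> (w - v)) *\<^sub>R \<nu>) (w - (\<nu> \<bullet> (w - v)) *\<^sub>R \<nu>)" v]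
      by simp
  qed
  also have "\<dots> = (\<integral>\<^sup>+u. (\<integral>\<^sup>+v. h (v + (\<nu> \<bullet> u) *\<^sub>R \<nu>) (u + v - (\<nu> \<bullet> u) *\<^sub>R \<nu>) \<partial>lborel) \<partial>lborel)"
    by (rule lborel_pair.Fubini') measurable
  \<comment> \<open>For fixed u, translating v back by c leaves the first velocity as v and makes
    the second one v plus the reflected u.\<close>
  also have "\<dots> = (\<integral>\<^sup>+u. (\<integral>\<^sup>+v. h v (v + reflect \<nu> u) \<partial>lborel) \<partial>lborel)"
  proof (rule nn_integral_cong)
    fix u
    define c where "c = (\<nu> \<bullet> u) *\<^sub>R \<nu>"
    have "reflect \<nu> u = u - c - c"
      by (simp only: reflect_def mult_2 scaleR_left_distrib c_def) simp
    then have *: "u + (v + - c) - c = v + reflect \<nu> u" "v + - c + c = v" for v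
      by simp_all
    have "(\<integral>\<^sup>+v. h (v + c) (u + v - c) \<partial>lborel) = (\<integral>\<^sup>+v. h (v + - c + c) (u + (v + - c) - c) \<partial>lborel)"
      by (rule nn_integral_lborel_shift[of "\<lambda>v. h (v + c) (u + v - c)" "- c", symmetric]) measurable
    then show "(\<integral>\<^sup>+v. h (v + (\<nu> \<bullet> u) *\<^sub>R \<nu>) (u + v - (\<nu> \<bullet> u) *\<^sub>R \<nu>) \<partial>lborel) =
      (\<integral>\<^sup>+v. h v (v + reflect \<nu> u) \<partial>lborel)"
      unfolding c_def[symmetric] * .
  qed
  also have "\<dots> = (\<integral>\<^sup>+v. (\<integral>\<^sup>+u. h v (v + reflect \<nu> u) \<partial>lborel) \<partial>lborel)"
    unfolding reflect_def by (rule lborel_pair.Fubini') measurable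
  also have "\<dots> = (\<integral>\<^sup>+v. (\<integral>\<^sup>+w. h v w \<partial>lborel) \<partial>lborel)"
  proof (rule nn_integral_cong)
    fix v
    have "(\<integral>\<^sup>+u. h v (v + reflect \<nu> u) \<partial>lborel) = (\<integral>\<^sup>+u. h v (v + u) \<partial>lborel)"
      by (rule nn_integral_reflect[OF \<nu>]) measurable
    also have "\<dots> = (\<integral>\<^sup>+w. h v w \<partial>lborel)"
      using nn_integral_lborel_shift[of "h v" v] by (simp add: add.commute)
    finally show "(\<integral>\<^sup>+u. h v (v + reflect \<nu> u) \<partial>lborel) = (\<integral>\<^sup>+w. h v w \<partial>lborel)" .
  qed
  finally show ?thesis .
qed

abbreviation ph_coll :: "(phase \<times> (r3 \<times> r3)) measure" where
  "ph_coll \<equiv> ph \<Otimes>\<^sub>M (sph \<Otimes>\<^sub>M lborel)"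

lemma coll_measurable [measurable]: "coll \<in> ph_coll \<rightarrow>\<^sub>M ph_coll"
proof -
  have *: "coll = (\<lambda>p. ((fst (fst p), snd (fst p) + (fst (snd p) \<bullet> (snd (snd p) - snd (fst p))) *\<^sub>R fst (snd p)),
       (- fst (snd p), snd (snd p) - (fst (snd p) \<bullet> (snd (snd p) - snd (fst p))) *\<^sub>R fst (snd p))))"
    by (auto simp: coll_def fun_eq_iff)
  show ?thesis unfolding * by measurable
qed

text \<open>The order of integration is arranged with the two velocities innermost, where the
  collision map acts while \<nu> and x are parameters.\<close>

lemma nn_integral_ph_coll:
  assumes [measurable]: "H \<in> borel_measurable ph_coll"
  shows "(\<integral>\<^sup>+p. H p \<partial>ph_coll) =
    (\<integral>\<^sup>+\<nu>. (\<integral>\<^sup>+x. (\<integral>\<^sup>+v. (\<integral>\<^sup>+w. H ((x, v), (\<nu>, w)) \<partial>lborel) \<partial>lborel) * indicator cell x \<partial>lborel) \<partial>sph)"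
proof -
  have [measurable]: "(\<lambda>q. H ((f q, g q), (k q, l q))) \<in> borel_measurable N"
    if [measurable]: "f \<in> borel_measurable N" "g \<in> borel_measurable N" "k \<in> borel_measurable N" "l \<in> borel_measurable N"
    for f g k l and N :: "'z measure"
    by (rule measurable_compose[of "\<lambda>q. ((f q, g q), (k q, l q))" N ph_coll]) measurable
  have "(\<integral>\<^sup>+p. H p \<partial>ph_coll) = (\<integral>\<^sup>+z. (\<integral>\<^sup>+\<nu>. (\<integral>\<^sup>+w. H ((fst z, snd z), (\<nu>, w)) \<partial>lborel) \<partial>sph) \<partial>ph)"
    by (subst sph_lborel.nn_integral_fst[symmetric])
       (auto intro!: nn_integral_cong lborel.nn_integral_fst[symmetric])
  also have "\<dots> = (\<integral>\<^sup>+\<nu>. (\<integral>\<^sup>+z. (\<integral>\<^sup>+w. H ((fst z, snd z), (\<nu>, w)) \<partial>lborel) \<partial>ph) \<partial>sph)"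
    by (rule ph_sph.Fubini'[symmetric]) measurable
  also have "\<dots> = (\<integral>\<^sup>+\<nu>. (\<integral>\<^sup>+v. (\<integral>\<^sup>+x. (\<integral>\<^sup>+w. H ((x, v), (\<nu>, w)) \<partial>lborel) * indicator cell x \<partial>lborel) \<partial>lborel) \<partial>sph)"
    by (subst nn_integral_ph) auto
  also have "\<dots> = (\<integral>\<^sup>+\<nu>. (\<integral>\<^sup>+x. (\<integral>\<^sup>+v. (\<integral>\<^sup>+w. H ((x, v), (\<nu>, w)) \<partial>lborel) * indicator cell x \<partial>lborel) \<partial>lborel) \<partial>sph)"
    by (intro nn_integral_cong lborel_pair.Fubini') measurable
  also have "\<dots> = (\<integral>\<^sup>+\<nu>. (\<integral>\<^sup>+x. (\<integral>\<^sup>+v. (\<integral>\<^sup>+w. H ((x, v), (\<nu>, w)) \<partial>lborel) \<partial>lborel) * indicator cell x \<partial>lborel) \<partial>sph)"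
    by (intro nn_integral_cong nn_integral_multc) measurable
  finally show ?thesis .
qed

text \<open>At fixed \<nu> the velocity integral is invariant and leaves \<open>- \<nu>\<close> as
  parameter; the symmetry of the sphere measure removes the sign.\<close>

lemma nn_integral_coll:
  assumes [measurable]: "H \<in> borel_measurable ph_coll"
  shows "(\<integral>\<^sup>+p. H (coll p) \<partial>ph_coll) = (\<integral>\<^sup>+p. H p \<partial>ph_coll)"
proof -
  have [measurable]: "(\<lambda>q. H ((f q, g q), (k q, l q))) \<in> borel_measurable N"
    if [measurable]: "f \<in> borel_measurable N" "g \<in> borel_measurable N" "k \<in> borel_measurable N" "l \<in> borel_measurable N"
    for f g k l and N :: "'z measure"
    by (rule measurable_compose[of "\<lambda>q. ((f q, g q), (k q, l q))" N ph_coll]) measurable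
  have "(\<integral>\<^sup>+p. H (coll p) \<partial>ph_coll) =
    (\<integral>\<^sup>+\<nu>. (\<integral>\<^sup>+x. (\<integral>\<^sup>+v. (\<integral>\<^sup>+w. H (coll ((x, v), (\<nu>, w))) \<partial>lborel) \<partial>lborel) * indicator cell x \<partial>lborel) \<partial>sph)"
    by (rule nn_integral_ph_coll) measurable
  also have "\<dots> = (\<integral>\<^sup>+\<nu>. (\<integral>\<^sup>+x. (\<integral>\<^sup>+v. (\<integral>\<^sup>+w. H ((x, v), (- \<nu>, w)) \<partial>lborel) \<partial>lborel) * indicator cell x \<partial>lborel) \<partial>sph)"
  proof (rule nn_integral_cong_AE, rule AE_mp[OF AE_sph], rule AE_I2, rule impI)
    fix \<nu> :: r3 assume \<nu>: "norm \<nu> = 1"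
    have "(\<integral>\<^sup>+v. (\<integral>\<^sup>+w. H (coll ((x, v), (\<nu>, w))) \<partial>lborel) \<partial>lborel) = (\<integral>\<^sup>+v. (\<integral>\<^sup>+w. H ((x, v), (- \<nu>, w)) \<partial>lborel) \<partial>lborel)" for x
      unfolding coll_def by (simp, rule nn_integral_collide[OF \<nu>, where h="\<lambda>v w. H ((x, v), (- \<nu>, w))"]) measurable
    then show "(\<integral>\<^sup>+x. (\<integral>\<^sup>+v. (\<integral>\<^sup>+w. H (coll ((x, v), (\<nu>, w))) \<partial>lborel) \<partial>lborel) * indicator cell x \<partial>lborel) =
      (\<integral>\<^sup>+x. (\<integral>\<^sup>+v. (\<integral>\<^sup>+w. H ((x, v), (- \<nu>, w)) \<partial>lborel) \<partial>lborel) * indicator cell x \<partial>lborel)"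
      by simp
  qed
  also have "\<dots> = (\<integral>\<^sup>+\<nu>. (\<integral>\<^sup>+x. (\<integral>\<^sup>+v. (\<integral>\<^sup>+w. H ((x, v), (\<nu>, w)) \<partial>lborel) \<partial>lborel) * indicator cell x \<partial>lborel) \<partial>sph)"
    by (rule nn_integral_sph_uminus) measurable
  also have "\<dots> = (\<integral>\<^sup>+p. H p \<partial>ph_coll)"
    by (rule nn_integral_ph_coll[symmetric]) measurable
  finally show ?thesis .
qed

lemma distr_coll: "distr ph_coll ph_coll coll = ph_coll"
proof (rule measure_eqI)
  fix A assume "A \<in> sets (distr ph_coll ph_coll coll)"
  then have A [measurable]: "A \<in> sets ph_coll" by simp
  have "emeasure (distr ph_coll ph_coll coll) A = (\<integral>\<^sup>+p. indicator A p \<partial>distr ph_coll ph_coll coll)"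
    by (rule nn_integral_indicator[symmetric]) (simp only: sets_distr A)
  also have "\<dots> = (\<integral>\<^sup>+p. indicator A (coll p) \<partial>ph_coll)"
    by (rule nn_integral_distr) measurable
  also have "\<dots> = (\<integral>\<^sup>+p. indicator A p \<partial>ph_coll)"
    by (rule nn_integral_coll) measurable
  also have "\<dots> = emeasure ph_coll A"
    by (rule nn_integral_indicator[OF A])
  finally show "emeasure (distr ph_coll ph_coll coll) A = emeasure ph_coll A" .
qed simp

text \<open>Transports null sets from pre-collisional to post-collisional data. The gain term needs
  this, since it evaluates a density at the state before the collision.\<close>

lemma AE_coll: "AE p in ph_coll. P p \<Longrightarrow> AE p in ph_coll. P (coll p)"
  by (rule AE_distrD[OF coll_measurable]) (subst distr_coll)

section \<open>An integrable envelope of the background\<close>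

text \<open>A closed set that contains almost every point of the open cube contains the open cube,
  hence also its closure, in which the half-open cell lies.\<close>

lemma closed_cell_AE:
  fixes C :: "r3 set"
  assumes "closed C" and "AE x in lborel. x \<in> cell \<longrightarrow> x \<in> C" and "x \<in> cell"
  shows "x \<in> C"
proof -
  have box: "box 0 (1::r3) \<subseteq> cell" by (auto simp: mem_box_cart cell_def less_imp_le)
  have "AE x \<in> box 0 (1::r3) in lebesgue. x \<in> C"
    using assms(2) box by (intro AE_completion) auto
  then have "box 0 (1::r3) \<subseteq> C"
    using mem_closed_if_AE_lebesgue_open[OF open_box assms(1)] by blast
  then have "closure (box 0 (1::r3)) \<subseteq> C"
    using assms(1) by (simp add: closure_minimal)
  moreover have "(1/2) *\<^sub>R 1 \<in> box 0 (1::r3)" by (simp add: mem_box_cart)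
  then have "box 0 (1::r3) \<noteq> {}" by blast
  then have "closure (box 0 (1::r3)) = cbox 0 1" by (rule closure_box)
  moreover have "cell \<subseteq> cbox 0 (1::r3)" by (auto simp: mem_box_cart cell_def less_imp_le)
  ultimately show ?thesis using assms(3) by blast
qed

lemma periodic_closed_AE:
  fixes h :: "r3 \<Rightarrow> 'a::topological_space"
  assumes "periodic h" "closed {x. P (h x)}" "AE x in lborel. x \<in> cell \<longrightarrow> P (h x)"
  shows "P (h x)"
  using closed_cell_AE[OF assms(2), of "torus_rep x"] assms(3) torus_rep_in_cell[of x]
    periodic_torus_rep[OF assms(1), of x] by simp

text \<open>Composition with \<open>torus_rep\<close> only uses values on the cell, where
  measurability is given, and by periodicity it does not change the function.\<close>

lemma x_periodic_borel_measurable: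
  assumes "x_periodic h" and "h \<in> borel_measurable phase_measure"
  shows "h \<in> borel_measurable (borel :: phase measure)"
proof -
  have "(\<lambda>z. (torus_rep (fst z), snd z)) \<in> borel \<rightarrow>\<^sub>M phase_measure"
    unfolding phase_measure_def
    by (rule measurable_restrict_space2) (auto simp: torus_rep_in_cell)
  from measurable_compose[OF this assms(2)]
  have "(\<lambda>z. h (torus_rep (fst z), snd z)) \<in> borel_measurable borel" .
  moreover have "h (torus_rep x, v) = h (x, v)" for x v
    using assms(1) periodic_torus_rep[of "\<lambda>x. h (x, v)"] by (simp add: x_periodic_def)
  ultimately show ?thesis by simp
qed

lemma AE_phase_measure_slices:
  assumes "AE z in phase_measure. P z" and "Measurable.pred borel P"
  shows "AE v in lborel. AE x in lborel. x \<in> cell \<longrightarrow> P (x, v)"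
proof -
  have [measurable]: "Measurable.pred (lborel \<Otimes>\<^sub>M lborel) P"
    using assms(2) by (simp add: lborel_prod)
  have "AE z in lborel. z \<in> cell \<times> UNIV \<longrightarrow> P z"
    using assms(1) unfolding phase_measure_def by (subst (asm) AE_restrict_space_iff) auto
  then have "AE z in lborel \<Otimes>\<^sub>M lborel. fst z \<in> cell \<longrightarrow> P z"
    unfolding lborel_prod by (simp add: mem_Times_iff)
  then have "AE x in lborel. AE v in lborel. x \<in> cell \<longrightarrow> P (x, v)"
    using lborel_pair.AE_pair by fastforce
  moreover have [measurable]: "Measurable.pred (lborel \<Otimes>\<^sub>M lborel) (\<lambda>p. P (snd p, fst p))"
    by (rule measurable_compose[of "\<lambda>p. (snd p, fst p)" _ "lborel \<Otimes>\<^sub>M lborel" P]) measurable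
  ultimately show ?thesis
    by (subst lborel_pair.AE_commute) (measurable, simp_all add: borel_prod)
qed

lemma powr_holder_continuous:
  fixes h :: "'a::real_normed_vector \<Rightarrow> real"
  assumes "0 < \<alpha>" and H: "\<And>x y. x \<noteq> y \<Longrightarrow> \<bar>h x - h y\<bar> < M * norm (x - y) powr \<alpha>"
  shows "continuous_on UNIV h"
proof -
  have "isCont h x" for x
  proof -
    have "((\<lambda>y. norm (y - x) powr \<alpha>) \<longlongrightarrow> 0) (at x)"
      using assms(1) by (intro tendsto_zero_powrI tendsto_norm_zero LIM_zero) (auto intro: tendsto_intros)
    then have "((\<lambda>y. M * norm (y - x) powr \<alpha>) \<longlongrightarrow> 0) (at x)"
      by (rule tendsto_mult_right_zero)
    moreover have "\<forall>\<^sub>F y in at x. norm (h y - h x) \<le> M * norm (y - x) powr \<alpha>"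
      unfolding eventually_at_filter by (intro always_eventually allI impI) (simp add: H less_imp_le)
    ultimately have "((\<lambda>y. h y - h x) \<longlongrightarrow> 0) (at x)"
      by (rule Lim_null_comparison[rotated])
    then show ?thesis by (simp add: isCont_def LIM_zero_iff)
  qed
  then show ?thesis by (simp add: continuous_on_eq_continuous_at)
qed

text \<open>\<open>gbar\<close> need not be measurable, so its integral bounds are transferred to the supremum over a
  countable dense set, which agrees with it almost everywhere.\<close>

lemma background_admissible_envelope:
  assumes "background_admissible g0"
  obtains G :: "r3 \<Rightarrow> real" and N :: "r3 set" and C :: real
  where "g0 \<in> borel_measurable borel" "x_periodic g0" "G \<in> borel_measurable borel" "\<And>w. 0 \<le> G w"
    "N \<in> null_sets lborel"
    "\<And>w. w \<notin> N \<Longrightarrow> continuous_on UNIV (\<lambda>x. g0 (x, w))"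
    "\<And>x w. w \<notin> N \<Longrightarrow> 0 \<le> g0 (x, w)"
    "\<And>x w. w \<notin> N \<Longrightarrow> g0 (x, w) \<le> G w"
    "0 \<le> C" "(\<integral>\<^sup>+w. ennreal (G w * (1 + (norm w)\<^sup>2)) \<partial>lborel) \<le> ennreal C"
proof -
  from assms have per: "x_periodic g0" and pd: "prob_density phase_measure g0"
    and fin: "(\<integral>\<^sup>+v. gbar g0 v * ennreal (1 + (norm v)\<^sup>2) \<partial>lborel) < \<infinity>"
    by (auto simp: background_admissible_def)
  from assms obtain M \<alpha> where "\<alpha> > 0"
    and H: "AE v in lborel. \<forall>x y. x \<noteq> y \<longrightarrow> \<bar>g0 (x, v) - g0 (y, v)\<bar> < M * norm (x - y) powr \<alpha>"
    by (auto simp: background_admissible_def)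
  have per': "periodic (\<lambda>x. g0 (x, w))" for w using per by (simp add: x_periodic_def)
  have g0 [measurable]: "g0 \<in> borel_measurable borel"
    using pd by (intro x_periodic_borel_measurable per) (auto simp: prob_density_def)
  have cont: "AE w in lborel. continuous_on UNIV (\<lambda>x. g0 (x, w))"
    using H by eventually_elim (rule powr_holder_continuous[OF \<open>\<alpha> > 0\<close>], auto)
  have pos: "AE w in lborel. \<forall>x. 0 \<le> g0 (x, w)"
  proof -
    have "AE w in lborel. AE x in lborel. x \<in> cell \<longrightarrow> 0 \<le> g0 (x, w)"
      using pd by (intro AE_phase_measure_slices) (auto simp: prob_density_def)
    with cont show ?thesis
    proof eventually_elim
      case (elim w)
      have "closed {x. 0 \<le> g0 (x, w)}" using elim(1) by (intro closed_Collect_le) auto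
      from periodic_closed_AE[OF per' this elim(2)] show ?case by blast
    qed
  qed
  obtain D :: "r3 set" where D: "countable D" "\<And>X. open X \<Longrightarrow> X \<noteq> {} \<Longrightarrow> \<exists>d\<in>D. d \<in> X"
    using countable_dense_setE by blast
  define gs where "gs w = (SUP q\<in>D. ennreal (g0 (q, w)))" for w
  have gs [measurable]: "gs \<in> borel_measurable borel"
    unfolding gs_def using D(1) by (intro borel_measurable_SUP) auto
  have le_gs: "AE w in lborel. \<forall>x. ennreal (g0 (x, w)) \<le> gs w"
    using cont
  proof eventually_elim
    case (elim w)
    \<comment> \<open>If the bound failed somewhere, it would fail on a nonempty open set, hence at
      a point of the dense set over which \<open>gs\<close> is the supremum.\<close>
    have op: "open {x. gs w < ennreal (g0 (x, w))}"
      using elim by (intro open_Collect_less continuous_on_ennreal) auto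
    show ?case
    proof (rule ccontr)
      assume "\<not> (\<forall>x. ennreal (g0 (x, w)) \<le> gs w)"
      then have "{x. gs w < ennreal (g0 (x, w))} \<noteq> {}" by (auto simp: not_le)
      from D(2)[OF op this] obtain d where "d \<in> D" "gs w < ennreal (g0 (d, w))" by blast
      moreover have "ennreal (g0 (d, w)) \<le> gs w" unfolding gs_def using \<open>d \<in> D\<close> by (rule SUP_upper)
      ultimately show False by simp
    qed
  qed
  have gs_le: "AE w in lborel. gs w \<le> gbar g0 w"
    using cont
  proof eventually_elim
    case (elim w)
    have "AE x in cell_measure. ennreal (g0 (x, w)) \<le> gbar g0 w"
      unfolding gbar_def by (rule esssup_AE)
    then have ae: "AE x in lborel. x \<in> cell \<longrightarrow> ennreal (g0 (x, w)) \<le> gbar g0 w"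
      unfolding cell_measure_def by (subst (asm) AE_restrict_space_iff) auto
    \<comment> \<open>An essential supremum bounds only almost every x. Continuity of the slice
      extends the bound to all x, in particular to the countable dense set.\<close>
    have "closed {x. ennreal (g0 (x, w)) \<le> gbar g0 w}"
      using elim by (intro closed_Collect_le continuous_on_ennreal) auto
    then have "ennreal (g0 (x, w)) \<le> gbar g0 w" for x
      using ae by (rule periodic_closed_AE[OF per', where P="\<lambda>y. ennreal y \<le> gbar g0 w"])
    then show ?case unfolding gs_def by (intro SUP_least)
  qed
  have fin': "(\<integral>\<^sup>+w. gs w * ennreal (1 + (norm w)\<^sup>2) \<partial>lborel) < \<infinity>"
    by (rule le_less_trans[OF _ fin], rule nn_integral_mono_AE, use gs_le in eventually_elim)
       (rule mult_right_mono, auto)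
  have "AE w in lborel. gs w * ennreal (1 + (norm w)\<^sup>2) \<noteq> \<infinity>"
    using fin' by (intro nn_integral_noteq_infinite) auto
  then have gs_fin: "AE w in lborel. gs w \<noteq> \<infinity>"
    by eventually_elim (auto simp: ennreal_mult_eq_top_iff)
  define good where "good w \<longleftrightarrow> continuous_on UNIV (\<lambda>x. g0 (x, w)) \<and> (\<forall>x. 0 \<le> g0 (x, w)) \<and>
    (\<forall>x. g0 (x, w) \<le> enn2real (gs w))" for w
  have "AE w in lborel. good w"
    using cont pos le_gs gs_fin
  proof eventually_elim
    case (elim w)
    then have "g0 (x, w) \<le> enn2real (gs w)" for x
      using enn2real_mono[of "ennreal (g0 (x, w))" "gs w"] by (auto simp: less_top)
    with elim show ?case by (simp add: good_def)
  qed
  then obtain N where N: "N \<in> null_sets lborel" "\<And>w. w \<in> space lborel - N \<Longrightarrow> good w"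
    by (rule AE_E3) blast
  have N': "good w" if "w \<notin> N" for w
    using N(2)[of w] that by simp
  have eq: "(\<integral>\<^sup>+w. ennreal (enn2real (gs w) * (1 + (norm w)\<^sup>2)) \<partial>lborel) \<le> (\<integral>\<^sup>+w. gs w * ennreal (1 + (norm w)\<^sup>2) \<partial>lborel)"
    by (rule nn_integral_mono_AE, use gs_fin in eventually_elim)
       (simp add: ennreal_mult less_top)
  show thesis
  proof (rule that[of "\<lambda>w. enn2real (gs w)" N "enn2real (\<integral>\<^sup>+w. gs w * ennreal (1 + (norm w)\<^sup>2) \<partial>lborel)"])
    show "(\<integral>\<^sup>+w. ennreal (enn2real (gs w) * (1 + (norm w)\<^sup>2)) \<partial>lborel) \<le>
      ennreal (enn2real (\<integral>\<^sup>+w. gs w * ennreal (1 + (norm w)\<^sup>2) \<partial>lborel))"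
      using eq fin' by (simp add: less_top)
    show "(\<lambda>w. enn2real (gs w)) \<in> borel_measurable borel" by measurable
  qed (use N(1) N' per g0 in \<open>simp_all add: good_def\<close>)
qed

section \<open>Loss rates\<close>

lemma borel_measurable_set_interval_integral [measurable (raw)]:
  fixes f :: "'a \<Rightarrow> real \<Rightarrow> real"
  assumes [measurable]: "a \<in> borel_measurable M" "b \<in> borel_measurable M"
    "(\<lambda>p. f (fst p) (snd p)) \<in> borel_measurable (M \<Otimes>\<^sub>M lborel)"
  shows "(\<lambda>x. LINT \<sigma>:{a x..b x}|lborel. f x \<sigma>) \<in> borel_measurable M"
proof -
  have "(\<lambda>x. LINT \<sigma>:{a x..b x}|lborel. f x \<sigma>) =
    (\<lambda>x. \<integral>\<sigma>. (if a x \<le> \<sigma> \<and> \<sigma> \<le> b x then f x \<sigma> else 0) \<partial>lborel)"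
    unfolding set_lebesgue_integral_def by (intro ext Bochner_Integration.integral_cong) auto
  also have "\<dots> \<in> borel_measurable M"
    by (rule lborel.borel_measurable_lebesgue_integral) measurable
  finally show ?thesis .
qed

lemma set_integral_interval_continuous:
  fixes a :: "real \<Rightarrow> real"
  assumes "continuous_on UNIV a"
  shows "(LINT \<sigma>:{s..t}|lborel. a \<sigma>) = integral {s..t} a"
  by (rule set_borel_integral_eq_integral(2)[OF borel_integrable_atLeastAtMost'])
     (rule continuous_on_subset[OF assms], simp)

lemma set_integral_has_derivative:
  fixes a :: "real \<Rightarrow> real"
  assumes "continuous_on UNIV a" "s \<le> r" "r \<le> t"
  shows "((\<lambda>r. LINT \<sigma>:{s..r}|lborel. a \<sigma>) has_real_derivative a r) (at r within {s..t})"
  unfolding set_integral_interval_continuous[OF assms(1)]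
  using assms by (intro integral_has_real_derivative continuous_on_subset[OF assms(1)]) auto

lemma set_integral_interval_combine:
  fixes a :: "real \<Rightarrow> real"
  assumes "continuous_on UNIV a" "s \<le> r" "r \<le> t"
  shows "(LINT \<sigma>:{s..r}|lborel. a \<sigma>) + (LINT \<sigma>:{r..t}|lborel. a \<sigma>) = (LINT \<sigma>:{s..t}|lborel. a \<sigma>)"
  unfolding set_integral_interval_continuous[OF assms(1)]
  using assms(2,3)
  by (intro Henstock_Kurzweil_Integration.integral_combine integrable_continuous_interval continuous_on_subset[OF assms(1)]) auto

text \<open>The rate times the survival probability is minus the derivative of the survival
  probability: a waiting time with hazard rate \<open>a\<close> either exceeds t or has this density
  on [s, t]. It is the source of all conservation laws below.\<close>

lemma exp_survival_plus_rate:
  fixes a :: "real \<Rightarrow> real"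
  assumes cont: "continuous_on UNIV a" and pos: "\<And>r. 0 \<le> a r" and "s \<le> t"
  shows "ennreal (exp (- (LINT \<sigma>:{s..t}|lborel. a \<sigma>))) +
    (\<integral>\<^sup>+r. ennreal (a r * exp (- (LINT \<sigma>:{s..r}|lborel. a \<sigma>))) * indicator {s..t} r \<partial>lborel) = 1"
proof -
  have [measurable]: "a \<in> borel_measurable borel" using cont by (rule borel_measurable_continuous_onI)
  let ?F = "\<lambda>r. - exp (- (LINT \<sigma>:{s..r}|lborel. a \<sigma>))"
  have hb: "has_bochner_integral lborel (\<lambda>r. indicator {s..t} r *\<^sub>R (a r * exp (- (LINT \<sigma>:{s..r}|lborel. a \<sigma>)))) (?F t - ?F s)"
  proof (rule has_bochner_integral_FTC_Icc)
    fix r assume r: "s \<le> r" "r \<le> t"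
    show "(?F has_vector_derivative a r * exp (- (LINT \<sigma>:{s..r}|lborel. a \<sigma>))) (at r within {s..t})"
      unfolding has_real_derivative_iff_has_vector_derivative[symmetric]
      by (rule derivative_eq_intros refl set_integral_has_derivative[OF cont r])+ simp
  next
    have "continuous_on {s..t} (\<lambda>r. LINT \<sigma>:{s..r}|lborel. a \<sigma>)"
      using set_integral_has_derivative[OF cont, of s _ t]
      by (intro DERIV_continuous_on) auto
    then show "continuous_on {s..t} (\<lambda>r. a r * exp (- (LINT \<sigma>:{s..r}|lborel. a \<sigma>)))"
      by (intro continuous_intros continuous_on_subset[OF cont]) auto
  qed (use \<open>s \<le> t\<close> in auto)
  have "(\<integral>\<^sup>+r. ennreal (a r * exp (- (LINT \<sigma>:{s..r}|lborel. a \<sigma>))) * indicator {s..t} r \<partial>lborel) =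
    (\<integral>\<^sup>+r. ennreal (indicator {s..t} r *\<^sub>R (a r * exp (- (LINT \<sigma>:{s..r}|lborel. a \<sigma>)))) \<partial>lborel)"
    by (intro nn_integral_cong) (simp add: indicator_def)
  also have "\<dots> = ?F t - ?F s"
    using hb pos by (subst nn_integral_eq_integral) (auto simp: has_bochner_integral_iff)
  also have "?F t - ?F s = 1 - exp (- (LINT \<sigma>:{s..t}|lborel. a \<sigma>))"
    using set_integral_interval_continuous[OF cont, of s s] by simp
  finally have "ennreal (exp (- (LINT \<sigma>:{s..t}|lborel. a \<sigma>))) +
    (\<integral>\<^sup>+r. ennreal (a r * exp (- (LINT \<sigma>:{s..r}|lborel. a \<sigma>))) * indicator {s..t} r \<partial>lborel) =
    ennreal (exp (- (LINT \<sigma>:{s..t}|lborel. a \<sigma>))) + ennreal (1 - exp (- (LINT \<sigma>:{s..t}|lborel. a \<sigma>)))" by simp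
  also have "\<dots> = 1"
  proof -
    have "0 \<le> (LINT \<sigma>:{s..t}|lborel. a \<sigma>)"
      unfolding set_lebesgue_integral_def using pos by (intro integral_nonneg_AE) auto
    then show ?thesis by (subst ennreal_plus[symmetric]) auto
  qed
  finally show ?thesis .
qed

lemma nn_integral_params_snd:
  assumes [measurable]: "h \<in> borel_measurable borel"
  shows "(\<integral>\<^sup>+q. h (snd q) \<partial>(sph \<Otimes>\<^sub>M lborel)) = ennreal (4 * pi) * (\<integral>\<^sup>+w. h (w :: r3) \<partial>lborel)"
  by (subst lborel.nn_integral_fst[symmetric]) (auto simp: emeasure_sph mult.commute)

text \<open>\<open>G\<close> is a measurable envelope of the background density and \<open>N\<close> the null set of velocities where
  the slices of \<open>g0\<close> need not be continuous or nonnegative.\<close>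

locale background =
  fixes g0 :: "phase \<Rightarrow> real" and G :: "r3 \<Rightarrow> real" and N :: "r3 set" and C0 :: real
  assumes g0_measurable [measurable]: "g0 \<in> borel_measurable borel"
    and g0_periodic: "x_periodic g0"
    and G_measurable [measurable]: "G \<in> borel_measurable borel"
    and G_nonneg: "0 \<le> G w"
    and N_null: "N \<in> null_sets lborel"
    and g0_continuous: "w \<notin> N \<Longrightarrow> continuous_on UNIV (\<lambda>x. g0 (x, w))"
    and g0_nonneg: "w \<notin> N \<Longrightarrow> 0 \<le> g0 (x, w)"
    and g0_le_G: "w \<notin> N \<Longrightarrow> g0 (x, w) \<le> G w"
    and C0_nonneg: "0 \<le> C0"
    and G_moment: "(\<integral>\<^sup>+w. ennreal (G w * (1 + (norm w)\<^sup>2)) \<partial>lborel) \<le> ennreal C0"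
begin

text \<open>The collision rate per parameter \<open>q = (\<nu>, w)\<close>, with the free transport
  of the background written out. It is the integrand of \<open>Sigma_rate\<close>, and it is also
  the factor that a new collision contributes to a tree.\<close>

definition kernel :: "real \<Rightarrow> real \<Rightarrow> phase \<Rightarrow> r3 \<times> r3 \<Rightarrow> real" where
  "kernel \<epsilon> s z q = g0 (fst z + \<epsilon> *\<^sub>R fst q - s *\<^sub>R snd q, snd q) * max ((snd z - snd q) \<bullet> fst q) 0"

lemma kernel_measurable [measurable (raw)]:
  assumes [measurable]: "e \<in> borel_measurable M" "s \<in> borel_measurable M"
    "(\<lambda>x. fst (z x)) \<in> borel_measurable M" "(\<lambda>x. snd (z x)) \<in> borel_measurable M"
    "(\<lambda>x. fst (q x)) \<in> borel_measurable M" "(\<lambda>x. snd (q x)) \<in> borel_measurable M"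
  shows "(\<lambda>x. kernel (e x) (s x) (z x) (q x)) \<in> borel_measurable M"
  unfolding kernel_def by measurable

lemma N_measurable [measurable]: "N \<in> sets borel"
  using N_null by auto

lemma AE_params: "AE q in sph \<Otimes>\<^sub>M lborel. norm (fst q) = 1 \<and> snd q \<notin> N"
proof (rule sph_lborel.AE_pair_measure)
  show "AE \<nu> in sph. AE w in lborel. norm (fst (\<nu>, w)) = 1 \<and> snd (\<nu>, w) \<notin> N"
    using AE_sph AE_not_in[OF N_null] by auto
qed measurable

lemma kernel_nonneg: "snd q \<notin> N \<Longrightarrow> 0 \<le> kernel \<epsilon> s z q"
  by (simp add: kernel_def g0_nonneg)

lemma max_inner_le: "norm \<nu> = 1 \<Longrightarrow> max ((v - w) \<bullet> \<nu>) 0 \<le> norm v + norm (w :: r3)"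
  using Cauchy_Schwarz_ineq2[of "v - w" \<nu>] norm_triangle_ineq4[of v w] by (auto simp: abs_le_iff)

lemma kernel_le: 
  assumes "norm (fst q) = 1" "snd q \<notin> N"
  shows "kernel \<epsilon> s z q \<le> G (snd q) * (norm (snd z) + norm (snd q))"
  unfolding kernel_def using assms by (intro mult_mono g0_le_G max_inner_le G_nonneg) auto

lemma nn_integral_G_linear:
  assumes "0 \<le> b"
  shows "(\<integral>\<^sup>+q. ennreal (G (snd q) * (b + norm (snd q))) \<partial>(sph \<Otimes>\<^sub>M lborel)) \<le> ennreal (4 * pi * C0 * (1 + b))"
proof -
  have eq: "(\<integral>\<^sup>+q. ennreal (G (snd q) * (b + norm (snd q))) \<partial>(sph \<Otimes>\<^sub>M lborel)) =
     ennreal (4 * pi) * (\<integral>\<^sup>+w. ennreal (G w * (b + norm w)) \<partial>lborel)"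
    by (rule nn_integral_params_snd) measurable
  have "(\<integral>\<^sup>+w. ennreal (G w * (b + norm w)) \<partial>lborel) \<le> (\<integral>\<^sup>+w. ennreal (1 + b) * ennreal (G w * (1 + (norm w)\<^sup>2)) \<partial>lborel)"
  proof (rule nn_integral_mono)
    fix w :: r3
    \<comment> \<open>Yields b + |w| \<le> (1 + b) (1 + |w|^2), which reduces the linear weight to
      the moment bounded by \<open>C0\<close>.\<close>
    have "0 \<le> (norm w - 1)\<^sup>2" by simp
    then have "2 * norm w \<le> (norm w)\<^sup>2 + 1" by (simp add: power2_diff)
    then have "norm w \<le> 1 + (norm w)\<^sup>2" using norm_ge_zero[of w] by linarith
    then have "G w * (b + norm w) \<le> G w * ((1 + b) * (1 + (norm w)\<^sup>2))"
      using mult_nonneg_nonneg[OF assms zero_le_power2[of "norm w"]]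
      by (intro mult_left_mono G_nonneg) (simp add: algebra_simps)
    then show "ennreal (G w * (b + norm w)) \<le> ennreal (1 + b) * ennreal (G w * (1 + (norm w)\<^sup>2))"
      using assms by (subst ennreal_mult'[symmetric]) (auto intro!: ennreal_leI simp: mult_ac)
  qed
  also have "\<dots> = ennreal (1 + b) * (\<integral>\<^sup>+w. ennreal (G w * (1 + (norm w)\<^sup>2)) \<partial>lborel)"
    by (rule nn_integral_cmult) measurable
  also have "\<dots> \<le> ennreal (1 + b) * ennreal C0" by (intro mult_left_mono G_moment) simp
  finally show ?thesis
    unfolding eq using assms C0_nonneg mult_left_mono[of _ _ "ennreal (4 * pi)"]
    by (fastforce simp: ennreal_mult mult_ac)
qed

lemma nn_integral_G_square:
  "(\<integral>\<^sup>+q. ennreal (G (snd q) * (norm (snd q))\<^sup>2) \<partial>(sph \<Otimes>\<^sub>M lborel)) \<le> ennreal (4 * pi * C0)"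
proof -
  have eq: "(\<integral>\<^sup>+q. ennreal (G (snd q) * (norm (snd q))\<^sup>2) \<partial>(sph \<Otimes>\<^sub>M lborel)) =
     ennreal (4 * pi) * (\<integral>\<^sup>+w. ennreal (G w * (norm w)\<^sup>2) \<partial>lborel)"
    by (rule nn_integral_params_snd) measurable
  have "(\<integral>\<^sup>+w. ennreal (G w * (norm w)\<^sup>2) \<partial>lborel) \<le> (\<integral>\<^sup>+w. ennreal (G w * (1 + (norm w)\<^sup>2)) \<partial>lborel)"
    by (intro nn_integral_mono ennreal_leI mult_left_mono G_nonneg) simp
  also have "\<dots> \<le> ennreal C0" by (rule G_moment)
  finally show ?thesis
    unfolding eq using C0_nonneg by (simp add: mult_left_mono ennreal_mult)
qed

lemma integrable_G_linear:
  assumes "0 \<le> b"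
  shows "integrable (sph \<Otimes>\<^sub>M lborel) (\<lambda>q. G (snd q) * (b + norm (snd q)))"
  using nn_integral_G_linear[OF assms] assms
  by (intro integrableI_nonneg) (auto simp: G_nonneg intro: le_less_trans)

lemma Sigma_rate_eq: "Sigma_rate g0 \<epsilon> s z = (\<integral>q. kernel \<epsilon> s z q \<partial>(sph \<Otimes>\<^sub>M lborel))"
proof -
  have "Sigma_rate g0 \<epsilon> s z = (\<integral>q. kernel \<epsilon> s z q \<partial>(sphere_measure \<Otimes>\<^sub>M lborel))"
    by (cases z) (simp add: Sigma_rate_def kernel_def transport_def case_prod_unfold)
  also have "\<dots> = (\<integral>q. kernel \<epsilon> s z q \<partial>distr (sphere_measure \<Otimes>\<^sub>M lborel) (borel \<Otimes>\<^sub>M borel) (\<lambda>x. x))"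
    by (subst integral_distr[OF sphere_lborel_ident]) simp_all
  finally show ?thesis by (simp add: distr_sphere_lborel)
qed

lemma nn_integral_kernel_le: "(\<integral>\<^sup>+q. ennreal (kernel \<epsilon> s z q) \<partial>(sph \<Otimes>\<^sub>M lborel)) \<le> ennreal (4 * pi * C0 * (1 + norm (snd z)))"
proof -
  have "(\<integral>\<^sup>+q. ennreal (kernel \<epsilon> s z q) \<partial>(sph \<Otimes>\<^sub>M lborel)) \<le>
    (\<integral>\<^sup>+q. ennreal (G (snd q) * (norm (snd z) + norm (snd q))) \<partial>(sph \<Otimes>\<^sub>M lborel))"
    by (rule nn_integral_mono_AE, use AE_params in eventually_elim) (auto intro!: ennreal_leI kernel_le)
  also note nn_integral_G_linear
  finally show ?thesis by simp
qed

lemma integrable_kernel: "integrable (sph \<Otimes>\<^sub>M lborel) (kernel \<epsilon> s z)"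
proof (rule integrableI_nonneg)
  show "AE q in sph \<Otimes>\<^sub>M lborel. 0 \<le> kernel \<epsilon> s z q"
    using AE_params by eventually_elim (simp add: kernel_nonneg)
  show "(\<integral>\<^sup>+q. ennreal (kernel \<epsilon> s z q) \<partial>(sph \<Otimes>\<^sub>M lborel)) < \<infinity>"
    using nn_integral_kernel_le[of \<epsilon> s z] by (auto intro: le_less_trans)
qed measurable

lemma ennreal_Sigma_rate: "ennreal (Sigma_rate g0 \<epsilon> s z) = (\<integral>\<^sup>+q. ennreal (kernel \<epsilon> s z q) \<partial>(sph \<Otimes>\<^sub>M lborel))"
  unfolding Sigma_rate_eq
  by (rule nn_integral_eq_integral[symmetric, OF integrable_kernel], use AE_params in eventually_elim)
     (simp add: kernel_nonneg)

lemma Sigma_rate_nonneg: "0 \<le> Sigma_rate g0 \<epsilon> s z"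
  unfolding Sigma_rate_eq
  by (rule integral_nonneg_AE, use AE_params in eventually_elim) (simp add: kernel_nonneg)

lemma Sigma_rate_le: "Sigma_rate g0 \<epsilon> s z \<le> 4 * pi * C0 * (1 + norm (snd z))"
  using nn_integral_kernel_le[of \<epsilon> s z] C0_nonneg unfolding ennreal_Sigma_rate[symmetric]
  by (subst (asm) ennreal_le_iff) auto

lemma Sigma_rate_measurable [measurable (raw)]:
  assumes [measurable]: "e \<in> borel_measurable M" "s \<in> borel_measurable M"
    "(\<lambda>x. fst (z x)) \<in> borel_measurable M" "(\<lambda>x. snd (z x)) \<in> borel_measurable M"
  shows "(\<lambda>x. Sigma_rate g0 (e x) (s x) (z x)) \<in> borel_measurable M"
  unfolding Sigma_rate_eq by measurable

lemma kernel_shift: "k \<in> lattice \<Longrightarrow> kernel \<epsilon> s (x + k, v) q = kernel \<epsilon> s (x, v) q"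
proof -
  assume "k \<in> lattice"
  then have "g0 (x + \<epsilon> *\<^sub>R fst q - s *\<^sub>R snd q + k, snd q) = g0 (x + \<epsilon> *\<^sub>R fst q - s *\<^sub>R snd q, snd q)"
    using g0_periodic by (simp add: x_periodic_def periodic_def)
  then show ?thesis by (simp add: kernel_def algebra_simps)
qed

lemma Sigma_rate_shift: "k \<in> lattice \<Longrightarrow> Sigma_rate g0 \<epsilon> s (x + k, v) = Sigma_rate g0 \<epsilon> s (x, v)"
  by (simp add: Sigma_rate_eq kernel_shift)

text \<open>Dominated convergence. Off \<open>N\<close> the slices of \<open>g0\<close> are
  continuous, and since the velocity is fixed, the envelope gives one integrable majorant for all
  \<epsilon>, times and positions.\<close>

lemma Sigma_rate_tendsto:
  assumes "e \<longlonglongrightarrow> \<epsilon>" "s \<longlonglongrightarrow> \<sigma>" "x \<longlonglongrightarrow> y"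
  shows "(\<lambda>n. Sigma_rate g0 (e n) (s n) (x n, v)) \<longlonglongrightarrow> Sigma_rate g0 \<epsilon> \<sigma> (y, v)"
  unfolding Sigma_rate_eq
proof (rule integral_dominated_convergence)
  show "integrable (sph \<Otimes>\<^sub>M lborel) (\<lambda>q. G (snd q) * (norm v + norm (snd q)))"
    by (rule integrable_G_linear) simp
  show "AE q in sph \<Otimes>\<^sub>M lborel. (\<lambda>n. kernel (e n) (s n) (x n, v) q) \<longlonglongrightarrow> kernel \<epsilon> \<sigma> (y, v) q"
    using AE_params
  proof eventually_elim
    case (elim q)
    then have "continuous_on UNIV (\<lambda>x. g0 (x, snd q))" by (intro g0_continuous) simp
    then have "isCont (\<lambda>x. g0 (x, snd q)) (y + \<epsilon> *\<^sub>R fst q - \<sigma> *\<^sub>R snd q)"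
      by (simp add: continuous_on_eq_continuous_at)
    then have "(\<lambda>n. g0 (x n + e n *\<^sub>R fst q - s n *\<^sub>R snd q, snd q)) \<longlonglongrightarrow> g0 (y + \<epsilon> *\<^sub>R fst q - \<sigma> *\<^sub>R snd q, snd q)"
      by (rule isCont_tendsto_compose) (intro tendsto_intros assms)
    then show ?case unfolding kernel_def by (auto intro!: tendsto_intros)
  qed
  show "AE q in sph \<Otimes>\<^sub>M lborel. norm (kernel (e n) (s n) (x n, v) q) \<le> G (snd q) * (norm v + norm (snd q))" for n
    using AE_params by eventually_elim (use kernel_le[of _ "e n" "s n" "(x n, v)"] kernel_nonneg in auto)
qed measurable

text \<open>Continuity along straight lines is what makes the survival probability differentiable at
  every time of a free flight, not only at almost every time.\<close>

lemma Sigma_rate_continuous: "continuous_on UNIV (\<lambda>\<sigma>. Sigma_rate g0 \<epsilon> \<sigma> (x + \<sigma> *\<^sub>R u, v))"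
proof (rule continuous_at_imp_continuous_on, rule ballI)
  fix \<sigma> :: real
  show "isCont (\<lambda>\<sigma>. Sigma_rate g0 \<epsilon> \<sigma> (x + \<sigma> *\<^sub>R u, v)) \<sigma>"
    unfolding continuous_at_sequentially by (auto simp: comp_def intro!: Sigma_rate_tendsto tendsto_intros)
qed

end

section \<open>Survival along a free flight\<close>

context background
begin

text \<open>The probability that a particle that is at \<open>z\<close> at time \<open>t\<close> on a free flight had no collision in
  \<open>[s, t]\<close>. The base point is the end of the flight, as in \<open>evolution\<close>.\<close>

definition no_coll :: "real \<Rightarrow> real \<Rightarrow> real \<Rightarrow> phase \<Rightarrow> real" where
  "no_coll \<epsilon> s t z = exp (- (LINT \<sigma>:{s..t}|lborel. Sigma_rate g0 \<epsilon> \<sigma> (fst z - (t - \<sigma>) *\<^sub>R snd z, snd z)))"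

lemma evolution_eq: "evolution g0 \<epsilon> t s f z = no_coll \<epsilon> s t z * f (fst z - (t - s) *\<^sub>R snd z, snd z)"
  by (cases z) (simp add: evolution_def no_coll_def)

text \<open>With the end point written as \<open>x + t *\<^sub>R v\<close>, the integrand no longer
  depends on t, so that differentiation in t and splitting of the interval become
  elementary.\<close>

lemma no_coll_along:
  "no_coll \<epsilon> s t (x + t *\<^sub>R v, v) = exp (- (LINT \<sigma>:{s..t}|lborel. Sigma_rate g0 \<epsilon> \<sigma> (x + \<sigma> *\<^sub>R v, v)))"
  by (simp add: no_coll_def algebra_simps)

lemma no_coll_measurable [measurable (raw)]:
  assumes [measurable]: "e \<in> borel_measurable M" "s \<in> borel_measurable M" "t \<in> borel_measurable M"
    "(\<lambda>x. fst (z x)) \<in> borel_measurable M" "(\<lambda>x. snd (z x)) \<in> borel_measurable M"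
  shows "(\<lambda>x. no_coll (e x) (s x) (t x) (z x)) \<in> borel_measurable M"
  unfolding no_coll_def by measurable

lemma no_coll_pos: "0 < no_coll \<epsilon> s t z" by (simp add: no_coll_def)

lemma no_coll_refl: "no_coll \<epsilon> s s z = 1"
proof -
  have "no_coll \<epsilon> s s (x + s *\<^sub>R v, v) = 1" for x v
    unfolding no_coll_along set_integral_interval_continuous[OF Sigma_rate_continuous] by simp
  from this[of "fst z - s *\<^sub>R snd z" "snd z"] show ?thesis by simp
qed

lemma no_coll_shift: "k \<in> lattice \<Longrightarrow> no_coll \<epsilon> s t (x + k, v) = no_coll \<epsilon> s t (x, v)"
proof -
  assume "k \<in> lattice"
  then have "Sigma_rate g0 \<epsilon> \<sigma> (x + k - (t - \<sigma>) *\<^sub>R v, v) = Sigma_rate g0 \<epsilon> \<sigma> (x - (t - \<sigma>) *\<^sub>R v, v)" for \<sigma>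
    using Sigma_rate_shift[of k \<epsilon> \<sigma> "x - (t - \<sigma>) *\<^sub>R v" v] by (simp add: algebra_simps)
  then show ?thesis by (simp add: no_coll_def)
qed

lemma no_coll_survival:
  assumes "s \<le> t"
  shows "ennreal (no_coll \<epsilon> s t (x + (t - s) *\<^sub>R v, v)) +
    (\<integral>\<^sup>+r. ennreal (Sigma_rate g0 \<epsilon> r (x + (r - s) *\<^sub>R v, v) * no_coll \<epsilon> s r (x + (r - s) *\<^sub>R v, v)) * indicator {s..t} r \<partial>lborel) = 1"
proof -
  define y where "y = x - s *\<^sub>R v"
  have y: "x + (r - s) *\<^sub>R v = y + r *\<^sub>R v" for r by (simp add: y_def algebra_simps)
  show ?thesis unfolding y no_coll_along
    by (rule exp_survival_plus_rate[OF Sigma_rate_continuous Sigma_rate_nonneg assms])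
qed

lemma no_coll_has_derivative:
  assumes "s \<le> r" "r \<le> t"
  shows "((\<lambda>r. no_coll \<epsilon> s r (x + r *\<^sub>R v, v)) has_real_derivative
    - (no_coll \<epsilon> s r (x + r *\<^sub>R v, v) * Sigma_rate g0 \<epsilon> r (x + r *\<^sub>R v, v))) (at r within {s..t})"
  unfolding no_coll_along
  by (rule derivative_eq_intros refl set_integral_has_derivative[OF Sigma_rate_continuous assms])+ simp

lemma no_coll_split:
  assumes "s \<le> r" "r \<le> t"
  shows "no_coll \<epsilon> s t (x + t *\<^sub>R v, v) = no_coll \<epsilon> s r (x + r *\<^sub>R v, v) * no_coll \<epsilon> r t (x + t *\<^sub>R v, v)"
  unfolding no_coll_along set_integral_interval_combine[OF Sigma_rate_continuous assms, symmetric]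
  by (simp only: minus_add_distrib exp_add)

text \<open>From exp (- a) \<ge> 1 - a and the linear bound on the rate. The bound is uniform in
  \<epsilon> and is the origin of the Lipschitz constant in time.\<close>

lemma no_coll_ge:
  assumes "s \<le> t"
  shows "1 - 4 * pi * C0 * (1 + norm (snd z)) * (t - s) \<le> no_coll \<epsilon> s t z"
proof -
  let ?c = "4 * pi * C0 * (1 + norm (snd z))"
  define y where "y = fst z - t *\<^sub>R snd z"
  have z: "z = (y + t *\<^sub>R snd z, snd z)" by (simp add: y_def)
  let ?a = "\<lambda>\<sigma>. Sigma_rate g0 \<epsilon> \<sigma> (y + \<sigma> *\<^sub>R snd z, snd z)"
  have "(LINT \<sigma>:{s..t}|lborel. ?a \<sigma>) = integral {s..t} ?a"
    by (rule set_integral_interval_continuous[OF Sigma_rate_continuous])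
  also have "\<dots> \<le> integral {s..t} (\<lambda>_. ?c)"
    using Sigma_rate_le[of \<epsilon> _ "(_, snd z)"]
    by (intro integral_le integrable_continuous_interval continuous_on_subset[OF Sigma_rate_continuous]) auto
  also have "\<dots> = ?c * (t - s)" using assms by simp
  finally have "1 - ?c * (t - s) \<le> 1 - (LINT \<sigma>:{s..t}|lborel. ?a \<sigma>)" by simp
  also have "\<dots> \<le> no_coll \<epsilon> s t z"
    by (subst z, unfold no_coll_along) (use exp_ge_add_one_self[of "- (LINT \<sigma>:{s..t}|lborel. ?a \<sigma>)"] in simp)
  finally show ?thesis .
qed

lemma no_coll_tendsto:
  assumes "e \<longlonglongrightarrow> \<epsilon>"
  shows "(\<lambda>n. no_coll (e n) s t z) \<longlonglongrightarrow> no_coll \<epsilon> s t z"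
  unfolding no_coll_def set_lebesgue_integral_def
proof (intro tendsto_exp tendsto_minus integral_dominated_convergence)
  let ?c = "4 * pi * C0 * (1 + norm (snd z))"
  show "integrable lborel (\<lambda>\<sigma>. indicator {s..t} \<sigma> *\<^sub>R ?c)"
    by (rule borel_integrable_atLeastAtMost'[unfolded set_integrable_def]) auto
  show "AE \<sigma> in lborel. norm (indicator {s..t} \<sigma> *\<^sub>R Sigma_rate g0 (e n) \<sigma> (fst z - (t - \<sigma>) *\<^sub>R snd z, snd z)) \<le> indicator {s..t} \<sigma> *\<^sub>R ?c" for n
    using Sigma_rate_le[of "e n" _ "(_, snd z)"] Sigma_rate_nonneg by (auto simp: indicator_def)
  show "AE \<sigma> in lborel. (\<lambda>n. indicator {s..t} \<sigma> *\<^sub>R Sigma_rate g0 (e n) \<sigma> (fst z - (t - \<sigma>) *\<^sub>R snd z, snd z))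
    \<longlonglongrightarrow> indicator {s..t} \<sigma> *\<^sub>R Sigma_rate g0 \<epsilon> \<sigma> (fst z - (t - \<sigma>) *\<^sub>R snd z, snd z)"
    by (intro AE_I2 tendsto_intros Sigma_rate_tendsto assms)
qed measurable

end

section \<open>Densities of roots with a given number of collisions\<close>

definition flow :: "real \<Rightarrow> phase \<Rightarrow> phase" where
  "flow r z = (fst z + r *\<^sub>R snd z, snd z)"

text \<open>Collisions are reversible, so the same formula serves in both directions: on trees it
  produces the state after the collision, in \<open>gain\<close> the state before it.\<close>

definition post :: "phase \<Rightarrow> r3 \<times> r3 \<Rightarrow> phase" where
  "post z q = (fst z, snd z + (fst q \<bullet> (snd q - snd z)) *\<^sub>R fst q)"

text \<open>The parameters of the reversed collision: the opposite direction and the changed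
  velocity of the partner.\<close>

definition post_params :: "phase \<Rightarrow> r3 \<times> r3 \<Rightarrow> r3 \<times> r3" where
  "post_params z q = (- fst q, snd q - (fst q \<bullet> (snd q - snd z)) *\<^sub>R fst q)"

lemma fst_flow [simp]: "fst (flow r z) = fst z + r *\<^sub>R snd z"
  and snd_flow [simp]: "snd (flow r z) = snd z"
  and fst_post [simp]: "fst (post z q) = fst z"
  by (simp_all add: flow_def post_def)

lemma flow_flow [simp]: "flow r (flow s z) = flow (r + s) z"
  by (simp add: flow_def scaleR_add_left)

lemma flow_0 [simp]: "flow 0 z = z"
  by (simp add: flow_def)

lemma coll_eq: "coll (z, q) = (post z q, post_params z q)"
  by (cases z; cases q) (simp add: coll_def post_def post_params_def)

text \<open>The normal component of the relative velocity changes sign, so the second collision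
  takes back the multiple of \<nu> added by the first; the sign of \<nu> itself enters
  twice.\<close>

lemma post_involution:
  assumes "norm (fst q) = 1"
  shows "post (post z q) (post_params z q) = z"
proof -
  define c where "c = fst q \<bullet> (snd q - snd z)"
  have "fst q \<bullet> ((snd q - c *\<^sub>R fst q) - (snd z + c *\<^sub>R fst q)) = - c"
    using assms unfolding norm_eq_1 c_def
    by (simp only: inner_diff_right inner_add_right inner_scaleR_right) simp
  then show ?thesis by (simp add: post_def post_params_def c_def[symmetric])
qed

lemma flow_measurable [measurable (raw)]:
  assumes [measurable]: "r \<in> borel_measurable M" "(\<lambda>x. fst (z x)) \<in> borel_measurable M" "(\<lambda>x. snd (z x)) \<in> borel_measurable M"
  shows "(\<lambda>x. flow (r x) (z x)) \<in> borel_measurable M"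
  unfolding flow_def by measurable

lemma post_measurable [measurable (raw)]:
  assumes [measurable]: "(\<lambda>x. fst (z x)) \<in> borel_measurable M" "(\<lambda>x. snd (z x)) \<in> borel_measurable M"
    "(\<lambda>x. fst (q x)) \<in> borel_measurable M" "(\<lambda>x. snd (q x)) \<in> borel_measurable M"
  shows "(\<lambda>x. post (z x) (q x)) \<in> borel_measurable M"
  unfolding post_def by measurable

lemma post_params_measurable [measurable (raw)]:
  assumes [measurable]: "(\<lambda>x. fst (z x)) \<in> borel_measurable M" "(\<lambda>x. snd (z x)) \<in> borel_measurable M"
    "(\<lambda>x. fst (q x)) \<in> borel_measurable M" "(\<lambda>x. snd (q x)) \<in> borel_measurable M"
  shows "(\<lambda>x. post_params (z x) (q x)) \<in> borel_measurable M"
  unfolding post_params_def by measurable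

lemma AE_ph_coll: "AE p in ph_coll. norm (fst (snd p)) = 1"
proof (rule ph_sph_lborel.AE_pair_measure)
  have "AE q in sph \<Otimes>\<^sub>M (lborel :: r3 measure). norm (fst q) = 1"
    by (rule sph_lborel.AE_pair_measure) (measurable, use AE_sph in \<open>auto elim!: eventually_mono\<close>)
  then show "AE z in ph. AE q in sph \<Otimes>\<^sub>M (lborel :: r3 measure). norm (fst (snd (z, q))) = 1" by simp
qed measurable

lemma nn_integral_ph_flow:
  assumes [measurable]: "h \<in> borel_measurable borel" and "x_periodic h"
  shows "(\<integral>\<^sup>+z. h (flow r z) \<partial>ph) = (\<integral>\<^sup>+z. h z \<partial>ph)"
  unfolding flow_def by (rule nn_integral_ph_shift) (use assms in auto)

lemma x_periodic_iff: "x_periodic h \<longleftrightarrow> (\<forall>x v. \<forall>k\<in>lattice. h (x + k, v) = h (x, v))"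
  by (auto simp: x_periodic_def periodic_def)

lemma x_periodicD: "x_periodic h \<Longrightarrow> k \<in> lattice \<Longrightarrow> fst z' = fst z + k \<Longrightarrow> snd z' = snd z \<Longrightarrow> h z' = h z"
  by (cases z; cases z') (simp add: x_periodic_iff)

lemma x_periodicI: "(\<And>z z' k. k \<in> lattice \<Longrightarrow> fst z' = fst z + k \<Longrightarrow> snd z' = snd z \<Longrightarrow> h z' = h z) \<Longrightarrow> x_periodic h"
  unfolding x_periodic_iff by (metis fst_conv snd_conv)

section \<open>The gain term, its adjoint and Duhamel's recursion\<close>

context background
begin

lemma kernel_periodic: "k \<in> lattice \<Longrightarrow> fst z' = fst z + k \<Longrightarrow> snd z' = snd z \<Longrightarrow> kernel \<epsilon> s z' q = kernel \<epsilon> s z q"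
  using kernel_shift by (cases z; cases z') auto

lemma no_coll_periodic: "k \<in> lattice \<Longrightarrow> fst z' = fst z + k \<Longrightarrow> snd z' = snd z \<Longrightarrow> no_coll \<epsilon> s t z' = no_coll \<epsilon> s t z"
  using no_coll_shift by (cases z; cases z') auto

text \<open>The Boltzmann gain term written in pre-collisional variables. The minus sign in
  \<open>post_params\<close> puts the background particle at
  \<open>x - \<epsilon> *\<^sub>R \<nu>\<close>, in agreement with
  \<open>boltzmann_gain_integrand\<close>.\<close>

definition gain :: "real \<Rightarrow> real \<Rightarrow> (phase \<Rightarrow> ennreal) \<Rightarrow> phase \<Rightarrow> ennreal" where
  "gain \<epsilon> s f z = (\<integral>\<^sup>+q. f (post z q) * ennreal (kernel \<epsilon> s (post z q) (post_params z q)) \<partial>(sph \<Otimes>\<^sub>M lborel))"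

text \<open>The adjoint of \<open>gain\<close>: the value of the test function after a collision,
  weighted with the rate.\<close>

definition scatter :: "real \<Rightarrow> real \<Rightarrow> (phase \<Rightarrow> ennreal) \<Rightarrow> phase \<Rightarrow> ennreal" where
  "scatter \<epsilon> s \<phi> z = (\<integral>\<^sup>+q. ennreal (kernel \<epsilon> s z q) * \<phi> (post z q) \<partial>(sph \<Otimes>\<^sub>M lborel))"

text \<open>The adjoint of free flight with loss: it pulls a test function at time t back to the
  state at time s.\<close>

definition propagate :: "real \<Rightarrow> real \<Rightarrow> real \<Rightarrow> (phase \<Rightarrow> ennreal) \<Rightarrow> phase \<Rightarrow> ennreal" where
  "propagate \<epsilon> s t \<phi> z = ennreal (no_coll \<epsilon> s t (flow (t - s) z)) * \<phi> (flow (t - s) z)"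

lemma gain_measurable [measurable (raw)]:
  assumes [measurable]: "s \<in> borel_measurable M" 
    "(\<lambda>x. fst (z x)) \<in> borel_measurable M" "(\<lambda>x. snd (z x)) \<in> borel_measurable M"
    and f: "(\<lambda>p. f (fst p) (snd p)) \<in> borel_measurable (M \<Otimes>\<^sub>M borel)"
  shows "(\<lambda>x. gain \<epsilon> (s x) (f x) (z x)) \<in> borel_measurable M"
proof -
  have [measurable]: "(\<lambda>p. f (fst p) (post (z (fst p)) (snd p))) \<in> borel_measurable (M \<Otimes>\<^sub>M (sph \<Otimes>\<^sub>M lborel))"
    by (rule measurable_compose[OF _ f, of "\<lambda>p. (fst p, post (z (fst p)) (snd p))", simplified]) measurable
  show ?thesis unfolding gain_def by measurable
qed

lemma scatter_measurable [measurable (raw)]: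
  assumes [measurable]: "s \<in> borel_measurable M" 
    "(\<lambda>x. fst (z x)) \<in> borel_measurable M" "(\<lambda>x. snd (z x)) \<in> borel_measurable M"
    and f: "(\<lambda>p. f (fst p) (snd p)) \<in> borel_measurable (M \<Otimes>\<^sub>M borel)"
  shows "(\<lambda>x. scatter \<epsilon> (s x) (f x) (z x)) \<in> borel_measurable M"
proof -
  have [measurable]: "(\<lambda>p. f (fst p) (post (z (fst p)) (snd p))) \<in> borel_measurable (M \<Otimes>\<^sub>M (sph \<Otimes>\<^sub>M lborel))"
    by (rule measurable_compose[OF _ f, of "\<lambda>p. (fst p, post (z (fst p)) (snd p))", simplified]) measurable
  show ?thesis unfolding scatter_def by measurable
qed

lemma propagate_measurable [measurable (raw)]:
  assumes [measurable]: "s \<in> borel_measurable M" "t \<in> borel_measurable M"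
    "(\<lambda>x. fst (z x)) \<in> borel_measurable M" "(\<lambda>x. snd (z x)) \<in> borel_measurable M"
    and f: "(\<lambda>p. f (fst p) (snd p)) \<in> borel_measurable (M \<Otimes>\<^sub>M borel)"
  shows "(\<lambda>x. propagate \<epsilon> (s x) (t x) (f x) (z x)) \<in> borel_measurable M"
proof -
  have [measurable]: "(\<lambda>x. f x (flow (t x - s x) (z x))) \<in> borel_measurable M"
    by (rule measurable_compose[OF _ f, of "\<lambda>x. (x, flow (t x - s x) (z x))", simplified]) measurable
  show ?thesis unfolding propagate_def by measurable
qed

text \<open>The integrand on the left is \<open>H\<close> composed with the collision map, by
  \<open>post_involution\<close>, and that map preserves the measure.\<close>

lemma gain_dual:
  assumes [measurable]: "f \<in> borel_measurable borel" "\<phi> \<in> borel_measurable borel"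
  shows "(\<integral>\<^sup>+z. gain \<epsilon> s f z * \<phi> z \<partial>ph) = (\<integral>\<^sup>+z. f z * scatter \<epsilon> s \<phi> z \<partial>ph)"
proof -
  define H where "H p = f (fst p) * ennreal (kernel \<epsilon> s (fst p) (snd p)) * \<phi> (post (fst p) (snd p))" for p
  have H [measurable]: "H \<in> borel_measurable ph_coll" unfolding H_def by measurable
  have [measurable]: "(\<lambda>p. f (post (fst p) (snd p)) * ennreal (kernel \<epsilon> s (post (fst p) (snd p)) (post_params (fst p) (snd p))) * \<phi> (fst p))
    \<in> borel_measurable ph_coll" by measurable
  have "(\<integral>\<^sup>+z. gain \<epsilon> s f z * \<phi> z \<partial>ph) =
    (\<integral>\<^sup>+z. (\<integral>\<^sup>+q. f (post z q) * ennreal (kernel \<epsilon> s (post z q) (post_params z q)) * \<phi> z \<partial>(sph \<Otimes>\<^sub>M lborel)) \<partial>ph)"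
    unfolding gain_def by (intro nn_integral_cong nn_integral_multc[symmetric]) measurable
  also have "\<dots> = (\<integral>\<^sup>+p. f (post (fst p) (snd p)) * ennreal (kernel \<epsilon> s (post (fst p) (snd p)) (post_params (fst p) (snd p))) * \<phi> (fst p) \<partial>ph_coll)"
    by (subst sph_lborel.nn_integral_fst[symmetric]) simp_all
  also have "\<dots> = (\<integral>\<^sup>+p. H (coll p) \<partial>ph_coll)"
    by (rule nn_integral_cong_AE, use AE_ph_coll in eventually_elim)
       (auto simp: H_def coll_eq post_involution)
  also have "\<dots> = (\<integral>\<^sup>+p. H p \<partial>ph_coll)" by (rule nn_integral_coll[OF H])
  also have "\<dots> = (\<integral>\<^sup>+z. (\<integral>\<^sup>+q. f z * (ennreal (kernel \<epsilon> s z q) * \<phi> (post z q)) \<partial>(sph \<Otimes>\<^sub>M lborel)) \<partial>ph)"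
    by (subst sph_lborel.nn_integral_fst[symmetric]) (simp_all add: H_def mult.assoc)
  also have "\<dots> = (\<integral>\<^sup>+z. f z * scatter \<epsilon> s \<phi> z \<partial>ph)"
    unfolding scatter_def by (intro nn_integral_cong nn_integral_cmult) measurable
  finally show ?thesis .
qed

text \<open>Duhamel's formula for the density of particles that had exactly \<open>n\<close> collisions up to time \<open>t\<close>.\<close>

primrec F :: "real \<Rightarrow> (phase \<Rightarrow> ennreal) \<Rightarrow> nat \<Rightarrow> real \<Rightarrow> phase \<Rightarrow> ennreal" where
  "F \<epsilon> f 0 = (\<lambda>t z. ennreal (no_coll \<epsilon> 0 t z) * f (flow (- t) z))"
| "F \<epsilon> f (Suc n) = (\<lambda>t z. \<integral>\<^sup>+s. ennreal (no_coll \<epsilon> s t z) * gain \<epsilon> s (F \<epsilon> f n s) (flow (s - t) z) * indicator {0..t} s \<partial>lborel)"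

text \<open>Measurability has to be joint in time and state, because the recursion integrates over
  the time argument. The indicator with moving end point is written as a condition for the same
  reason.\<close>

lemma F_measurable_joint:
  assumes [measurable]: "f \<in> borel_measurable borel"
  shows "(\<lambda>p. F \<epsilon> f n (fst p) (snd p)) \<in> borel_measurable (borel \<Otimes>\<^sub>M borel)"
proof (induction n)
  case 0
  show ?case by simp
next
  case (Suc n)
  have [measurable]: "(\<lambda>x. F \<epsilon> f n (t x) (z x)) \<in> borel_measurable M"
    if [measurable]: "t \<in> borel_measurable M" "z \<in> borel_measurable M" for t z and M :: "'m measure"
    by (rule measurable_compose[OF _ Suc, of "\<lambda>x. (t x, z x)", simplified]) measurable
  have ind: "indicator {0..t} s = (if 0 \<le> s \<and> s \<le> t then 1 else 0 :: ennreal)" for s t :: real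
    by (simp add: indicator_def)
  show ?case unfolding F.simps ind by measurable
qed

lemma F_measurable [measurable (raw)]:
  assumes "f \<in> borel_measurable borel"
    and [measurable]: "t \<in> borel_measurable M" "z \<in> borel_measurable M"
  shows "(\<lambda>x. F \<epsilon> f n (t x) (z x)) \<in> borel_measurable M"
  by (rule measurable_compose[OF _ F_measurable_joint[OF assms(1)], of "\<lambda>x. (t x, z x)", simplified]) measurable

lemma gain_periodic: "x_periodic f \<Longrightarrow> x_periodic (gain \<epsilon> s f)"
proof (rule x_periodicI)
  fix z z' :: phase and k assume f: "x_periodic f" and k: "k \<in> lattice" "fst z' = fst z + k" "snd z' = snd z"
  have "f (post z' q) = f (post z q)" for q by (rule x_periodicD[OF f k(1)]) (simp_all add: post_def k)
  moreover have "kernel \<epsilon> s (post z' q) (post_params z' q) = kernel \<epsilon> s (post z q) (post_params z q)" for q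
    using kernel_periodic[OF k(1), of "post z' q" "post z q"] by (simp add: post_def post_params_def k)
  ultimately show "gain \<epsilon> s f z' = gain \<epsilon> s f z" unfolding gain_def by simp
qed

lemma scatter_periodic: "x_periodic f \<Longrightarrow> x_periodic (scatter \<epsilon> s f)"
proof (rule x_periodicI)
  fix z z' :: phase and k assume f: "x_periodic f" and k: "k \<in> lattice" "fst z' = fst z + k" "snd z' = snd z"
  have "f (post z' q) = f (post z q)" for q by (rule x_periodicD[OF f k(1)]) (simp_all add: post_def k)
  then show "scatter \<epsilon> s f z' = scatter \<epsilon> s f z" unfolding scatter_def using kernel_periodic[OF k] by simp
qed

lemma propagate_periodic: "x_periodic f \<Longrightarrow> x_periodic (propagate \<epsilon> s t f)"
proof (rule x_periodicI)
  fix z z' :: phase and k assume f: "x_periodic f" and k: "k \<in> lattice" "fst z' = fst z + k" "snd z' = snd z"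
  show "propagate \<epsilon> s t f z' = propagate \<epsilon> s t f z"
    unfolding propagate_def
    using x_periodicD[OF f k(1), of "flow (t - s) z'" "flow (t - s) z"]
      no_coll_periodic[OF k(1), of "flow (t - s) z'" "flow (t - s) z"] k by (simp add: flow_def)
qed

lemma F_periodic: "x_periodic f \<Longrightarrow> x_periodic (F \<epsilon> f n t)"
proof (induction n arbitrary: t)
  case 0
  show ?case
  proof (rule x_periodicI)
    fix z z' :: phase and k assume k: "k \<in> lattice" "fst z' = fst z + k" "snd z' = snd z"
    show "F \<epsilon> f 0 t z' = F \<epsilon> f 0 t z"
      using no_coll_periodic[OF k] x_periodicD[OF 0 k(1), of "flow (- t) z'" "flow (- t) z"] k by (simp add: flow_def)
  qed
next
  case (Suc n)
  show ?case
  proof (rule x_periodicI)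
    fix z z' :: phase and k assume k: "k \<in> lattice" "fst z' = fst z + k" "snd z' = snd z"
    have "gain \<epsilon> s (F \<epsilon> f n s) (flow (s - t) z') = gain \<epsilon> s (F \<epsilon> f n s) (flow (s - t) z)" for s
      by (rule x_periodicD[OF gain_periodic[OF Suc.IH[OF Suc.prems]] k(1)]) (simp_all add: flow_def k)
    then show "F \<epsilon> f (Suc n) t z' = F \<epsilon> f (Suc n) t z"
      using no_coll_periodic[OF k] by simp
  qed
qed

lemma F_0_dual:
  assumes [measurable]: "f \<in> borel_measurable borel" "\<phi> \<in> borel_measurable borel"
    and per: "x_periodic f" "x_periodic \<phi>"
  shows "(\<integral>\<^sup>+z. F \<epsilon> f 0 t z * \<phi> z \<partial>ph) = (\<integral>\<^sup>+z. f z * propagate \<epsilon> 0 t \<phi> z \<partial>ph)"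
proof -
  have "x_periodic (\<lambda>z. F \<epsilon> f 0 t z * \<phi> z)"
    using F_periodic[OF per(1), of \<epsilon> 0 t] per(2) by (simp add: x_periodic_iff)
  from nn_integral_ph_flow[OF _ this, of t] show ?thesis
    by (simp add: propagate_def mult_ac)
qed

text \<open>The time integral is exchanged with the one over phase space, free flight is undone by
  translation, and \<open>gain_dual\<close> moves the collision to the test function. The trees
  satisfy the same recursion.\<close>

lemma F_Suc_dual:
  assumes [measurable]: "f \<in> borel_measurable borel" "\<phi> \<in> borel_measurable borel"
    and per: "x_periodic f" "x_periodic \<phi>"
  shows "(\<integral>\<^sup>+z. F \<epsilon> f (Suc n) t z * \<phi> z \<partial>ph) =
    (\<integral>\<^sup>+s. (\<integral>\<^sup>+z. F \<epsilon> f n s z * scatter \<epsilon> s (propagate \<epsilon> s t \<phi>) z \<partial>ph) * indicator {0..t} s \<partial>lborel)"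
proof -
  interpret ph_lborel: pair_sigma_finite ph "lborel :: real measure" ..
  have "(\<integral>\<^sup>+z. F \<epsilon> f (Suc n) t z * \<phi> z \<partial>ph) =
    (\<integral>\<^sup>+z. (\<integral>\<^sup>+s. ennreal (no_coll \<epsilon> s t z) * gain \<epsilon> s (F \<epsilon> f n s) (flow (s - t) z) * indicator {0..t} s * \<phi> z \<partial>lborel) \<partial>ph)"
    unfolding F.simps by (intro nn_integral_cong nn_integral_multc[symmetric]) measurable
  also have "\<dots> = (\<integral>\<^sup>+s. (\<integral>\<^sup>+z. ennreal (no_coll \<epsilon> s t z) * gain \<epsilon> s (F \<epsilon> f n s) (flow (s - t) z) * indicator {0..t} s * \<phi> z \<partial>ph) \<partial>lborel)"
    by (rule ph_lborel.Fubini'[symmetric]) measurable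
  also have "\<dots> = (\<integral>\<^sup>+s. (\<integral>\<^sup>+z. F \<epsilon> f n s z * scatter \<epsilon> s (propagate \<epsilon> s t \<phi>) z \<partial>ph) * indicator {0..t} s \<partial>lborel)"
  proof (rule nn_integral_cong)
    fix s :: real
    let ?h = "\<lambda>z. gain \<epsilon> s (F \<epsilon> f n s) z * propagate \<epsilon> s t \<phi> z"
    have per': "x_periodic ?h"
      using gain_periodic[OF F_periodic[OF per(1)]] propagate_periodic[OF per(2)] by (simp add: x_periodic_iff)
    have "(\<integral>\<^sup>+z. ennreal (no_coll \<epsilon> s t z) * gain \<epsilon> s (F \<epsilon> f n s) (flow (s - t) z) * indicator {0..t} s * \<phi> z \<partial>ph) =
      (\<integral>\<^sup>+z. ?h (flow (s - t) z) * indicator {0..t} s \<partial>ph)"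
      by (simp add: propagate_def mult_ac)
    also have "\<dots> = (\<integral>\<^sup>+z. ?h (flow (s - t) z) \<partial>ph) * indicator {0..t} s"
      by (rule nn_integral_multc) measurable
    also have "(\<integral>\<^sup>+z. ?h (flow (s - t) z) \<partial>ph) = (\<integral>\<^sup>+z. ?h z \<partial>ph)"
      by (rule nn_integral_ph_flow[OF _ per']) measurable
    also have "\<dots> = (\<integral>\<^sup>+z. F \<epsilon> f n s z * scatter \<epsilon> s (propagate \<epsilon> s t \<phi>) z \<partial>ph)"
      by (rule gain_dual) measurable
    finally show "(\<integral>\<^sup>+z. ennreal (no_coll \<epsilon> s t z) * gain \<epsilon> s (F \<epsilon> f n s) (flow (s - t) z) * indicator {0..t} s * \<phi> z \<partial>ph) =
      (\<integral>\<^sup>+z. F \<epsilon> f n s z * scatter \<epsilon> s (propagate \<epsilon> s t \<phi>) z \<partial>ph) * indicator {0..t} s" .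
  qed
  finally show ?thesis .
qed

end

section \<open>Mass and first moment\<close>

context background
begin

abbreviation pairing :: "real \<Rightarrow> (phase \<Rightarrow> ennreal) \<Rightarrow> nat \<Rightarrow> real \<Rightarrow> (phase \<Rightarrow> ennreal) \<Rightarrow> ennreal" where
  "pairing \<epsilon> f n t \<phi> \<equiv> \<integral>\<^sup>+z. F \<epsilon> f n t z * \<phi> z \<partial>ph"

text \<open>A flight from z at time s either lasts until t or ends by a collision at some r. The
  velocity is constant meanwhile, so a function of the velocity factors out.\<close>

lemma propagate_survival:
  assumes "s \<le> t" and [measurable]: "\<psi> \<in> borel_measurable borel"
  shows "propagate \<epsilon> s t (\<lambda>z. \<psi> (snd z)) z +
    (\<integral>\<^sup>+r. propagate \<epsilon> s r (\<lambda>z. ennreal (Sigma_rate g0 \<epsilon> r z) * \<psi> (snd z)) z * indicator {s..t} r \<partial>lborel) = \<psi> (snd z)"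
proof -
  have "(\<integral>\<^sup>+r. propagate \<epsilon> s r (\<lambda>z. ennreal (Sigma_rate g0 \<epsilon> r z) * \<psi> (snd z)) z * indicator {s..t} r \<partial>lborel) =
    (\<integral>\<^sup>+r. ennreal (Sigma_rate g0 \<epsilon> r (flow (r - s) z) * no_coll \<epsilon> s r (flow (r - s) z)) * indicator {s..t} r * \<psi> (snd z) \<partial>lborel)"
    by (intro nn_integral_cong) (simp add: propagate_def ennreal_mult Sigma_rate_nonneg no_coll_pos less_imp_le mult_ac)
  also have "\<dots> = (\<integral>\<^sup>+r. ennreal (Sigma_rate g0 \<epsilon> r (flow (r - s) z) * no_coll \<epsilon> s r (flow (r - s) z)) * indicator {s..t} r \<partial>lborel) * \<psi> (snd z)"
    by (rule nn_integral_multc) measurable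
  finally show ?thesis
    using no_coll_survival[OF assms(1), of \<epsilon> "fst z" "snd z"]
    by (simp add: propagate_def flow_def distrib_right[symmetric])
qed

lemma scatter_survival:
  assumes "s \<le> t" and [measurable]: "\<psi> \<in> borel_measurable borel"
  shows "scatter \<epsilon> s (propagate \<epsilon> s t (\<lambda>z. \<psi> (snd z))) z +
    (\<integral>\<^sup>+r. scatter \<epsilon> s (propagate \<epsilon> s r (\<lambda>z. ennreal (Sigma_rate g0 \<epsilon> r z) * \<psi> (snd z))) z * indicator {s..t} r \<partial>lborel) =
    scatter \<epsilon> s (\<lambda>z. \<psi> (snd z)) z"
proof -
  interpret sq_l: pair_sigma_finite "sph \<Otimes>\<^sub>M (lborel :: r3 measure)" "lborel :: real measure" ..
  let ?p = "\<lambda>r. propagate \<epsilon> s r (\<lambda>z. ennreal (Sigma_rate g0 \<epsilon> r z) * \<psi> (snd z))"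
  have "(\<integral>\<^sup>+r. scatter \<epsilon> s (?p r) z * indicator {s..t} r \<partial>lborel) =
    (\<integral>\<^sup>+r. (\<integral>\<^sup>+q. ennreal (kernel \<epsilon> s z q) * ?p r (post z q) * indicator {s..t} r \<partial>(sph \<Otimes>\<^sub>M lborel)) \<partial>lborel)"
    unfolding scatter_def by (intro nn_integral_cong nn_integral_multc[symmetric]) measurable
  also have "\<dots> = (\<integral>\<^sup>+q. (\<integral>\<^sup>+r. ennreal (kernel \<epsilon> s z q) * ?p r (post z q) * indicator {s..t} r \<partial>lborel) \<partial>(sph \<Otimes>\<^sub>M lborel))"
    by (rule sq_l.Fubini') measurable
  also have "\<dots> = (\<integral>\<^sup>+q. ennreal (kernel \<epsilon> s z q) * (\<integral>\<^sup>+r. ?p r (post z q) * indicator {s..t} r \<partial>lborel) \<partial>(sph \<Otimes>\<^sub>M lborel))"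
    unfolding mult.assoc by (intro nn_integral_cong nn_integral_cmult) measurable
  finally have eq: "(\<integral>\<^sup>+r. scatter \<epsilon> s (?p r) z * indicator {s..t} r \<partial>lborel) = \<dots>" .
  show ?thesis unfolding eq unfolding scatter_def
    by (subst nn_integral_add[symmetric])
       (measurable, simp add: distrib_left[symmetric] propagate_survival[OF assms])
qed

lemma F_0_balance:
  assumes [measurable]: "f \<in> borel_measurable borel" "\<psi> \<in> borel_measurable borel"
    and per: "x_periodic f" and t: "0 \<le> t"
  shows "pairing \<epsilon> f 0 t (\<lambda>z. \<psi> (snd z)) +
    (\<integral>\<^sup>+r. pairing \<epsilon> f 0 r (\<lambda>z. ennreal (Sigma_rate g0 \<epsilon> r z) * \<psi> (snd z)) * indicator {0..t} r \<partial>lborel) =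
    (\<integral>\<^sup>+z. f z * \<psi> (snd z) \<partial>ph)"
proof -
  interpret ph_lborel: pair_sigma_finite ph "lborel :: real measure" ..
  let ?p = "\<lambda>r. propagate \<epsilon> 0 r (\<lambda>z. ennreal (Sigma_rate g0 \<epsilon> r z) * \<psi> (snd z))"
  have dual0: "pairing \<epsilon> f 0 t (\<lambda>z. \<psi> (snd z)) = (\<integral>\<^sup>+z. f z * propagate \<epsilon> 0 t (\<lambda>z. \<psi> (snd z)) z \<partial>ph)"
    by (rule F_0_dual[OF assms(1) _ per]) (measurable, simp add: x_periodic_iff Sigma_rate_shift)
  have dual: "pairing \<epsilon> f 0 r (\<lambda>z. ennreal (Sigma_rate g0 \<epsilon> r z) * \<psi> (snd z)) = (\<integral>\<^sup>+z. f z * ?p r z \<partial>ph)" for r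
    by (rule F_0_dual[OF assms(1) _ per]) (measurable, simp add: x_periodic_iff Sigma_rate_shift)
  have "(\<integral>\<^sup>+r. (\<integral>\<^sup>+z. f z * ?p r z \<partial>ph) * indicator {0..t} r \<partial>lborel) =
    (\<integral>\<^sup>+r. (\<integral>\<^sup>+z. f z * ?p r z * indicator {0..t} r \<partial>ph) \<partial>lborel)"
    by (intro nn_integral_cong nn_integral_multc[symmetric]) measurable
  also have "\<dots> = (\<integral>\<^sup>+z. (\<integral>\<^sup>+r. f z * ?p r z * indicator {0..t} r \<partial>lborel) \<partial>ph)"
    by (rule ph_lborel.Fubini') measurable
  also have "\<dots> = (\<integral>\<^sup>+z. f z * (\<integral>\<^sup>+r. ?p r z * indicator {0..t} r \<partial>lborel) \<partial>ph)"
    unfolding mult.assoc by (intro nn_integral_cong nn_integral_cmult) measurable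
  finally have eq: "(\<integral>\<^sup>+r. (\<integral>\<^sup>+z. f z * ?p r z \<partial>ph) * indicator {0..t} r \<partial>lborel) = \<dots>" .
  show ?thesis unfolding dual0 dual eq
    by (subst nn_integral_add[symmetric])
       (measurable, simp add: distrib_left[symmetric] propagate_survival[OF t])
qed

text \<open>What enters the class of \<open>Suc n\<close> collisions at a time s \<le> t either is
  still there at t or leaves it at some r in [s, t]. For each s this is
  \<open>scatter_survival\<close>.\<close>

lemma F_Suc_balance:
  assumes [measurable]: "f \<in> borel_measurable borel" "\<psi> \<in> borel_measurable borel"
    and per: "x_periodic f"
  shows "pairing \<epsilon> f (Suc n) t (\<lambda>z. \<psi> (snd z)) +
    (\<integral>\<^sup>+r. pairing \<epsilon> f (Suc n) r (\<lambda>z. ennreal (Sigma_rate g0 \<epsilon> r z) * \<psi> (snd z)) * indicator {0..t} r \<partial>lborel) =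
    (\<integral>\<^sup>+s. pairing \<epsilon> f n s (scatter \<epsilon> s (\<lambda>z. \<psi> (snd z))) * indicator {0..t} s \<partial>lborel)"
proof -
  interpret ph_lborel: pair_sigma_finite ph "lborel :: real measure" ..
  let ?p = "\<lambda>s r. scatter \<epsilon> s (propagate \<epsilon> s r (\<lambda>z. ennreal (Sigma_rate g0 \<epsilon> r z) * \<psi> (snd z)))"
  have ind: "indicator {a..b} r = (if a \<le> r \<and> r \<le> b then 1 else 0 :: ennreal)" for a b r :: real
    by (simp add: indicator_def)
  have dual0: "pairing \<epsilon> f (Suc n) t (\<lambda>z. \<psi> (snd z)) =
    (\<integral>\<^sup>+s. pairing \<epsilon> f n s (scatter \<epsilon> s (propagate \<epsilon> s t (\<lambda>z. \<psi> (snd z)))) * indicator {0..t} s \<partial>lborel)"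
    by (rule F_Suc_dual[OF assms(1) _ per]) (measurable, simp add: x_periodic_iff Sigma_rate_shift)
  have dual: "pairing \<epsilon> f (Suc n) r (\<lambda>z. ennreal (Sigma_rate g0 \<epsilon> r z) * \<psi> (snd z)) =
    (\<integral>\<^sup>+s. pairing \<epsilon> f n s (?p s r) * indicator {0..r} s \<partial>lborel)" for r
    by (rule F_Suc_dual[OF assms(1) _ per]) (measurable, simp add: x_periodic_iff Sigma_rate_shift)
  define W where "W s r = pairing \<epsilon> f n s (?p s r)" for s r
  define U where "U s z = (\<integral>\<^sup>+r. ?p s r z * indicator {s..t} r \<partial>lborel)" for s z
  have [measurable]: "(\<lambda>x. W (a x) (b x)) \<in> borel_measurable M"
    if [measurable]: "a \<in> borel_measurable M" "b \<in> borel_measurable M" for a b and M :: "'m measure"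
    unfolding W_def by measurable
  have [measurable]: "(\<lambda>x. U (a x) (b x)) \<in> borel_measurable M"
    if [measurable]: "a \<in> borel_measurable M" "b \<in> borel_measurable M" for a b and M :: "'m measure"
    unfolding U_def ind by measurable
  have W: "(\<integral>\<^sup>+r. W s r * indicator {s..t} r \<partial>lborel) = pairing \<epsilon> f n s (U s)" for s
  proof -
    have "(\<integral>\<^sup>+r. W s r * indicator {s..t} r \<partial>lborel) =
      (\<integral>\<^sup>+r. (\<integral>\<^sup>+z. F \<epsilon> f n s z * ?p s r z * indicator {s..t} r \<partial>ph) \<partial>lborel)"
      unfolding W_def by (intro nn_integral_cong nn_integral_multc[symmetric]) measurable
    also have "\<dots> = (\<integral>\<^sup>+z. (\<integral>\<^sup>+r. F \<epsilon> f n s z * ?p s r z * indicator {s..t} r \<partial>lborel) \<partial>ph)"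
      by (rule ph_lborel.Fubini') measurable
    also have "\<dots> = pairing \<epsilon> f n s (U s)"
      unfolding U_def mult.assoc by (intro nn_integral_cong nn_integral_cmult) measurable
    finally show ?thesis .
  qed
  have "(\<integral>\<^sup>+r. (\<integral>\<^sup>+s. W s r * indicator {0..r} s \<partial>lborel) * indicator {0..t} r \<partial>lborel) =
    (\<integral>\<^sup>+r. (\<integral>\<^sup>+s. W s r * indicator {0..r} s * indicator {0..t} r \<partial>lborel) \<partial>lborel)"
    unfolding ind by (intro nn_integral_cong nn_integral_multc[symmetric]) measurable
  also have "\<dots> = (\<integral>\<^sup>+s. (\<integral>\<^sup>+r. W s r * indicator {0..r} s * indicator {0..t} r \<partial>lborel) \<partial>lborel)"
    unfolding ind by (rule lborel_pair.Fubini') measurable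
  \<comment> \<open>The triangle 0 \<le> s \<le> r \<le> t, now described by r for given s.\<close>
  also have "\<dots> = (\<integral>\<^sup>+s. (\<integral>\<^sup>+r. W s r * indicator {s..t} r * indicator {0..t} s \<partial>lborel) \<partial>lborel)"
    by (intro nn_integral_cong) (auto simp: indicator_def)
  also have "\<dots> = (\<integral>\<^sup>+s. pairing \<epsilon> f n s (U s) * indicator {0..t} s \<partial>lborel)"
    by (subst nn_integral_multc) (measurable, simp add: W)
  finally have eq: "(\<integral>\<^sup>+r. (\<integral>\<^sup>+s. W s r * indicator {0..r} s \<partial>lborel) * indicator {0..t} r \<partial>lborel) = \<dots>" .
  define V where "V s = scatter \<epsilon> s (propagate \<epsilon> s t (\<lambda>z. \<psi> (snd z)))" for s
  have [measurable]: "(\<lambda>x. V (a x) (b x)) \<in> borel_measurable M"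
    if [measurable]: "a \<in> borel_measurable M" "b \<in> borel_measurable M" for a b and M :: "'m measure"
    unfolding V_def by measurable
  have VU: "V s z + U s z = scatter \<epsilon> s (\<lambda>z. \<psi> (snd z)) z" if "s \<le> t" for s z
    unfolding V_def U_def by (rule scatter_survival[OF that]) measurable
  have sum_eq: "pairing \<epsilon> f n s (V s) * indicator {0..t} s + pairing \<epsilon> f n s (U s) * indicator {0..t} s =
      pairing \<epsilon> f n s (scatter \<epsilon> s (\<lambda>z. \<psi> (snd z))) * indicator {0..t} s" for s
  proof (cases "s \<in> {0..t}")
    case True
    then have "s \<le> t" by simp
    have "pairing \<epsilon> f n s (V s) + pairing \<epsilon> f n s (U s) = (\<integral>\<^sup>+z. F \<epsilon> f n s z * V s z + F \<epsilon> f n s z * U s z \<partial>ph)"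
      by (rule nn_integral_add[symmetric]) measurable
    also have "\<dots> = pairing \<epsilon> f n s (scatter \<epsilon> s (\<lambda>z. \<psi> (snd z)))"
      by (simp only: distrib_left[symmetric] VU[OF \<open>s \<le> t\<close>])
    finally show ?thesis using True by simp
  qed simp
  have "(\<integral>\<^sup>+s. pairing \<epsilon> f n s (V s) * indicator {0..t} s \<partial>lborel) + (\<integral>\<^sup>+s. pairing \<epsilon> f n s (U s) * indicator {0..t} s \<partial>lborel) =
    (\<integral>\<^sup>+s. pairing \<epsilon> f n s (V s) * indicator {0..t} s + pairing \<epsilon> f n s (U s) * indicator {0..t} s \<partial>lborel)"
    by (rule nn_integral_add[symmetric]) measurable
  then show ?thesis unfolding dual0 dual W_def[symmetric] eq V_def[symmetric] by (simp only: sum_eq)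
qed

section \<open>Telescoping of mass and first moment\<close>

lemma scatter_one: "scatter \<epsilon> s (\<lambda>z. 1) z = ennreal (Sigma_rate g0 \<epsilon> s z)"
  by (simp add: scatter_def ennreal_Sigma_rate)

text \<open>\<open>scatter\<close> turns 1 into the collision rate, so the inflow into the class
  \<open>Suc n\<close> is exactly the outflow from the class n, and the balance laws
  telescope.\<close>

lemma F_mass_flux:
  assumes [measurable]: "f \<in> borel_measurable borel" and per: "x_periodic f" and t: "0 \<le> t"
  shows "(\<Sum>i\<le>n. \<integral>\<^sup>+z. F \<epsilon> f i t z \<partial>ph) +
    (\<integral>\<^sup>+s. pairing \<epsilon> f n s (\<lambda>z. ennreal (Sigma_rate g0 \<epsilon> s z)) * indicator {0..t} s \<partial>lborel) = (\<integral>\<^sup>+z. f z \<partial>ph)"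
proof (induction n)
  case 0
  show ?case using F_0_balance[OF assms(1) _ per t, of "\<lambda>_. 1"] by simp
next
  case (Suc n)
  have "(\<integral>\<^sup>+z. F \<epsilon> f (Suc n) t z \<partial>ph) +
      (\<integral>\<^sup>+s. pairing \<epsilon> f (Suc n) s (\<lambda>z. ennreal (Sigma_rate g0 \<epsilon> s z)) * indicator {0..t} s \<partial>lborel) =
      (\<integral>\<^sup>+s. pairing \<epsilon> f n s (\<lambda>z. ennreal (Sigma_rate g0 \<epsilon> s z)) * indicator {0..t} s \<partial>lborel)"
    using F_Suc_balance[OF assms(1) _ per, of "\<lambda>_. 1" \<epsilon> n t] by (simp add: scatter_one del: F.simps)
  with Suc show ?case by (simp add: add.assoc del: F.simps)
qed

text \<open>The kinetic energy of the pair is conserved, so the speed after a collision with \<open>w\<close> is at most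
  \<open>sqrt (\<bar>v\<bar>\<^sup>2 + \<bar>w\<bar>\<^sup>2)\<close>. The resulting gain in speed compensates the linear growth of the rate in \<open>\<bar>v\<bar>\<close>.\<close>

lemma norm_post_square_le:
  assumes "norm (fst q) = 1"
  shows "(norm (snd (post z q)))\<^sup>2 \<le> (norm (snd z))\<^sup>2 + (norm (snd q))\<^sup>2"
proof -
  obtain \<nu> w where q: "q = (\<nu>, w)" by (cases q)
  obtain x v where z: "z = (x, v)" by (cases z)
  have \<nu>: "\<nu> \<bullet> \<nu> = 1" using assms by (simp add: q norm_eq_1)
  define c where "c = \<nu> \<bullet> (w - v)"
  have c: "c = \<nu> \<bullet> w - \<nu> \<bullet> v" unfolding c_def by (rule inner_diff_right)
  have "(norm (v + c *\<^sub>R \<nu>))\<^sup>2 = v \<bullet> v + 2 * c * (\<nu> \<bullet> v) + c * c * (\<nu> \<bullet> \<nu>)"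
    by (simp add: power2_norm_eq_inner inner_add_left inner_add_right inner_commute)
  also have "\<dots> = v \<bullet> v - (\<nu> \<bullet> v)\<^sup>2 + (\<nu> \<bullet> w)\<^sup>2"
    unfolding \<nu> c power2_eq_square by algebra
  also have "\<dots> \<le> v \<bullet> v + w \<bullet> w"
  proof -
    have "(\<nu> \<bullet> w)\<^sup>2 \<le> w \<bullet> w"
      using Cauchy_Schwarz_ineq[of \<nu> w] \<nu> by simp
    then show ?thesis using zero_le_power2[of "\<nu> \<bullet> v"] by linarith
  qed
  finally have "(norm (v + c *\<^sub>R \<nu>))\<^sup>2 \<le> (norm v)\<^sup>2 + (norm w)\<^sup>2"
    by (simp only: power2_norm_eq_inner)
  then show ?thesis by (simp add: post_def q z c_def)
qed

text \<open>Here a, b, r stand for |v|, |w| and the speed after the collision, and a + b for the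
  growth of the rate. If r \<ge> b, then a + b \<le> a + r and a difference of squares appears; if r
  < b, then r - a < b - a and one appears again.\<close>

lemma speed_gain_le:
  fixes a b r :: real
  assumes "0 \<le> a" "0 \<le> b" "0 \<le> r" "r\<^sup>2 \<le> a\<^sup>2 + b\<^sup>2"
  shows "(a + b) * (r - a) \<le> b\<^sup>2"
proof (cases "r \<le> a")
  case True
  then have "(a + b) * (r - a) \<le> 0" using assms by (simp add: mult_nonneg_nonpos)
  then show ?thesis using zero_le_power2[of b] by linarith
next
  case False
  show ?thesis
  proof (cases "b \<le> r")
    case True
    then have "(a + b) * (r - a) \<le> (a + r) * (r - a)" using False assms by (intro mult_right_mono) auto
    also have "\<dots> \<le> b\<^sup>2" using assms(4) by (simp add: power2_eq_square algebra_simps)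
    finally show ?thesis .
  next
    case b: False
    then have "(a + b) * (r - a) \<le> (a + b) * (b - a)" using assms by (intro mult_left_mono) auto
    also have "\<dots> \<le> b\<^sup>2" using assms by (simp add: power2_eq_square algebra_simps)
    finally show ?thesis .
  qed
qed

text \<open>The first term on the right is the outflow of the moment, which cancels in the balance.
  The remainder is independent of the velocity, although the rate is not bounded.\<close>

lemma scatter_speed_le:
  "scatter \<epsilon> s (\<lambda>z. ennreal (1 + norm (snd z))) z \<le>
   ennreal (Sigma_rate g0 \<epsilon> s z) * ennreal (1 + norm (snd z)) + ennreal (4 * pi * C0)"
proof -
  have "scatter \<epsilon> s (\<lambda>z. ennreal (1 + norm (snd z))) z \<le>
    (\<integral>\<^sup>+q. ennreal (kernel \<epsilon> s z q) * ennreal (1 + norm (snd z)) + ennreal (G (snd q) * (norm (snd q))\<^sup>2) \<partial>(sph \<Otimes>\<^sub>M lborel))"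
    unfolding scatter_def
  proof (rule nn_integral_mono_AE, use AE_params in eventually_elim)
    case (elim q)
    let ?a = "norm (snd z)" and ?b = "norm (snd q)" and ?r = "norm (snd (post z q))" and ?k = "kernel \<epsilon> s z q"
    have k: "0 \<le> ?k" "?k \<le> G (snd q) * (?a + ?b)" using elim kernel_nonneg kernel_le by auto
    have *: "(?a + ?b) * (?r - ?a) \<le> ?b\<^sup>2"
      using elim by (intro speed_gain_le norm_post_square_le) auto
    have "?k * (?r - ?a) \<le> G (snd q) * ?b\<^sup>2"
    \<comment> \<open>Where the speed drops, only nonnegativity of the kernel is used; its upper
      bound enters only where the speed grows.\<close>
    proof (cases "?r \<le> ?a")
      case True
      then have "?k * (?r - ?a) \<le> 0" using k by (simp add: mult_nonneg_nonpos)
      also have "\<dots> \<le> G (snd q) * ?b\<^sup>2" by (simp add: G_nonneg)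
      finally show ?thesis .
    next
      case False
      then have "?k * (?r - ?a) \<le> G (snd q) * (?a + ?b) * (?r - ?a)"
        using k by (intro mult_right_mono) auto
      also have "\<dots> \<le> G (snd q) * ?b\<^sup>2" using mult_left_mono[OF * G_nonneg] by (simp add: mult.assoc)
      finally show ?thesis .
    qed
    then have "?k * (1 + ?r) \<le> ?k * (1 + ?a) + G (snd q) * ?b\<^sup>2" by (simp add: algebra_simps)
    then show ?case
      using k G_nonneg by (simp add: ennreal_mult[symmetric] ennreal_plus[symmetric] del: ennreal_plus)
  qed
  also have "\<dots> = ennreal (Sigma_rate g0 \<epsilon> s z) * ennreal (1 + norm (snd z)) +
      (\<integral>\<^sup>+q. ennreal (G (snd q) * (norm (snd q))\<^sup>2) \<partial>(sph \<Otimes>\<^sub>M lborel))"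
    by (subst nn_integral_add) (measurable, simp add: nn_integral_multc ennreal_Sigma_rate)
  also have "\<dots> \<le> ennreal (Sigma_rate g0 \<epsilon> s z) * ennreal (1 + norm (snd z)) + ennreal (4 * pi * C0)"
    by (intro add_left_mono nn_integral_G_square)
  finally show ?thesis .
qed


abbreviation speed_weight :: "phase \<Rightarrow> ennreal" where
  "speed_weight z \<equiv> ennreal (1 + norm (snd z))"

text \<open>The telescoping of \<open>F_mass_flux\<close> for the weight 1 + |v|; each class adds
  \<open>4 * pi * C0\<close> times its mass integrated over time.\<close>

lemma F_moment_flux:
  assumes [measurable]: "f \<in> borel_measurable borel" and per: "x_periodic f" and t: "0 \<le> t"
  shows "(\<Sum>i\<le>n. pairing \<epsilon> f i t speed_weight) +
    (\<integral>\<^sup>+s. pairing \<epsilon> f n s (\<lambda>z. ennreal (Sigma_rate g0 \<epsilon> s z) * speed_weight z) * indicator {0..t} s \<partial>lborel) \<le>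
    (\<integral>\<^sup>+z. f z * speed_weight z \<partial>ph) +
    ennreal (4 * pi * C0) * (\<Sum>i<n. \<integral>\<^sup>+s. (\<integral>\<^sup>+z. F \<epsilon> f i s z \<partial>ph) * indicator {0..t} s \<partial>lborel)"
proof (induction n)
  case 0
  show ?case using F_0_balance[OF assms(1) _ per t, of "\<lambda>v. ennreal (1 + norm v)"] by (simp del: F.simps)
next
  case (Suc n)
  let ?G = "\<lambda>n. \<integral>\<^sup>+s. pairing \<epsilon> f n s (\<lambda>z. ennreal (Sigma_rate g0 \<epsilon> s z) * speed_weight z) * indicator {0..t} s \<partial>lborel"
  let ?M = "\<lambda>n. \<integral>\<^sup>+s. (\<integral>\<^sup>+z. F \<epsilon> f n s z \<partial>ph) * indicator {0..t} s \<partial>lborel"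
  have "pairing \<epsilon> f (Suc n) t speed_weight + ?G (Suc n) =
    (\<integral>\<^sup>+s. pairing \<epsilon> f n s (scatter \<epsilon> s speed_weight) * indicator {0..t} s \<partial>lborel)"
    by (rule F_Suc_balance[OF assms(1) _ per, where \<psi>="\<lambda>v. ennreal (1 + norm v)"]) measurable
  also have "\<dots> \<le> (\<integral>\<^sup>+s. pairing \<epsilon> f n s (\<lambda>z. ennreal (Sigma_rate g0 \<epsilon> s z) * speed_weight z) * indicator {0..t} s +
      ennreal (4 * pi * C0) * ((\<integral>\<^sup>+z. F \<epsilon> f n s z \<partial>ph) * indicator {0..t} s) \<partial>lborel)"
  proof (rule nn_integral_mono)
    fix s :: real
    have "pairing \<epsilon> f n s (scatter \<epsilon> s speed_weight) \<le>
      (\<integral>\<^sup>+z. F \<epsilon> f n s z * (ennreal (Sigma_rate g0 \<epsilon> s z) * speed_weight z) + ennreal (4 * pi * C0) * F \<epsilon> f n s z \<partial>ph)"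
    proof (rule nn_integral_mono)
      fix z
      have "F \<epsilon> f n s z * scatter \<epsilon> s speed_weight z \<le>
        F \<epsilon> f n s z * (ennreal (Sigma_rate g0 \<epsilon> s z) * speed_weight z + ennreal (4 * pi * C0))"
        by (rule mult_left_mono[OF scatter_speed_le]) simp
      then show "F \<epsilon> f n s z * scatter \<epsilon> s speed_weight z \<le>
        F \<epsilon> f n s z * (ennreal (Sigma_rate g0 \<epsilon> s z) * speed_weight z) + ennreal (4 * pi * C0) * F \<epsilon> f n s z"
        by (simp only: distrib_left mult.commute[of _ "ennreal (4 * pi * C0)"])
    qed
    also have "\<dots> = pairing \<epsilon> f n s (\<lambda>z. ennreal (Sigma_rate g0 \<epsilon> s z) * speed_weight z) + ennreal (4 * pi * C0) * (\<integral>\<^sup>+z. F \<epsilon> f n s z \<partial>ph)"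
      by (subst nn_integral_add) (measurable, simp add: nn_integral_cmult)
    finally show "pairing \<epsilon> f n s (scatter \<epsilon> s speed_weight) * indicator {0..t} s \<le>
      pairing \<epsilon> f n s (\<lambda>z. ennreal (Sigma_rate g0 \<epsilon> s z) * speed_weight z) * indicator {0..t} s +
      ennreal (4 * pi * C0) * ((\<integral>\<^sup>+z. F \<epsilon> f n s z \<partial>ph) * indicator {0..t} s)"
      by (cases "s \<in> {0..t}") auto
  qed
  also have "\<dots> = ?G n + ennreal (4 * pi * C0) * ?M n"
    by (subst nn_integral_add) (measurable, simp add: nn_integral_cmult)
  finally have "pairing \<epsilon> f (Suc n) t speed_weight + ?G (Suc n) \<le> ?G n + ennreal (4 * pi * C0) * ?M n" .
  then have "(\<Sum>i\<le>n. pairing \<epsilon> f i t speed_weight) + (pairing \<epsilon> f (Suc n) t speed_weight + ?G (Suc n)) \<le>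
    ((\<Sum>i\<le>n. pairing \<epsilon> f i t speed_weight) + ?G n) + ennreal (4 * pi * C0) * ?M n"
    by (simp add: add_left_mono add.assoc)
  also have "\<dots> \<le> (\<integral>\<^sup>+z. f z * speed_weight z \<partial>ph) + ennreal (4 * pi * C0) * (\<Sum>i<n. ?M i) + ennreal (4 * pi * C0) * ?M n"
    by (rule add_right_mono[OF Suc])
  finally show ?case by (simp add: add.assoc distrib_left del: F.simps)
qed

text \<open>The masses of all classes add up to at most one at each time, so the accumulated
  additions stay below \<open>4 * pi * C0 * t\<close>, uniformly in n and \<epsilon>.\<close>

lemma F_moment_le:
  assumes f [measurable]: "f \<in> borel_measurable borel" and per: "x_periodic f" and t: "0 \<le> t"
    and mass: "(\<integral>\<^sup>+z. f z \<partial>ph) \<le> 1"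
  shows "(\<Sum>i\<le>n. pairing \<epsilon> f i t speed_weight) \<le> (\<integral>\<^sup>+z. f z * speed_weight z \<partial>ph) + ennreal (4 * pi * C0 * t)"
proof -
  have "(\<Sum>i<n. \<integral>\<^sup>+s. (\<integral>\<^sup>+z. F \<epsilon> f i s z \<partial>ph) * indicator {0..t} s \<partial>lborel) =
    (\<integral>\<^sup>+s. (\<Sum>i<n. \<integral>\<^sup>+z. F \<epsilon> f i s z \<partial>ph) * indicator {0..t} s \<partial>lborel)"
    unfolding sum_distrib_right by (rule nn_integral_sum[symmetric]) measurable
  also have "\<dots> \<le> (\<integral>\<^sup>+s. indicator {0..t} s \<partial>lborel)"
  proof (rule nn_integral_mono)
    fix s :: real
    show "(\<Sum>i<n. \<integral>\<^sup>+z. F \<epsilon> f i s z \<partial>ph) * indicator {0..t} s \<le> indicator {0..t} s"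
    proof (cases "s \<in> {0..t}")
      case True
      have "(\<Sum>i<n. \<integral>\<^sup>+z. F \<epsilon> f i s z \<partial>ph) \<le> (\<Sum>i\<le>n. \<integral>\<^sup>+z. F \<epsilon> f i s z \<partial>ph)"
        by (rule sum_mono2) auto
      also have "\<dots> \<le> (\<integral>\<^sup>+z. f z \<partial>ph)"
        using True F_mass_flux[OF f per, of s \<epsilon> n, symmetric] unfolding le_iff_add by auto
      finally show ?thesis using mass True by (simp del: F.simps)
    qed simp
  qed
  also have "\<dots> = ennreal t" using t by simp
  finally have "ennreal (4 * pi * C0) * (\<Sum>i<n. \<integral>\<^sup>+s. (\<integral>\<^sup>+z. F \<epsilon> f i s z \<partial>ph) * indicator {0..t} s \<partial>lborel) \<le> ennreal (4 * pi * C0 * t)"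
    using t C0_nonneg by (simp add: ennreal_mult mult_left_mono)
  note * = add_left_mono[OF this, of "\<integral>\<^sup>+z. f z * speed_weight z \<partial>ph"]
  have "(\<Sum>i\<le>n. pairing \<epsilon> f i t speed_weight) \<le> (\<Sum>i\<le>n. pairing \<epsilon> f i t speed_weight) +
    (\<integral>\<^sup>+s. pairing \<epsilon> f n s (\<lambda>z. ennreal (Sigma_rate g0 \<epsilon> s z) * speed_weight z) * indicator {0..t} s \<partial>lborel)"
    by (rule order_trans[OF _ add_left_mono[OF zero_le]]) simp
  also note F_moment_flux[OF f per t]
  also note *
  finally show ?thesis .
qed

lemma F_moment_total:
  assumes f [measurable]: "f \<in> borel_measurable borel" and per: "x_periodic f" and t: "0 \<le> t"
    and mass: "(\<integral>\<^sup>+z. f z \<partial>ph) \<le> 1"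
  shows "(\<Sum>n. pairing \<epsilon> f n t speed_weight) \<le> (\<integral>\<^sup>+z. f z * speed_weight z \<partial>ph) + ennreal (4 * pi * C0 * t)"
proof (subst suminf_eq_SUP, rule SUP_least)
  fix n
  show "(\<Sum>i<n. pairing \<epsilon> f i t speed_weight) \<le> (\<integral>\<^sup>+z. f z * speed_weight z \<partial>ph) + ennreal (4 * pi * C0 * t)"
  proof -
    have "(\<Sum>i<n. pairing \<epsilon> f i t speed_weight) \<le> (\<Sum>i\<le>n. pairing \<epsilon> f i t speed_weight)"
      by (rule sum_mono2) auto
    also note F_moment_le[OF assms]
    finally show ?thesis .
  qed
qed

lemma Sigma_rate_le_weight: "ennreal (Sigma_rate g0 \<epsilon> s z) \<le> ennreal (4 * pi * C0) * speed_weight z"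
proof -
  have "ennreal (Sigma_rate g0 \<epsilon> s z) \<le> ennreal (4 * pi * C0 * (1 + norm (snd z)))"
    by (rule ennreal_leI[OF Sigma_rate_le])
  also have "\<dots> = ennreal (4 * pi * C0) * speed_weight z"
    using C0_nonneg by (intro ennreal_mult) auto
  finally show ?thesis .
qed

text \<open>The rate is dominated by the weight 1 + |v|, and the moments summed over all classes are
  bounded uniformly on [0, t].\<close>

lemma F_flux_total_finite:
  assumes f [measurable]: "f \<in> borel_measurable borel" and per: "x_periodic f" and t: "0 \<le> t"
    and mass: "(\<integral>\<^sup>+z. f z \<partial>ph) \<le> 1" and moment: "(\<integral>\<^sup>+z. f z * speed_weight z \<partial>ph) < \<infinity>"
  shows "(\<Sum>n. \<integral>\<^sup>+s. pairing \<epsilon> f n s (\<lambda>z. ennreal (Sigma_rate g0 \<epsilon> s z)) * indicator {0..t} s \<partial>lborel) < \<infinity>"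
proof -
  let ?B = "(\<integral>\<^sup>+z. f z * speed_weight z \<partial>ph) + ennreal (4 * pi * C0 * t)"
  have "(\<Sum>n. \<integral>\<^sup>+s. pairing \<epsilon> f n s (\<lambda>z. ennreal (Sigma_rate g0 \<epsilon> s z)) * indicator {0..t} s \<partial>lborel) =
    (\<integral>\<^sup>+s. (\<Sum>n. pairing \<epsilon> f n s (\<lambda>z. ennreal (Sigma_rate g0 \<epsilon> s z)) * indicator {0..t} s) \<partial>lborel)"
    by (rule nn_integral_suminf[symmetric]) measurable
  also have "\<dots> \<le> (\<integral>\<^sup>+s. ennreal (4 * pi * C0) * ?B * indicator {0..t} s \<partial>lborel)"
  proof (rule nn_integral_mono)
    fix s :: real
    show "(\<Sum>n. pairing \<epsilon> f n s (\<lambda>z. ennreal (Sigma_rate g0 \<epsilon> s z)) * indicator {0..t} s) \<le> ennreal (4 * pi * C0) * ?B * indicator {0..t} s"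
    proof (cases "s \<in> {0..t}")
      case True
      have "(\<Sum>n. pairing \<epsilon> f n s (\<lambda>z. ennreal (Sigma_rate g0 \<epsilon> s z))) \<le> (\<Sum>n. ennreal (4 * pi * C0) * pairing \<epsilon> f n s speed_weight)"
      proof (intro suminf_le summableI)
        fix n
        have "pairing \<epsilon> f n s (\<lambda>z. ennreal (Sigma_rate g0 \<epsilon> s z)) \<le> (\<integral>\<^sup>+z. ennreal (4 * pi * C0) * (F \<epsilon> f n s z * speed_weight z) \<partial>ph)"
        proof (rule nn_integral_mono)
          fix z
          have "F \<epsilon> f n s z * ennreal (Sigma_rate g0 \<epsilon> s z) \<le> F \<epsilon> f n s z * (ennreal (4 * pi * C0) * speed_weight z)"
            by (rule mult_left_mono[OF Sigma_rate_le_weight]) simp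
          then show "F \<epsilon> f n s z * ennreal (Sigma_rate g0 \<epsilon> s z) \<le> ennreal (4 * pi * C0) * (F \<epsilon> f n s z * speed_weight z)"
            by (simp only: mult.left_commute)
        qed
        also have "\<dots> = ennreal (4 * pi * C0) * pairing \<epsilon> f n s speed_weight"
          by (rule nn_integral_cmult) measurable
        finally show "pairing \<epsilon> f n s (\<lambda>z. ennreal (Sigma_rate g0 \<epsilon> s z)) \<le> ennreal (4 * pi * C0) * pairing \<epsilon> f n s speed_weight" .
      qed
      also have "\<dots> = ennreal (4 * pi * C0) * (\<Sum>n. pairing \<epsilon> f n s speed_weight)" by (rule ennreal_suminf_cmult)
      also have "\<dots> \<le> ennreal (4 * pi * C0) * ?B"
        using True C0_nonneg
        by (intro mult_left_mono order_trans[OF F_moment_total[OF f per _ mass]] add_left_mono ennreal_leI) auto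
      finally show ?thesis using True by simp
    qed simp
  qed
  also have "\<dots> = ennreal (4 * pi * C0) * ?B * ennreal t"
    using t by (subst nn_integral_cmult_indicator) auto
  also have "\<dots> < \<infinity>"
    using moment by (simp add: ennreal_mult_less_top less_top)
  finally show ?thesis .
qed

lemma F_total_mass:
  assumes f [measurable]: "f \<in> borel_measurable borel" and per: "x_periodic f" and t: "0 \<le> t"
    and mass: "(\<integral>\<^sup>+z. f z \<partial>ph) = 1" and moment: "(\<integral>\<^sup>+z. f z * speed_weight z \<partial>ph) < \<infinity>"
  shows "(\<Sum>n. \<integral>\<^sup>+z. F \<epsilon> f n t z \<partial>ph) = 1"
proof -
  define J where "J n = (\<integral>\<^sup>+s. pairing \<epsilon> f n s (\<lambda>z. ennreal (Sigma_rate g0 \<epsilon> s z)) * indicator {0..t} s \<partial>lborel)" for n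
  define m where "m n = (\<integral>\<^sup>+z. F \<epsilon> f n t z \<partial>ph)" for n
  have eq: "(\<Sum>i\<le>n. m i) + J n = 1" for n
    unfolding m_def J_def using F_mass_flux[OF f per t] mass by simp
  \<comment> \<open>Every flux is finite, so their series can be read in the reals, where a
    convergent series has terms tending to 0.\<close>
  have J1: "J n \<le> 1" for n using eq[of n] by (metis le_iff_add add.commute)
  then have J: "J n = ennreal (enn2real (J n))" for n
    by (metis ennreal_enn2real ennreal_one_less_top le_less_trans)
  have "(\<Sum>n. J n) < \<infinity>"
    unfolding J_def using mass by (intro F_flux_total_finite[OF f per t _ moment]) simp
  then have "(\<Sum>n. ennreal (enn2real (J n))) \<noteq> top" using J by (simp add: less_top)
  then have "summable (\<lambda>n. enn2real (J n))" by (rule summable_suminf_not_top[rotated]) simp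
  then have "(\<lambda>n. enn2real (J n)) \<longlonglongrightarrow> 0" by (rule summable_LIMSEQ_zero)
  then have "(\<lambda>n. ennreal (enn2real (J n))) \<longlonglongrightarrow> ennreal 0" by (rule tendsto_ennrealI)
  then have "J \<longlonglongrightarrow> 0" using J by simp
  moreover have "(\<lambda>n. \<Sum>i\<le>n. m i) \<longlonglongrightarrow> (\<Sum>n. m n)"
    using summableI[of m, THEN summable_LIMSEQ'] by simp
  ultimately have "(\<lambda>n. (\<Sum>i\<le>n. m i) + J n) \<longlonglongrightarrow> (\<Sum>n. m n) + 0" by (intro tendsto_add)
  then show ?thesis unfolding eq m_def[symmetric] by (simp add: LIMSEQ_const_iff)
qed

section \<open>Summation over the number of collisions\<close>

definition Ft :: "real \<Rightarrow> (phase \<Rightarrow> ennreal) \<Rightarrow> real \<Rightarrow> phase \<Rightarrow> ennreal" where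
  "Ft \<epsilon> f t z = (\<Sum>n. F \<epsilon> f n t z)"

lemma Ft_measurable [measurable (raw)]:
  assumes [measurable]: "f \<in> borel_measurable borel" "t \<in> borel_measurable M" "z \<in> borel_measurable M"
  shows "(\<lambda>x. Ft \<epsilon> f (t x) (z x)) \<in> borel_measurable M"
  unfolding Ft_def by measurable

lemma Ft_periodic: "x_periodic f \<Longrightarrow> x_periodic (Ft \<epsilon> f t)"
  using F_periodic by (simp add: x_periodic_iff Ft_def)

lemma Ft_pairing:
  assumes [measurable]: "f \<in> borel_measurable borel" "\<phi> \<in> borel_measurable borel"
  shows "(\<integral>\<^sup>+z. Ft \<epsilon> f t z * \<phi> z \<partial>ph) = (\<Sum>n. pairing \<epsilon> f n t \<phi>)"
  unfolding Ft_def ennreal_suminf_multc[symmetric] by (rule nn_integral_suminf) measurable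

text \<open>Summing Duhamel's recursion over n. With values in \<open>ennreal\<close> the identity
  holds at every point; null sets enter only in the passage to real functions.\<close>

lemma Ft_mild:
  assumes [measurable]: "f \<in> borel_measurable borel"
  shows "Ft \<epsilon> f t z = ennreal (no_coll \<epsilon> 0 t z) * f (flow (- t) z) +
    (\<integral>\<^sup>+s. ennreal (no_coll \<epsilon> s t z) * gain \<epsilon> s (Ft \<epsilon> f s) (flow (s - t) z) * indicator {0..t} s \<partial>lborel)"
proof -
  have ind: "indicator {a..b} r = (if a \<le> r \<and> r \<le> b then 1 else 0 :: ennreal)" for a b r :: real
    by (simp add: indicator_def)
  have gain: "gain \<epsilon> s (Ft \<epsilon> f s) y = (\<Sum>n. gain \<epsilon> s (F \<epsilon> f n s) y)" for s y
    unfolding gain_def Ft_def ennreal_suminf_multc[symmetric] by (rule nn_integral_suminf) measurable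
  have "Ft \<epsilon> f t z = F \<epsilon> f 0 t z + (\<Sum>n. F \<epsilon> f (Suc n) t z)"
    unfolding Ft_def by (subst suminf_offset[OF summableI, of _ 1]) (simp add: add.commute del: F.simps)
  also have "(\<Sum>n. F \<epsilon> f (Suc n) t z) =
    (\<integral>\<^sup>+s. (\<Sum>n. ennreal (no_coll \<epsilon> s t z) * gain \<epsilon> s (F \<epsilon> f n s) (flow (s - t) z) * indicator {0..t} s) \<partial>lborel)"
    unfolding F.simps by (rule nn_integral_suminf[symmetric]) measurable
  also have "\<dots> = (\<integral>\<^sup>+s. ennreal (no_coll \<epsilon> s t z) * gain \<epsilon> s (Ft \<epsilon> f s) (flow (s - t) z) * indicator {0..t} s \<partial>lborel)"
    unfolding gain by simp
  finally show ?thesis by simp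
qed

end

section \<open>The mild solution\<close>

lemma AE_ph_flow:
  assumes [measurable]: "Measurable.pred borel P" and per: "x_periodic P" and AE: "AE z in ph. P z"
  shows "AE z in ph. P (flow r z)"
proof -
  let ?h = "\<lambda>z. if P z then 0 else 1 :: ennreal"
  have [measurable]: "Measurable.pred borel (\<lambda>z. P (flow r z))"
    by (rule measurable_compose[OF _ assms(1)]) measurable
  have "(\<integral>\<^sup>+z. ?h (flow r z) \<partial>ph) = (\<integral>\<^sup>+z. ?h z \<partial>ph)"
    by (rule nn_integral_ph_flow) (use per in \<open>auto simp: x_periodic_iff\<close>)
  also have "\<dots> = 0"
    using AE by (subst nn_integral_0_iff_AE) (auto elim!: eventually_mono)
  finally have "AE z in ph. ?h (flow r z) = 0"
    by (subst (asm) nn_integral_0_iff_AE) auto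
  then show ?thesis by eventually_elim (auto split: if_splits)
qed

lemma measurable_phase_measureI: "h \<in> borel \<rightarrow>\<^sub>M N \<Longrightarrow> h \<in> phase_measure \<rightarrow>\<^sub>M N"
  by (rule measurable_compose[OF phase_measure_ident, of h, simplified])

lemma sigma_finite_phase_measure: "sigma_finite_measure phase_measure"
  unfolding phase_measure_def by (intro sigma_finite_measure_restrict_space) (auto simp: lborel.sigma_finite_measure_axioms)

interpretation phase: sigma_finite_measure phase_measure by (rule sigma_finite_phase_measure)

lemma sigma_finite_time: "sigma_finite_measure (restrict_space lborel {0..T::real})"
  by (intro sigma_finite_measure_restrict_space) (auto simp: lborel.sigma_finite_measure_axioms)

locale transport_data = background +
  fixes f0 :: "phase \<Rightarrow> real"
  assumes f0_measurable [measurable]: "f0 \<in> borel_measurable borel"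
    and f0_periodic: "x_periodic f0"
    and f0_nonneg: "AE z in ph. 0 \<le> f0 z"
    and f0_mass: "(\<integral>\<^sup>+z. ennreal (f0 z) \<partial>ph) = 1"
    and f0_moment: "(\<integral>\<^sup>+z. ennreal (f0 z) * ennreal (1 + norm (snd z)) \<partial>ph) < \<infinity>"
begin

abbreviation D :: "real \<Rightarrow> real \<Rightarrow> phase \<Rightarrow> ennreal" where
  "D \<epsilon> \<equiv> Ft \<epsilon> (\<lambda>z. ennreal (f0 z))"

lemma ef0_measurable [measurable]: "(\<lambda>z. ennreal (f0 z)) \<in> borel_measurable borel" by measurable

lemma ef0_periodic: "x_periodic (\<lambda>z. ennreal (f0 z))"
  using f0_periodic by (simp add: x_periodic_iff)

lemma D_measurable [measurable (raw)]:
  assumes [measurable]: "t \<in> borel_measurable M" "z \<in> borel_measurable M"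
  shows "(\<lambda>x. D \<epsilon> (t x) (z x)) \<in> borel_measurable M"
  by (rule Ft_measurable) measurable

lemma D_mass: "0 \<le> t \<Longrightarrow> (\<integral>\<^sup>+z. D \<epsilon> t z \<partial>ph) = 1"
  using Ft_pairing[OF ef0_measurable, of "\<lambda>_. 1" \<epsilon> t]
    F_total_mass[OF ef0_measurable ef0_periodic _ f0_mass f0_moment, of t \<epsilon>] by simp

definition moment_bound :: "real \<Rightarrow> ennreal" where
  "moment_bound t = (\<integral>\<^sup>+z. ennreal (f0 z) * speed_weight z \<partial>ph) + ennreal (4 * pi * C0 * t)"

lemma moment_bound_finite: "moment_bound t < \<infinity>"
  using f0_moment by (simp add: moment_bound_def less_top)

lemma moment_bound_mono: "s \<le> t \<Longrightarrow> moment_bound s \<le> moment_bound t"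
  unfolding moment_bound_def using C0_nonneg by (intro add_left_mono ennreal_leI mult_left_mono) auto

lemma D_moment: "0 \<le> t \<Longrightarrow> (\<integral>\<^sup>+z. D \<epsilon> t z * speed_weight z \<partial>ph) \<le> moment_bound t"
proof -
  assume t: "0 \<le> t"
  have "(\<integral>\<^sup>+z. D \<epsilon> t z * speed_weight z \<partial>ph) = (\<Sum>n. pairing \<epsilon> (\<lambda>z. ennreal (f0 z)) n t speed_weight)"
    by (rule Ft_pairing) measurable
  also have "\<dots> \<le> moment_bound t"
    unfolding moment_bound_def
    by (rule F_moment_total[OF ef0_measurable ef0_periodic t]) (simp only: f0_mass order_refl)
  finally show ?thesis .
qed

lemma D_finite: "0 \<le> t \<Longrightarrow> AE z in ph. D \<epsilon> t z \<noteq> \<infinity>"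
  by (rule nn_integral_noteq_infinite) (simp_all add: D_mass)

lemma D_periodic: "x_periodic (D \<epsilon> t)"
  by (rule Ft_periodic[OF ef0_periodic])

text \<open>Testing with 1 identifies the total gain with the total loss, which the first moment
  controls.\<close>

lemma gain_D_integral:
  assumes "0 \<le> s"
  shows "(\<integral>\<^sup>+z. gain \<epsilon> s (D \<epsilon> s) z \<partial>ph) \<le> ennreal (4 * pi * C0) * moment_bound s"
proof -
  have "(\<integral>\<^sup>+z. gain \<epsilon> s (D \<epsilon> s) z \<partial>ph) = (\<integral>\<^sup>+z. D \<epsilon> s z * scatter \<epsilon> s (\<lambda>_. 1) z \<partial>ph)"
    using gain_dual[of "D \<epsilon> s" "\<lambda>_. 1" \<epsilon> s] by simp
  also have "\<dots> \<le> (\<integral>\<^sup>+z. ennreal (4 * pi * C0) * (D \<epsilon> s z * speed_weight z) \<partial>ph)"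
    unfolding scatter_one
  proof (rule nn_integral_mono)
    fix z
    have "D \<epsilon> s z * ennreal (Sigma_rate g0 \<epsilon> s z) \<le> D \<epsilon> s z * (ennreal (4 * pi * C0) * speed_weight z)"
      by (rule mult_left_mono[OF Sigma_rate_le_weight]) simp
    then show "D \<epsilon> s z * ennreal (Sigma_rate g0 \<epsilon> s z) \<le> ennreal (4 * pi * C0) * (D \<epsilon> s z * speed_weight z)"
      by (simp only: mult.left_commute)
  qed
  also have "\<dots> = ennreal (4 * pi * C0) * (\<integral>\<^sup>+z. D \<epsilon> s z * speed_weight z \<partial>ph)"
    by (rule nn_integral_cmult) measurable
  also have "\<dots> \<le> ennreal (4 * pi * C0) * moment_bound s"
    by (rule mult_left_mono[OF D_moment[OF assms]]) simp
  finally show ?thesis .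
qed

text \<open>\<open>enn2real\<close> sends an infinite value to 0; by \<open>D_finite\<close> this
  affects only a null set at each time.\<close>

definition boltzmann_sol :: "real \<Rightarrow> real \<Rightarrow> phase \<Rightarrow> real" where
  "boltzmann_sol \<epsilon> t z = enn2real (D \<epsilon> t z)"

lemma boltzmann_sol_measurable [measurable (raw)]:
  assumes [measurable]: "t \<in> borel_measurable M" "z \<in> borel_measurable M"
  shows "(\<lambda>x. boltzmann_sol \<epsilon> (t x) (z x)) \<in> borel_measurable M"
  unfolding boltzmann_sol_def by measurable

lemma integrand_measurable [measurable (raw)]:
  assumes [measurable]: "s \<in> borel_measurable M"
    "(\<lambda>x. fst (z x)) \<in> borel_measurable M" "(\<lambda>x. snd (z x)) \<in> borel_measurable M"
    "(\<lambda>x. fst (q x)) \<in> borel_measurable M" "(\<lambda>x. snd (q x)) \<in> borel_measurable M"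
  shows "(\<lambda>x. boltzmann_gain_integrand g0 \<epsilon> (s x) (boltzmann_sol \<epsilon> (s x)) (z x) (q x)) \<in> borel_measurable M"
  unfolding boltzmann_gain_integrand_def Let_def transport_def case_prod_unfold by measurable

text \<open>With respect to \<open>- \<nu>\<close>, the relative velocity before the collision has
  the same normal component as the one after it with respect to \<nu>.\<close>

lemma integrand_eq:
  assumes "norm (fst q) = 1"
  shows "boltzmann_gain_integrand g0 \<epsilon> s h z q = h (post z q) * kernel \<epsilon> s (post z q) (post_params z q)"
proof -
  obtain \<nu> w where q: "q = (\<nu>, w)" by (cases q)
  obtain x v where z: "z = (x, v)" by (cases z)
  have \<nu>: "\<nu> \<bullet> \<nu> = 1" using assms by (simp add: q norm_eq_1)
  define c where "c = \<nu> \<bullet> (w - v)"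
  have "(v + c *\<^sub>R \<nu> - (w - c *\<^sub>R \<nu>)) \<bullet> (- \<nu>) = - ((v - w) \<bullet> \<nu>) - 2 * c * (\<nu> \<bullet> \<nu>)"
    by (simp only: inner_minus_right inner_diff_left inner_add_left inner_scaleR_left)
  also have "\<dots> = (v - w) \<bullet> \<nu>"
    unfolding \<nu> by (simp add: c_def inner_diff_left inner_diff_right inner_commute)
  finally have "(v + c *\<^sub>R \<nu> - (w - c *\<^sub>R \<nu>)) \<bullet> (- \<nu>) = (v - w) \<bullet> \<nu>" .
  then show ?thesis
    unfolding q z boltzmann_gain_integrand_def kernel_def post_def post_params_def transport_def Let_def prod.case fst_conv snd_conv c_def[symmetric]
    by (simp only: scaleR_minus_right add_uminus_conv_diff mult.assoc)
qed

lemma boltzmann_gain_eq: "boltzmann_gain g0 \<epsilon> s (boltzmann_sol \<epsilon> s) z =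
    (\<integral>q. boltzmann_gain_integrand g0 \<epsilon> s (boltzmann_sol \<epsilon> s) z q \<partial>(sph \<Otimes>\<^sub>M lborel))"
proof -
  have "(\<integral>q. boltzmann_gain_integrand g0 \<epsilon> s (boltzmann_sol \<epsilon> s) z q \<partial>distr (sphere_measure \<Otimes>\<^sub>M lborel) (borel \<Otimes>\<^sub>M borel) (\<lambda>x. x)) =
    boltzmann_gain g0 \<epsilon> s (boltzmann_sol \<epsilon> s) z"
    unfolding boltzmann_gain_def by (subst integral_distr[OF sphere_lborel_ident]) simp_all
  then show ?thesis by (simp add: distr_sphere_lborel)
qed

lemma boltzmann_gain_measurable [measurable (raw)]:
  assumes [measurable]: "s \<in> borel_measurable M"
    "(\<lambda>x. fst (z x)) \<in> borel_measurable M" "(\<lambda>x. snd (z x)) \<in> borel_measurable M"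
  shows "(\<lambda>x. boltzmann_gain g0 \<epsilon> (s x) (boltzmann_sol \<epsilon> (s x)) (z x)) \<in> borel_measurable M"
  unfolding boltzmann_gain_eq by measurable

text \<open>The condition for almost every q is encoded as a vanishing integral. This makes the
  predicate measurable in s and z, which exchanging almost-everywhere quantifiers requires.\<close>

definition regular :: "real \<Rightarrow> real \<Rightarrow> phase \<Rightarrow> bool" where
  "regular \<epsilon> s z \<longleftrightarrow>
    (\<integral>\<^sup>+q. (if norm (fst q) = 1 \<and> D \<epsilon> s (post z q) \<noteq> \<infinity> \<and> snd (post_params z q) \<notin> N then 0 else 1) \<partial>(sph \<Otimes>\<^sub>M lborel)) = (0::ennreal) \<and>
    gain \<epsilon> s (D \<epsilon> s) z \<noteq> \<infinity>"

lemma regular_measurable [measurable (raw)]: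
  assumes [measurable]: "s \<in> borel_measurable M"
    "(\<lambda>x. fst (z x)) \<in> borel_measurable M" "(\<lambda>x. snd (z x)) \<in> borel_measurable M"
  shows "Measurable.pred M (\<lambda>x. regular \<epsilon> (s x) (z x))"
proof -
  have [measurable]: "Measurable.pred (M \<Otimes>\<^sub>M (sph \<Otimes>\<^sub>M lborel)) (\<lambda>p. snd (post_params (z (fst p)) (snd p)) \<notin> N)"
    by (rule measurable_compose[of "\<lambda>p. snd (post_params (z (fst p)) (snd p))" _ borel]) measurable
  show ?thesis unfolding regular_def by measurable
qed

lemma regular_periodic: "x_periodic (regular \<epsilon> s)"
proof (rule x_periodicI)
  fix z z' :: phase and k assume k: "k \<in> lattice" "fst z' = fst z + k" "snd z' = snd z"
  have "D \<epsilon> s (post z' q) = D \<epsilon> s (post z q)" for q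
    by (rule x_periodicD[OF D_periodic k(1)]) (simp_all add: post_def k)
  moreover have "snd (post_params z' q) = snd (post_params z q)" for q by (simp add: post_params_def k)
  moreover have "gain \<epsilon> s (D \<epsilon> s) z' = gain \<epsilon> s (D \<epsilon> s) z"
    by (rule x_periodicD[OF gain_periodic[OF D_periodic] k])
  ultimately show "regular \<epsilon> s z' = regular \<epsilon> s z" by (simp add: regular_def)
qed

lemma AE_regular:
  assumes s: "0 \<le> s"
  shows "AE z in ph. regular \<epsilon> s z"
proof -
  have 1: "AE p in ph_coll. norm (fst (snd p)) = 1" by (rule AE_ph_coll)
  have "AE p in ph_coll. D \<epsilon> s (fst p) < \<infinity>"
  proof (rule ph_sph_lborel.AE_pair_measure)
    show "AE z in ph. AE q in sph \<Otimes>\<^sub>M (lborel :: r3 measure). D \<epsilon> s (fst (z, q)) < \<infinity>"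
      using D_finite[OF s, of \<epsilon>] by eventually_elim (simp add: less_top)
  qed measurable
  \<comment> \<open>Finiteness at almost every state becomes finiteness at the pre-collisional state
    for almost every collision; the null set \<open>N\<close> is treated in the same way
    below.\<close>
  from AE_coll[OF this] have 2: "AE p in ph_coll. D \<epsilon> s (fst (coll p)) \<noteq> \<infinity>"
    by eventually_elim (simp add: less_top)
  have "AE p in ph_coll. snd (snd p) \<notin> N"
  proof (rule ph_sph_lborel.AE_pair_measure)
    show "AE z in ph. AE q in sph \<Otimes>\<^sub>M (lborel :: r3 measure). snd (snd (z, q)) \<notin> N"
    proof (rule AE_I2)
      fix z
      show "AE q in sph \<Otimes>\<^sub>M (lborel :: r3 measure). snd (snd (z, q)) \<notin> N"
        using AE_params by eventually_elim simp
    qed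
  qed measurable
  from AE_coll[OF this] have 3: "AE p in ph_coll. snd (snd (coll p)) \<notin> N" .
  have "AE p in ph_coll. norm (fst (snd p)) = 1 \<and> D \<epsilon> s (fst (coll p)) \<noteq> \<infinity> \<and> snd (snd (coll p)) \<notin> N"
    using 1 2 3 by eventually_elim simp
  from ph_sph_lborel.AE_pair[OF this]
  have "AE z in ph. AE q in sph \<Otimes>\<^sub>M lborel. norm (fst q) = 1 \<and> D \<epsilon> s (post z q) \<noteq> \<infinity> \<and> snd (post_params z q) \<notin> N"
    by (simp add: coll_eq)
  moreover have "AE z in ph. gain \<epsilon> s (D \<epsilon> s) z \<noteq> \<infinity>"
  proof (rule nn_integral_noteq_infinite)
    have "ennreal (4 * pi * C0) * moment_bound s < \<infinity>"
      using moment_bound_finite by (simp add: ennreal_mult_less_top less_top)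
    with gain_D_integral[OF s, of \<epsilon>] show "(\<integral>\<^sup>+z. gain \<epsilon> s (D \<epsilon> s) z \<partial>ph) \<noteq> \<infinity>"
      by (auto simp: top_unique)
  qed measurable
  ultimately show ?thesis
  proof eventually_elim
    case (elim z)
    have "(\<integral>\<^sup>+q. (if norm (fst q) = 1 \<and> D \<epsilon> s (post z q) \<noteq> \<infinity> \<and> snd (post_params z q) \<notin> N then 0 else 1) \<partial>(sph \<Otimes>\<^sub>M lborel)) =
      (\<integral>\<^sup>+q. 0 \<partial>(sph \<Otimes>\<^sub>M (lborel :: r3 measure)))"
      by (rule nn_integral_cong_AE, use elim(1) in eventually_elim) auto
    with elim(2) show ?case by (simp add: regular_def)
  qed
qed

lemma regularD:
  assumes "regular \<epsilon> s z"
  shows "integrable (sph \<Otimes>\<^sub>M lborel) (boltzmann_gain_integrand g0 \<epsilon> s (boltzmann_sol \<epsilon> s) z)"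
    and "ennreal (boltzmann_gain g0 \<epsilon> s (boltzmann_sol \<epsilon> s) z) = gain \<epsilon> s (D \<epsilon> s) z"
    and "0 \<le> boltzmann_gain g0 \<epsilon> s (boltzmann_sol \<epsilon> s) z"
proof -
  let ?b = "boltzmann_gain_integrand g0 \<epsilon> s (boltzmann_sol \<epsilon> s) z"
  have [measurable]: "Measurable.pred (sph \<Otimes>\<^sub>M lborel) (\<lambda>q. snd (post_params z q) \<notin> N)"
    by (rule measurable_compose[of "\<lambda>q. snd (post_params z q)" _ borel]) measurable
  have AE: "AE q in sph \<Otimes>\<^sub>M lborel. norm (fst q) = 1 \<and> D \<epsilon> s (post z q) \<noteq> \<infinity> \<and> snd (post_params z q) \<notin> N"
  proof -
    have "AE q in sph \<Otimes>\<^sub>M lborel. (if norm (fst q) = 1 \<and> D \<epsilon> s (post z q) \<noteq> \<infinity> \<and> snd (post_params z q) \<notin> N then 0 else 1) = (0::ennreal)"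
      using assms unfolding regular_def by (subst (asm) nn_integral_0_iff_AE) auto
    then show ?thesis by eventually_elim (auto split: if_splits)
  qed
  have eq: "AE q in sph \<Otimes>\<^sub>M lborel. 0 \<le> ?b q \<and>
    ennreal (?b q) = D \<epsilon> s (post z q) * ennreal (kernel \<epsilon> s (post z q) (post_params z q))"
    using AE
  proof eventually_elim
    case (elim q)
    then have "0 \<le> kernel \<epsilon> s (post z q) (post_params z q)" by (intro kernel_nonneg) auto
    with elim show ?case
      by (simp add: integrand_eq boltzmann_sol_def ennreal_mult less_top)
  qed
  have nn: "(\<integral>\<^sup>+q. ennreal (?b q) \<partial>(sph \<Otimes>\<^sub>M lborel)) = gain \<epsilon> s (D \<epsilon> s) z"
    unfolding gain_def by (rule nn_integral_cong_AE, use eq in eventually_elim) simp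
  have fin: "gain \<epsilon> s (D \<epsilon> s) z < \<infinity>" using assms by (simp add: regular_def less_top)
  show int: "integrable (sph \<Otimes>\<^sub>M lborel) ?b"
    by (rule integrableI_nonneg) (use eq nn fin in \<open>auto elim!: eventually_mono\<close>)
  show "0 \<le> boltzmann_gain g0 \<epsilon> s (boltzmann_sol \<epsilon> s) z"
    unfolding boltzmann_gain_eq by (rule integral_nonneg_AE, use eq in eventually_elim) simp
  show "ennreal (boltzmann_gain g0 \<epsilon> s (boltzmann_sol \<epsilon> s) z) = gain \<epsilon> s (D \<epsilon> s) z"
    unfolding boltzmann_gain_eq nn[symmetric]
    by (rule nn_integral_eq_integral[symmetric, OF int], use eq in eventually_elim) simp
qed

lemma boltzmann_sol_mild_solution:
  assumes "0 < T"
  shows "mild_solution T \<epsilon> f0 g0 (boltzmann_sol \<epsilon>)"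
  unfolding mild_solution_def
proof (intro conjI ballI)
  interpret time: sigma_finite_measure "restrict_space lborel {0..T}" by (rule sigma_finite_time)
  interpret tp: pair_sigma_finite "restrict_space lborel {0..T}" phase_measure ..
  interpret lp: pair_sigma_finite "lborel :: real measure" ph ..
  have [measurable]: "fst \<in> borel_measurable (restrict_space lborel {0..T} \<Otimes>\<^sub>M phase_measure)"
    by (rule measurable_compose[OF measurable_fst]) (rule measurable_restrict_space1, simp)
  have [measurable]: "snd \<in> borel_measurable (restrict_space lborel {0..T} \<Otimes>\<^sub>M phase_measure)"
    by (rule measurable_compose[OF measurable_snd]) simp
  note this[measurable]
  have reg: "AE p in restrict_space lborel {0..T} \<Otimes>\<^sub>M phase_measure. regular \<epsilon> (fst p) (snd p)"
  proof (rule tp.AE_pair_measure)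
    show "AE s in restrict_space lborel {0..T}. AE z in phase_measure. regular \<epsilon> (fst (s, z)) (snd (s, z))"
      by (subst AE_restrict_space_iff) (auto intro!: AE_phaseI AE_regular)
  qed measurable
  {
    fix t assume t: "t \<in> {0..T}"
    show "x_periodic (boltzmann_sol \<epsilon> t)" using D_periodic by (simp add: x_periodic_iff boltzmann_sol_def)
    show "integrable phase_measure (boltzmann_sol \<epsilon> t)"
    proof (rule integrableI_nonneg)
      have "(\<integral>\<^sup>+z. ennreal (boltzmann_sol \<epsilon> t z) \<partial>phase_measure) \<le> (\<integral>\<^sup>+z. D \<epsilon> t z \<partial>ph)"
        by (subst nn_integral_phase) (auto intro!: nn_integral_mono simp: boltzmann_sol_def ennreal_enn2real_if)
      also have "\<dots> < \<infinity>" using t by (simp add: D_mass)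
      finally show "(\<integral>\<^sup>+z. ennreal (boltzmann_sol \<epsilon> t z) \<partial>phase_measure) < \<infinity>" .
    qed (auto simp: boltzmann_sol_def intro!: measurable_phase_measureI)
  }
  show "AE (s, z) in restrict_space lborel {0..T} \<Otimes>\<^sub>M phase_measure.
      integrable (sphere_measure \<Otimes>\<^sub>M lborel) (boltzmann_gain_integrand g0 \<epsilon> s (boltzmann_sol \<epsilon> s) z)"
    using reg
  proof eventually_elim
    case (elim p)
    have "integrable (distr (sphere_measure \<Otimes>\<^sub>M lborel) (borel \<Otimes>\<^sub>M borel) (\<lambda>x. x)) (boltzmann_gain_integrand g0 \<epsilon> (fst p) (boltzmann_sol \<epsilon> (fst p)) (snd p))"
      unfolding distr_sphere_lborel by (rule regularD(1)[OF elim])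
    then show ?case unfolding case_prod_unfold
      by (subst (asm) integrable_distr_eq[OF sphere_lborel_ident]) simp_all
  qed
  show "integrable (restrict_space lborel {0..T} \<Otimes>\<^sub>M phase_measure) (\<lambda>(s, z). boltzmann_gain g0 \<epsilon> s (boltzmann_sol \<epsilon> s) z)"
  proof (rule integrableI_nonneg)
    show meas [measurable]: "(\<lambda>(s, z). boltzmann_gain g0 \<epsilon> s (boltzmann_sol \<epsilon> s) z) \<in> borel_measurable (restrict_space lborel {0..T} \<Otimes>\<^sub>M phase_measure)"
      unfolding case_prod_unfold by measurable
    show "AE p in restrict_space lborel {0..T} \<Otimes>\<^sub>M phase_measure. 0 \<le> (case p of (s, z) \<Rightarrow> boltzmann_gain g0 \<epsilon> s (boltzmann_sol \<epsilon> s) z)"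
      using reg by eventually_elim (auto simp: case_prod_unfold regularD(3))
    have "(\<integral>\<^sup>+p. ennreal (case p of (s, z) \<Rightarrow> boltzmann_gain g0 \<epsilon> s (boltzmann_sol \<epsilon> s) z) \<partial>(restrict_space lborel {0..T} \<Otimes>\<^sub>M phase_measure)) =
      (\<integral>\<^sup>+p. gain \<epsilon> (fst p) (D \<epsilon> (fst p)) (snd p) \<partial>(restrict_space lborel {0..T} \<Otimes>\<^sub>M phase_measure))"
      by (rule nn_integral_cong_AE, use reg in eventually_elim) (auto simp: case_prod_unfold regularD(2))
    also have "\<dots> = (\<integral>\<^sup>+s. (\<integral>\<^sup>+z. gain \<epsilon> s (D \<epsilon> s) z \<partial>phase_measure) \<partial>restrict_space lborel {0..T})"
    proof -
      have g: "(\<lambda>p. gain \<epsilon> (fst p) (D \<epsilon> (fst p)) (snd p)) \<in> borel_measurable (borel \<Otimes>\<^sub>M borel)" by measurable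
      have "(\<lambda>p. (fst p, snd p)) \<in> restrict_space lborel {0..T} \<Otimes>\<^sub>M phase_measure \<rightarrow>\<^sub>M borel \<Otimes>\<^sub>M borel" by measurable
      from measurable_compose[OF this g]
      have "(\<lambda>p. gain \<epsilon> (fst p) (D \<epsilon> (fst p)) (snd p)) \<in> borel_measurable (restrict_space lborel {0..T} \<Otimes>\<^sub>M phase_measure)" by simp
      then show ?thesis by (subst phase.nn_integral_fst[symmetric]) simp_all
    qed
    also have "\<dots> \<le> (\<integral>\<^sup>+s. ennreal (4 * pi * C0) * moment_bound T \<partial>restrict_space lborel {0..T})"
    proof (rule nn_integral_mono)
      fix s assume "s \<in> space (restrict_space lborel {0..T})"
      then have s: "0 \<le> s" "s \<le> T" by (auto simp: space_restrict_space)
      have "(\<integral>\<^sup>+z. gain \<epsilon> s (D \<epsilon> s) z \<partial>phase_measure) = (\<integral>\<^sup>+z. gain \<epsilon> s (D \<epsilon> s) z \<partial>ph)"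
        by (rule nn_integral_phase) measurable
      also have "\<dots> \<le> ennreal (4 * pi * C0) * moment_bound T"
        by (rule order_trans[OF gain_D_integral[OF s(1)] mult_left_mono[OF moment_bound_mono[OF s(2)]]]) simp
      finally show "(\<integral>\<^sup>+z. gain \<epsilon> s (D \<epsilon> s) z \<partial>phase_measure) \<le> ennreal (4 * pi * C0) * moment_bound T" .
    qed
    also have "\<dots> < \<infinity>"
      using moment_bound_finite[of T] assms
      by (simp add: emeasure_restrict_space space_restrict_space ennreal_mult_less_top less_top)
    finally show "(\<integral>\<^sup>+p. ennreal (case p of (s, z) \<Rightarrow> boltzmann_gain g0 \<epsilon> s (boltzmann_sol \<epsilon> s) z) \<partial>(restrict_space lborel {0..T} \<Otimes>\<^sub>M phase_measure)) < \<infinity>" .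
  qed
  fix t assume t: "t \<in> {0..T}"
  have "AE s in lborel. AE z in ph. s \<in> {0..t} \<longrightarrow> regular \<epsilon> s (flow (s - t) z)"
  proof (rule AE_I2)
    fix s :: real
    show "AE z in ph. s \<in> {0..t} \<longrightarrow> regular \<epsilon> s (flow (s - t) z)"
    proof (cases "s \<in> {0..t}")
      case True
      then have "AE z in ph. regular \<epsilon> s (flow (s - t) z)"
        by (intro AE_ph_flow regular_periodic AE_regular) auto
      then show ?thesis by eventually_elim simp
    next
      case False
      then show ?thesis by (intro AE_I2 impI) blast
    qed
  qed
  \<comment> \<open>For each s almost every end point z is regular along its backward flight. The
    mild formula needs the reverse order of the quantifiers, and this measurability permits the
    exchange.\<close>
  moreover have "{p \<in> space (lborel \<Otimes>\<^sub>M ph). fst p \<in> {0..t} \<longrightarrow> regular \<epsilon> (fst p) (flow (fst p - t) (snd p))} \<in> sets (lborel \<Otimes>\<^sub>M ph)"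
    by measurable
  ultimately have "AE z in ph. AE s in lborel. s \<in> {0..t} \<longrightarrow> regular \<epsilon> s (flow (s - t) z)"
    by (simp only: lp.AE_commute[where P="\<lambda>s z. s \<in> {0..t} \<longrightarrow> regular \<epsilon> s (flow (s - t) z)"])
  moreover have "AE z in ph. 0 \<le> f0 (flow (- t) z)"
    using f0_nonneg f0_periodic by (intro AE_ph_flow[where P="\<lambda>z. 0 \<le> f0 z"]) (auto simp: x_periodic_iff)
  moreover have "AE z in ph. D \<epsilon> t z \<noteq> \<infinity>" using t by (intro D_finite) simp
  ultimately have "AE z in ph. boltzmann_sol \<epsilon> t z = evolution g0 \<epsilon> t 0 f0 z
      + (LINT s:{0..t}|lborel. evolution g0 \<epsilon> t s (boltzmann_gain g0 \<epsilon> s (boltzmann_sol \<epsilon> s)) z)"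
  proof eventually_elim
    case (elim z)
    let ?i = "\<lambda>s. indicator {0..t} s *\<^sub>R (no_coll \<epsilon> s t z * boltzmann_gain g0 \<epsilon> s (boltzmann_sol \<epsilon> s) (flow (s - t) z))"
    let ?I = "\<integral>\<^sup>+s. ennreal (no_coll \<epsilon> s t z) * gain \<epsilon> s (D \<epsilon> s) (flow (s - t) z) * indicator {0..t} s \<partial>lborel"
    have Dz: "D \<epsilon> t z = ennreal (no_coll \<epsilon> 0 t z * f0 (flow (- t) z)) + ?I"
      using elim(2) by (subst Ft_mild) (auto simp: ennreal_mult no_coll_pos less_imp_le)
    have "(\<integral>s. ?i s \<partial>lborel) = enn2real (\<integral>\<^sup>+s. ennreal (?i s) \<partial>lborel)"
    proof (rule integral_eq_nn_integral)
      show "AE s in lborel. 0 \<le> ?i s"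
        using elim(1) by eventually_elim (auto simp: indicator_def regularD(3) no_coll_pos less_imp_le)
    qed measurable
    also have "(\<integral>\<^sup>+s. ennreal (?i s) \<partial>lborel) = ?I"
      by (rule nn_integral_cong_AE, use elim(1) in eventually_elim)
         (auto simp: indicator_def regularD(2,3) ennreal_mult no_coll_pos less_imp_le)
    finally have L: "(LINT s:{0..t}|lborel. evolution g0 \<epsilon> t s (boltzmann_gain g0 \<epsilon> s (boltzmann_sol \<epsilon> s)) z) = enn2real ?I"
      unfolding set_lebesgue_integral_def evolution_eq
      by (simp add: flow_def scaleR_diff_left algebra_simps)
    \<comment> \<open>Without finiteness \<open>enn2real\<close> would not be additive here.\<close>
    have "?I \<noteq> \<infinity>" using elim(3) unfolding Dz by auto
    then have "boltzmann_sol \<epsilon> t z = no_coll \<epsilon> 0 t z * f0 (flow (- t) z) + enn2real ?I"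
      unfolding boltzmann_sol_def Dz using elim(2)
      by (subst enn2real_plus) (auto simp: less_top no_coll_pos less_imp_le)
    then show ?case unfolding L unfolding evolution_eq by (simp add: flow_def)
  qed
  then show "AE z in phase_measure. boltzmann_sol \<epsilon> t z = evolution g0 \<epsilon> t 0 f0 z
      + (LINT s:{0..t}|lborel. evolution g0 \<epsilon> t s (boltzmann_gain g0 \<epsilon> s (boltzmann_sol \<epsilon> s)) z)"
    by (rule AE_phaseI)
qed

end

section \<open>Integration over trees\<close>

text \<open>Lifts a decomposition of a measure on sets to integrals, by induction over measurable
  functions. Monotone limits commute with the sum because all terms are nonnegative.\<close>

lemma nn_integral_measure_suminf:
  assumes sets: "\<And>n. sets (N n) = sets M"
    and em: "\<And>A. A \<in> sets M \<Longrightarrow> emeasure M A = (\<Sum>n. emeasure (N n) A)"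
    and f: "f \<in> borel_measurable M"
  shows "(\<integral>\<^sup>+x. f x \<partial>M) = (\<Sum>n. \<integral>\<^sup>+x. f x \<partial>N n)"
proof -
  have meas: "borel_measurable (N n) = borel_measurable M" for n
    by (rule measurable_cong_sets[OF sets refl])
  show ?thesis
    using f
  proof induct
    case (cong f g)
    have "(\<integral>\<^sup>+x. g x \<partial>M) = (\<integral>\<^sup>+x. f x \<partial>M)" by (intro nn_integral_cong) (simp add: cong(3))
    moreover have "(\<integral>\<^sup>+x. g x \<partial>N n) = (\<integral>\<^sup>+x. f x \<partial>N n)" for n
      by (intro nn_integral_cong) (simp add: cong(3) sets_eq_imp_space_eq[OF sets])
    ultimately show ?case by (simp only: cong(4))
  next
    case (set A)
    then show ?case by (simp add: em sets)
  next
    case (mult u c)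
    have "(\<integral>\<^sup>+x. c * u x \<partial>M) = c * (\<integral>\<^sup>+x. u x \<partial>M)" by (rule nn_integral_cmult) fact
    moreover have "(\<integral>\<^sup>+x. c * u x \<partial>N n) = c * (\<integral>\<^sup>+x. u x \<partial>N n)" for n
      by (rule nn_integral_cmult) (simp only: meas mult)
    ultimately show ?case by (simp add: mult(4))
  next
    case (add u v)
    have "(\<integral>\<^sup>+x. v x + u x \<partial>M) = (\<integral>\<^sup>+x. v x \<partial>M) + (\<integral>\<^sup>+x. u x \<partial>M)"
      by (rule nn_integral_add) fact+
    moreover have "(\<integral>\<^sup>+x. v x + u x \<partial>N n) = (\<integral>\<^sup>+x. v x \<partial>N n) + (\<integral>\<^sup>+x. u x \<partial>N n)" for n
      by (rule nn_integral_add) (simp_all only: meas add)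
    ultimately show ?case using add(3,7) by (simp add: suminf_add[OF summableI summableI])
  next
    case (seq U)
    have "(\<integral>\<^sup>+x. (SUP i. U i) x \<partial>M) = (SUP i. \<integral>\<^sup>+x. U i x \<partial>M)"
      unfolding SUP_apply by (intro nn_integral_monotone_convergence_SUP \<open>incseq U\<close> seq(1))
    also have "\<dots> = (SUP i. \<Sum>n. \<integral>\<^sup>+x. U i x \<partial>N n)" by (simp only: seq(3))
    also have "\<dots> = (\<Sum>n. SUP i. \<integral>\<^sup>+x. U i x \<partial>N n)"
      using \<open>incseq U\<close> by (intro ennreal_suminf_SUP_eq[symmetric]) (auto simp: incseq_def le_fun_def intro!: nn_integral_mono)
    also have "\<dots> = (\<Sum>n. \<integral>\<^sup>+x. (SUP i. U i) x \<partial>N n)"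
    proof (rule suminf_cong)
      fix n
      show "(SUP i. \<integral>\<^sup>+x. U i x \<partial>N n) = (\<integral>\<^sup>+x. (SUP i. U i) x \<partial>N n)"
        unfolding SUP_apply
        by (intro nn_integral_monotone_convergence_SUP[symmetric] \<open>incseq U\<close>) (simp only: meas seq(1))
    qed
    finally show ?case .
  qed
qed

lemma tree_vimage_trees: "mk_tree n -` trees T \<inter> space (component_measure T n) \<in> sets (component_measure T n)"
  using trees_in_tree_sets[of T] by (simp add: tree_sets_def)

text \<open>The product space also contains tuples whose times do not increase; the indicator
  discards them.\<close>

definition tree_int :: "real \<Rightarrow> nat \<Rightarrow> (tree \<Rightarrow> ennreal) \<Rightarrow> ennreal" where
  "tree_int T n h = (\<integral>\<^sup>+x. h (mk_tree n x) * indicator (trees T) (mk_tree n x) \<partial>component_measure T n)"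

lemma nn_integral_tree:
  assumes h: "h \<in> borel_measurable (tree_measure T)"
  shows "(\<integral>\<^sup>+\<Phi>. h \<Phi> \<partial>tree_measure T) = (\<Sum>n. tree_int T n h)"
proof -
  \<comment> \<open>\<open>mk_tree n\<close> maps into the space of trees only on this set, so the
    component is restricted to it before it is pushed forward.\<close>
  define A where "A n = mk_tree n -` trees T \<inter> space (component_measure T n)" for n
  have A: "A n \<in> sets (component_measure T n)" for n unfolding A_def by (rule tree_vimage_trees)
  have mk: "mk_tree n \<in> restrict_space (component_measure T n) (A n) \<rightarrow>\<^sub>M tree_measure T" for n
  proof (rule measurableI)
    fix x assume "x \<in> space (restrict_space (component_measure T n) (A n))"
    then show "mk_tree n x \<in> space (tree_measure T)" by (auto simp: space_restrict_space A_def tree_measure(1))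
  next
    fix B assume "B \<in> sets (tree_measure T)"
    then have B: "B \<subseteq> trees T" "mk_tree n -` B \<inter> space (component_measure T n) \<in> sets (component_measure T n)"
      by (auto simp: tree_measure(1,2) tree_sets_def)
    have "mk_tree n -` B \<inter> space (restrict_space (component_measure T n) (A n)) = mk_tree n -` B \<inter> space (component_measure T n)"
      using B(1) by (auto simp: space_restrict_space A_def)
    then show "mk_tree n -` B \<inter> space (restrict_space (component_measure T n) (A n)) \<in> sets (restrict_space (component_measure T n) (A n))"
      using B A[of n] by (subst sets_restrict_space_iff) (auto simp: A_def)
  qed
  let ?N = "\<lambda>n. distr (restrict_space (component_measure T n) (A n)) (tree_measure T) (mk_tree n)"
  have total: "(\<integral>\<^sup>+\<Phi>. h \<Phi> \<partial>tree_measure T) = (\<Sum>n. \<integral>\<^sup>+\<Phi>. h \<Phi> \<partial>?N n)"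
  proof (rule nn_integral_measure_suminf[OF _ _ h])
    fix B assume B: "B \<in> sets (tree_measure T)"
    then have "B \<in> tree_sets T" "B \<subseteq> trees T" by (auto simp: tree_measure(1,2) tree_sets_def)
    have "emeasure (?N n) B = emeasure (component_measure T n) (mk_tree n -` B \<inter> space (component_measure T n))" for n
    proof -
      have "mk_tree n -` B \<inter> space (restrict_space (component_measure T n) (A n)) = mk_tree n -` B \<inter> space (component_measure T n)"
        using \<open>B \<subseteq> trees T\<close> by (auto simp: space_restrict_space A_def)
      then have "emeasure (?N n) B = emeasure (restrict_space (component_measure T n) (A n)) (mk_tree n -` B \<inter> space (component_measure T n))"
        using B by (subst emeasure_distr[OF mk]) auto
      also have "\<dots> = emeasure (component_measure T n) (mk_tree n -` B \<inter> space (component_measure T n))"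
        using \<open>B \<subseteq> trees T\<close> A[of n] by (intro emeasure_restrict_space) (auto simp: A_def)
      finally show ?thesis .
    qed
    then show "emeasure (tree_measure T) B = (\<Sum>n. emeasure (?N n) B)"
      using tree_measure(3)[OF \<open>B \<in> tree_sets T\<close>] by simp
  qed simp
  have "(\<integral>\<^sup>+\<Phi>. h \<Phi> \<partial>?N n) = tree_int T n h" for n
  proof -
    have "(\<integral>\<^sup>+\<Phi>. h \<Phi> \<partial>?N n) = (\<integral>\<^sup>+x. h (mk_tree n x) \<partial>restrict_space (component_measure T n) (A n))"
      by (rule nn_integral_distr[OF mk]) (simp only: measurable_distr_eq1 h)
    also have "\<dots> = (\<integral>\<^sup>+x. h (mk_tree n x) * indicator (A n) x \<partial>component_measure T n)"
      using A[of n] by (intro nn_integral_restrict_space) simp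
    also have "\<dots> = tree_int T n h"
      unfolding tree_int_def by (intro nn_integral_cong) (simp add: A_def indicator_def)
    finally show ?thesis .
  qed
  then show ?thesis unfolding total by simp
qed

text \<open>Measurability on each component with respect to plain Borel sets. It does not depend on
  T and, unlike measurability for \<open>tree_measure T\<close>, passes to trees extended by one
  collision.\<close>

definition tree_borel :: "(tree \<Rightarrow> 'b::topological_space) \<Rightarrow> bool" where
  "tree_borel h \<longleftrightarrow> (\<forall>n. (\<lambda>p. h (fst p, map (snd p) [0..<n])) \<in> borel_measurable (borel \<Otimes>\<^sub>M PiM {..<n} (\<lambda>_. borel)))"

lemma tree_borel_comp:
  assumes h: "tree_borel h" and Z: "Z \<in> borel_measurable M" and C: "\<And>i. i < n \<Longrightarrow> C i \<in> borel_measurable M"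
  shows "(\<lambda>x. h (Z x, map (\<lambda>i. C i x) [0..<n])) \<in> borel_measurable M"
proof -
  have "(\<lambda>x. (Z x, \<lambda>i\<in>{..<n}. C i x)) \<in> M \<rightarrow>\<^sub>M borel \<Otimes>\<^sub>M PiM {..<n} (\<lambda>_. borel)"
    using Z C by (intro measurable_Pair measurable_restrict) auto
  from measurable_compose[OF this, of "\<lambda>p. h (fst p, map (snd p) [0..<n])"] h
  have "(\<lambda>x. h (Z x, map (\<lambda>i\<in>{..<n}. C i x) [0..<n])) \<in> borel_measurable M"
    by (simp add: tree_borel_def)
  moreover have "map (\<lambda>i\<in>{..<n}. C i x) [0..<n] = map (\<lambda>i. C i x) [0..<n]" for x
    by (rule map_cong) auto
  ultimately show ?thesis by simp
qed

lemma collision_measure_ident: "(\<lambda>x. x) \<in> collision_measure T \<rightarrow>\<^sub>M borel"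
proof -
  have "(\<lambda>x. x) \<in> restrict_space lborel {0..T} \<rightarrow>\<^sub>M borel" by (rule measurable_restrict_space1) simp
  then have "(\<lambda>x. (fst x, snd x)) \<in> collision_measure T \<rightarrow>\<^sub>M borel \<Otimes>\<^sub>M (borel \<Otimes>\<^sub>M borel)"
    unfolding collision_measure_def
    by (intro measurable_Pair measurable_compose[OF measurable_fst, of "\<lambda>x. x", simplified]
        measurable_compose[OF measurable_snd sphere_lborel_ident, simplified])
  then show ?thesis by (simp add: borel_prod)
qed

lemma component_fst: "fst \<in> component_measure T n \<rightarrow>\<^sub>M borel"
  unfolding component_measure_def by (rule measurable_compose[OF measurable_fst, of "\<lambda>x. x", simplified]) simp

lemma component_snd: "i < n \<Longrightarrow> (\<lambda>x. snd x i) \<in> component_measure T n \<rightarrow>\<^sub>M borel"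
  unfolding component_measure_def
  by (rule measurable_compose[OF _ collision_measure_ident])
     (rule measurable_compose[OF measurable_snd measurable_component_singleton], simp)

lemma tree_borel_mk_tree:
  assumes "tree_borel h"
  shows "(\<lambda>x. h (mk_tree n x)) \<in> borel_measurable (component_measure T n)"
proof -
  have "(\<lambda>x. h (fst x, map (\<lambda>i. snd x i) [0..<n])) \<in> borel_measurable (component_measure T n)"
    by (rule tree_borel_comp[OF assms component_fst component_snd])
  then show ?thesis by (simp add: mk_tree_def case_prod_unfold)
qed

lemma tree_borel_measurable:
  assumes "tree_borel h"
  shows "h \<in> borel_measurable (tree_measure T)"
proof (rule measurableI)
  fix B :: "'a set" assume "B \<in> sets borel"
  have "mk_tree n -` (h -` B \<inter> trees T) \<inter> space (component_measure T n) \<in> sets (component_measure T n)" for n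
  proof -
    have "mk_tree n -` (h -` B \<inter> trees T) \<inter> space (component_measure T n) =
      ((\<lambda>x. h (mk_tree n x)) -` B \<inter> space (component_measure T n)) \<inter> (mk_tree n -` trees T \<inter> space (component_measure T n))"
      by auto
    also have "\<dots> \<in> sets (component_measure T n)"
      using measurable_sets[OF tree_borel_mk_tree[OF assms] \<open>B \<in> sets borel\<close>] tree_vimage_trees by blast
    finally show ?thesis .
  qed
  then show "h -` B \<inter> space (tree_measure T) \<in> sets (tree_measure T)"
    by (auto simp: tree_measure(1,2) tree_sets_def)
qed simp

lemma tree_ind_mk_tree:
  "(\<lambda>x. indicator (trees T) (mk_tree n x) :: ennreal) \<in> borel_measurable (component_measure T n)"
proof -
  have "(\<lambda>x. indicator (mk_tree n -` trees T \<inter> space (component_measure T n)) x :: ennreal) \<in> borel_measurable (component_measure T n)"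
    using tree_vimage_trees by simp
  then show ?thesis by (rule measurable_cong[THEN iffD1, rotated]) (auto simp: indicator_def)
qed

section \<open>Splitting off the last collision\<close>

definition snoc :: "tree \<Rightarrow> collision \<Rightarrow> tree" where
  "snoc \<Phi> c = (fst \<Phi>, snd \<Phi> @ [c])"

lemma sigma_finite_collision_measure: "sigma_finite_measure (collision_measure T)"
proof -
  interpret time: sigma_finite_measure "restrict_space lborel {0..T}" by (rule sigma_finite_time)
  interpret p: pair_sigma_finite "restrict_space lborel {0..T}" "sphere_measure \<Otimes>\<^sub>M (lborel :: r3 measure)" ..
  show ?thesis unfolding collision_measure_def by (rule p.sigma_finite_measure_axioms)
qed

lemma product_sigma_finite_collision: "product_sigma_finite (\<lambda>_. collision_measure T)"
  by (simp add: product_sigma_finite_def sigma_finite_collision_measure)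

lemma sigma_finite_component: "sigma_finite_measure (component_measure T n)"
proof -
  interpret p: product_sigma_finite "\<lambda>_::nat. collision_measure T" by (rule product_sigma_finite_collision)
  interpret s: sigma_finite_measure "PiM {..<n} (\<lambda>_::nat. collision_measure T)" by (rule p.sigma_finite) simp
  interpret q: pair_sigma_finite phase_measure "PiM {..<n} (\<lambda>_::nat. collision_measure T)" ..
  show ?thesis unfolding component_measure_def by (rule q.sigma_finite_measure_axioms)
qed

lemma nn_integral_component_0:
  "(\<integral>\<^sup>+x. h (mk_tree 0 x) \<partial>component_measure T 0) = (\<integral>\<^sup>+z. h (z, []) \<partial>phase_measure)"
  if "(\<lambda>z. h (z, [])) \<in> borel_measurable borel"
proof -
  interpret p: product_sigma_finite "\<lambda>_::nat. collision_measure T" by (rule product_sigma_finite_collision)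
  interpret s: sigma_finite_measure "PiM {} (\<lambda>_::nat. collision_measure T)" by (rule p.sigma_finite) simp
  have [measurable]: "(\<lambda>z. h (z, [])) \<in> borel_measurable phase_measure"
    by (rule measurable_phase_measureI[OF that])
  have "(\<integral>\<^sup>+x. h (mk_tree 0 x) \<partial>component_measure T 0) = (\<integral>\<^sup>+x. h (fst x, []) \<partial>(phase_measure \<Otimes>\<^sub>M PiM {} (\<lambda>_::nat. collision_measure T)))"
    by (simp add: component_measure_def mk_tree_def case_prod_unfold)
  also have "\<dots> = (\<integral>\<^sup>+z. (\<integral>\<^sup>+c. h (z, []) \<partial>PiM {} (\<lambda>_::nat. collision_measure T)) \<partial>phase_measure)"
    by (subst s.nn_integral_fst[symmetric]) simp_all
  finally show ?thesis by (simp add: PiM_empty)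
qed

lemma nn_integral_component_Suc:
  assumes f: "f \<in> borel_measurable (component_measure T (Suc n))"
  shows "(\<integral>\<^sup>+x. f x \<partial>component_measure T (Suc n)) =
    (\<integral>\<^sup>+x. (\<integral>\<^sup>+y. f (fst x, (snd x)(n := y)) \<partial>collision_measure T) \<partial>component_measure T n)"
proof -
  interpret c: sigma_finite_measure "collision_measure T" by (rule sigma_finite_collision_measure)
  interpret p: product_sigma_finite "\<lambda>_::nat. collision_measure T" by (rule product_sigma_finite_collision)
  interpret s: sigma_finite_measure "PiM {..<n} (\<lambda>_::nat. collision_measure T)" by (rule p.sigma_finite) simp
  interpret s': sigma_finite_measure "PiM {..<Suc n} (\<lambda>_::nat. collision_measure T)" by (rule p.sigma_finite) simp
  have f' [measurable]: "f \<in> borel_measurable (phase_measure \<Otimes>\<^sub>M PiM (insert n {..<n}) (\<lambda>_::nat. collision_measure T))"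
    using f by (simp add: component_measure_def lessThan_Suc)
  have upd: "(\<lambda>p. (fst (fst p), (snd (fst p))(n := snd p))) \<in>
      (phase_measure \<Otimes>\<^sub>M PiM {..<n} (\<lambda>_::nat. collision_measure T)) \<Otimes>\<^sub>M collision_measure T \<rightarrow>\<^sub>M
      phase_measure \<Otimes>\<^sub>M PiM (insert n {..<n}) (\<lambda>_::nat. collision_measure T)"
    by (intro measurable_Pair measurable_compose[OF measurable_fst measurable_fst]
        measurable_fun_upd[where J="{..<n}"] measurable_compose[OF measurable_fst measurable_snd] measurable_snd) auto
  have inner: "(\<lambda>x. \<integral>\<^sup>+y. f (fst x, (snd x)(n := y)) \<partial>collision_measure T) \<in>
      borel_measurable (phase_measure \<Otimes>\<^sub>M PiM {..<n} (\<lambda>_::nat. collision_measure T))"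
    using measurable_compose[OF upd f'] by (intro c.borel_measurable_nn_integral) (simp add: case_prod_unfold)
  have "(\<integral>\<^sup>+x. f x \<partial>component_measure T (Suc n)) =
    (\<integral>\<^sup>+z. (\<integral>\<^sup>+c. f (z, c) \<partial>PiM (insert n {..<n}) (\<lambda>_::nat. collision_measure T)) \<partial>phase_measure)"
    unfolding component_measure_def using s'.nn_integral_fst[of f phase_measure] f' by (simp add: lessThan_Suc)
  also have "\<dots> = (\<integral>\<^sup>+z. (\<integral>\<^sup>+c. (\<integral>\<^sup>+y. f (z, c(n := y)) \<partial>collision_measure T) \<partial>PiM {..<n} (\<lambda>_::nat. collision_measure T)) \<partial>phase_measure)"
  proof (rule nn_integral_cong)
    fix z assume "z \<in> space phase_measure"
    then have "(\<lambda>c. f (z, c)) \<in> borel_measurable (PiM (insert n {..<n}) (\<lambda>_::nat. collision_measure T))" by measurable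
    then show "(\<integral>\<^sup>+c. f (z, c) \<partial>PiM (insert n {..<n}) (\<lambda>_::nat. collision_measure T)) =
      (\<integral>\<^sup>+c. (\<integral>\<^sup>+y. f (z, c(n := y)) \<partial>collision_measure T) \<partial>PiM {..<n} (\<lambda>_::nat. collision_measure T))"
      by (intro p.product_nn_integral_insert) auto
  qed
  also have "\<dots> = (\<integral>\<^sup>+x. (\<integral>\<^sup>+y. f (fst x, (snd x)(n := y)) \<partial>collision_measure T) \<partial>component_measure T n)"
    unfolding component_measure_def using s.nn_integral_fst[OF inner] by simp
  finally show ?thesis .
qed

lemma nn_integral_collision_measure:
  assumes [measurable]: "k \<in> borel_measurable borel"
  shows "(\<integral>\<^sup>+y. k y \<partial>collision_measure T) = (\<integral>\<^sup>+\<tau>. (\<integral>\<^sup>+q. k (\<tau>, q) \<partial>(sph \<Otimes>\<^sub>M lborel)) * indicator {0..T} \<tau> \<partial>lborel)"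
proof -
  have k: "k \<in> borel_measurable (restrict_space lborel {0..T} \<Otimes>\<^sub>M (sphere_measure \<Otimes>\<^sub>M lborel))"
    unfolding collision_measure_def[symmetric] by (rule measurable_compose[OF collision_measure_ident assms])
  have [measurable]: "(\<lambda>q. k (\<tau>, q)) \<in> borel_measurable (borel \<Otimes>\<^sub>M borel)" for \<tau>
  proof -
    have "(\<lambda>q. k (\<tau>, (fst q, snd q))) \<in> borel_measurable (borel \<Otimes>\<^sub>M borel)"
      by (rule measurable_compose[OF _ assms]) measurable
    then show ?thesis by simp
  qed
  have "(\<integral>\<^sup>+y. k y \<partial>collision_measure T) = (\<integral>\<^sup>+\<tau>. (\<integral>\<^sup>+q. k (\<tau>, q) \<partial>(sphere_measure \<Otimes>\<^sub>M lborel)) \<partial>restrict_space lborel {0..T})"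
    unfolding collision_measure_def by (rule sphere_lborel.nn_integral_fst[OF k, symmetric])
  also have "\<dots> = (\<integral>\<^sup>+\<tau>. (\<integral>\<^sup>+q. k (\<tau>, q) \<partial>(sph \<Otimes>\<^sub>M lborel)) \<partial>restrict_space lborel {0..T})"
    by (intro nn_integral_cong nn_integral_sphere_lborel) simp
  finally show ?thesis by (simp add: nn_integral_restrict_space)
qed

lemma snoc_in_trees:
  assumes "\<tau> \<in> {0..T}" "fst q \<in> sphere 0 1"
  shows "snoc \<Phi> (\<tau>, q) \<in> trees T \<longleftrightarrow> \<Phi> \<in> trees T \<and> (ncoll \<Phi> = 0 \<or> tau \<Phi> < \<tau>)"
proof (cases "snd \<Phi>" rule: rev_cases)
  case Nil
  then show ?thesis using assms by (cases \<Phi>; cases q) (auto simp: snoc_def trees_def ncoll_def)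
next
  case (snoc cs c)
  then show ?thesis using assms
    by (cases \<Phi>; cases q) (auto simp: snoc_def trees_def ncoll_def tau_def sorted_wrt_append)
qed

text \<open>The innermost integral is over the last collision; the ordering of the times constrains
  it only through \<open>tau\<close> of the shorter tree.\<close>

lemma tree_int_Suc:
  assumes h: "tree_borel h"
  shows "tree_int T (Suc n) h = tree_int T n (\<lambda>\<Phi>. \<integral>\<^sup>+\<tau>. (\<integral>\<^sup>+q. h (snoc \<Phi> (\<tau>, q)) \<partial>(sph \<Otimes>\<^sub>M lborel)) *
    indicator {\<tau>. 0 \<le> \<tau> \<and> \<tau> \<le> T \<and> (ncoll \<Phi> = 0 \<or> tau \<Phi> < \<tau>)} \<tau> \<partial>lborel)"
proof -
  have "tree_int T (Suc n) h = (\<integral>\<^sup>+x. (\<integral>\<^sup>+y. h (mk_tree (Suc n) (fst x, (snd x)(n := y))) *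
      indicator (trees T) (mk_tree (Suc n) (fst x, (snd x)(n := y))) \<partial>collision_measure T) \<partial>component_measure T n)"
    unfolding tree_int_def
    by (rule nn_integral_component_Suc) (intro borel_measurable_times_ennreal tree_borel_mk_tree[OF h] tree_ind_mk_tree)
  also have "\<dots> = tree_int T n (\<lambda>\<Phi>. \<integral>\<^sup>+\<tau>. (\<integral>\<^sup>+q. h (snoc \<Phi> (\<tau>, q)) \<partial>(sph \<Otimes>\<^sub>M lborel)) *
    indicator {\<tau>. 0 \<le> \<tau> \<and> \<tau> \<le> T \<and> (ncoll \<Phi> = 0 \<or> tau \<Phi> < \<tau>)} \<tau> \<partial>lborel)"
    unfolding tree_int_def
  proof (rule nn_integral_cong)
    fix x
    define \<Phi> where "\<Phi> = mk_tree n x"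
    have snoc: "mk_tree (Suc n) (fst x, (snd x)(n := y)) = snoc \<Phi> y" for y
      by (simp add: \<Phi>_def mk_tree_def snoc_def case_prod_unfold)
    let ?J = "{\<tau>. 0 \<le> \<tau> \<and> \<tau> \<le> T \<and> (ncoll \<Phi> = 0 \<or> tau \<Phi> < \<tau>)}"
    have hm: "(\<lambda>y. h (snoc \<Phi> y)) \<in> borel_measurable borel"
    proof -
      have "(\<lambda>y. h (fst x, map (\<lambda>i. ((snd x)(n := y)) i) [0..<Suc n])) \<in> borel_measurable borel"
        by (rule tree_borel_comp[OF h]) (auto simp: fun_upd_def)
      moreover have "map (\<lambda>i. ((snd x)(n := y)) i) [0..<Suc n] = map (snd x) [0..<n] @ [y]" for y by simp
      ultimately show ?thesis by (simp only: \<Phi>_def mk_tree_def snoc_def case_prod_unfold fst_conv snd_conv)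
    qed
    have J: "indicator ?J \<tau> = (if 0 \<le> \<tau> \<and> \<tau> \<le> T \<and> (ncoll \<Phi> = 0 \<or> tau \<Phi> < \<tau>) then 1 else 0 :: ennreal)" for \<tau>
      by simp
    have [measurable]: "(\<lambda>y. h (snoc \<Phi> y) * indicator ?J (fst y)) \<in> borel_measurable borel"
      using hm unfolding J by measurable
    have m: "(\<lambda>q. h (snoc \<Phi> (\<tau>, q))) \<in> borel_measurable (sph \<Otimes>\<^sub>M lborel)" for \<tau>
    proof -
      have "(\<lambda>q. h (snoc \<Phi> (\<tau>, (fst q, snd q)))) \<in> borel_measurable (sph \<Otimes>\<^sub>M lborel)"
        by (rule measurable_compose[OF _ hm]) measurable
      then show ?thesis by simp
    qed
    have "(\<integral>\<^sup>+y. h (snoc \<Phi> y) * indicator (trees T) (snoc \<Phi> y) \<partial>collision_measure T) =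
      (\<integral>\<^sup>+y. (h (snoc \<Phi> y) * indicator ?J (fst y)) * indicator (trees T) \<Phi> \<partial>collision_measure T)"
    proof (rule nn_integral_cong)
      fix y assume "y \<in> space (collision_measure T)"
      then have "fst y \<in> {0..T}" "fst (snd y) \<in> sphere 0 1"
        by (auto simp: collision_measure_def space_pair_measure space_restrict_space)
      then show "h (snoc \<Phi> y) * indicator (trees T) (snoc \<Phi> y) = (h (snoc \<Phi> y) * indicator ?J (fst y)) * indicator (trees T) \<Phi>"
        using snoc_in_trees[of "fst y" T "snd y" \<Phi>] by (auto simp: indicator_def)
    qed
    also have "\<dots> = (\<integral>\<^sup>+y. h (snoc \<Phi> y) * indicator ?J (fst y) \<partial>collision_measure T) * indicator (trees T) \<Phi>"
      by (cases "\<Phi> \<in> trees T") simp_all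
    also have "(\<integral>\<^sup>+y. h (snoc \<Phi> y) * indicator ?J (fst y) \<partial>collision_measure T) =
      (\<integral>\<^sup>+\<tau>. (\<integral>\<^sup>+q. h (snoc \<Phi> (\<tau>, q)) * indicator ?J (fst (\<tau>, q)) \<partial>(sph \<Otimes>\<^sub>M lborel)) * indicator {0..T} \<tau> \<partial>lborel)"
      by (rule nn_integral_collision_measure) measurable
    also have "\<dots> = (\<integral>\<^sup>+\<tau>. (\<integral>\<^sup>+q. h (snoc \<Phi> (\<tau>, q)) \<partial>(sph \<Otimes>\<^sub>M lborel)) * indicator ?J \<tau> \<partial>lborel)"
    proof (rule nn_integral_cong)
      fix \<tau> :: real
      show "(\<integral>\<^sup>+q. h (snoc \<Phi> (\<tau>, q)) * indicator ?J (fst (\<tau>, q)) \<partial>(sph \<Otimes>\<^sub>M lborel)) * indicator {0..T} \<tau> =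
        (\<integral>\<^sup>+q. h (snoc \<Phi> (\<tau>, q)) \<partial>(sph \<Otimes>\<^sub>M lborel)) * indicator ?J \<tau>"
        by (cases "\<tau> \<in> ?J") (auto simp: indicator_def)
    qed
    finally show "(\<integral>\<^sup>+y. h (mk_tree (Suc n) (fst x, (snd x)(n := y))) *
      indicator (trees T) (mk_tree (Suc n) (fst x, (snd x)(n := y))) \<partial>collision_measure T) =
      (\<integral>\<^sup>+\<tau>. (\<integral>\<^sup>+q. h (snoc (mk_tree n x) (\<tau>, q)) \<partial>(sph \<Otimes>\<^sub>M lborel)) *
        indicator {\<tau>. 0 \<le> \<tau> \<and> \<tau> \<le> T \<and> (ncoll (mk_tree n x) = 0 \<or> tau (mk_tree n x) < \<tau>)} \<tau> \<partial>lborel) * indicator (trees T) (mk_tree n x)"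
      unfolding snoc \<Phi>_def[symmetric] .
  qed
  finally show ?thesis .
qed

lemma tree_int_0:
  assumes h: "tree_borel h"
  shows "tree_int T 0 h = (\<integral>\<^sup>+z. h (z, []) \<partial>ph)"
proof -
  have m: "(\<lambda>z. h (z, [])) \<in> borel_measurable borel"
    using tree_borel_comp[OF h, of "\<lambda>z. z" borel 0] by simp
  have "tree_int T 0 h = (\<integral>\<^sup>+x. h (mk_tree 0 x) \<partial>component_measure T 0)"
    unfolding tree_int_def
  proof (rule nn_integral_cong)
    fix x assume "x \<in> space (component_measure T 0)"
    then have "mk_tree 0 x \<in> trees T" by (subst mk_tree_in_trees_iff) auto
    then show "h (mk_tree 0 x) * indicator (trees T) (mk_tree 0 x) = h (mk_tree 0 x)" by simp
  qed
  also have "\<dots> = (\<integral>\<^sup>+z. h (z, []) \<partial>phase_measure)" by (rule nn_integral_component_0[OF m])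
  also have "\<dots> = (\<integral>\<^sup>+z. h (z, []) \<partial>ph)" by (rule nn_integral_phase[OF m])
  finally show ?thesis .
qed

lemma tree_int_cong:
  assumes "\<And>\<Phi>. \<Phi> \<in> trees T \<Longrightarrow> ncoll \<Phi> = n \<Longrightarrow> h \<Phi> = h' \<Phi>"
  shows "tree_int T n h = tree_int T n h'"
  unfolding tree_int_def
proof (rule nn_integral_cong)
  fix x
  have "ncoll (mk_tree n x) = n" by (simp add: mk_tree_def ncoll_def case_prod_unfold)
  then show "h (mk_tree n x) * indicator (trees T) (mk_tree n x) = h' (mk_tree n x) * indicator (trees T) (mk_tree n x)"
    using assms[of "mk_tree n x"] by (auto simp: indicator_def)
qed

lemma tree_int_mono:
  assumes "\<And>\<Phi>. \<Phi> \<in> trees T \<Longrightarrow> ncoll \<Phi> = n \<Longrightarrow> h \<Phi> \<le> h' \<Phi>"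
  shows "tree_int T n h \<le> tree_int T n h'"
  unfolding tree_int_def
proof (rule nn_integral_mono)
  fix x
  have "ncoll (mk_tree n x) = n" by (simp add: mk_tree_def ncoll_def case_prod_unfold)
  then show "h (mk_tree n x) * indicator (trees T) (mk_tree n x) \<le> h' (mk_tree n x) * indicator (trees T) (mk_tree n x)"
    using assms[of "mk_tree n x"] by (auto simp: indicator_def)
qed

section \<open>The solution of the idealised equation\<close>

lemma trajectory_Cons:
  "trajectory z s (c # cs) t =
    (if t < fst c then flow (t - s) z else trajectory (post (flow (fst c - s) z) (snd c)) (fst c) cs t)"
proof -
  obtain x v where z: "z = (x, v)" by (cases z)
  obtain t1 \<nu> w where c: "c = (t1, \<nu>, w)" by (cases c)
  have eq: "v - (\<nu> \<bullet> (v - w)) *\<^sub>R \<nu> = v + (\<nu> \<bullet> (w - v)) *\<^sub>R \<nu>"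
    by (simp add: inner_diff_right scaleR_diff_left)
  show ?thesis by (simp add: z c flow_def post_def flip: eq)
qed

lemma trajectory_Nil: "trajectory z s [] t = flow (t - s) z"
  by (cases z) (simp add: flow_def)

text \<open>\<open>trajectory\<close> recurses from the first collision on, whereas trees grow at
  the last one; this lemma translates between the two directions.\<close>

lemma trajectory_snoc:
  assumes "\<And>c. c \<in> set cs \<Longrightarrow> fst c \<le> \<tau>"
  shows "trajectory z s (cs @ [(\<tau>, q)]) t =
    (if t < \<tau> then trajectory z s cs t else flow (t - \<tau>) (post (trajectory z s cs \<tau>) q))"
  using assms
proof (induction cs arbitrary: z s)
  case Nil
  then show ?case by (simp add: trajectory_Cons trajectory_Nil)
next
  case (Cons c cs)
  have "fst c \<le> \<tau>" using Cons.prems by simp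
  moreover have "c' \<in> set cs \<Longrightarrow> fst c' \<le> \<tau>" for c' using Cons.prems by simp
  ultimately show ?case using Cons.IH by (auto simp: trajectory_Cons)
qed

lemma trajectory_flow:
  assumes "\<And>c. c \<in> set cs \<Longrightarrow> fst c \<le> r" "r \<le> t"
  shows "trajectory z s cs t = flow (t - r) (trajectory z s cs r)"
  using assms
proof (induction cs arbitrary: z s)
  case Nil
  then show ?case by (simp add: trajectory_Nil)
next
  case (Cons c cs)
  have "fst c \<le> r" using Cons.prems by simp
  moreover have "c' \<in> set cs \<Longrightarrow> fst c' \<le> r" for c' using Cons.prems by simp
  ultimately show ?case using Cons.IH Cons.prems(2) by (auto simp: trajectory_Cons)
qed

lemma root_snoc:
  assumes "\<And>c. c \<in> set (snd \<Phi>) \<Longrightarrow> fst c \<le> \<tau>"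
  shows "root (snoc \<Phi> (\<tau>, q)) t = (if t < \<tau> then root \<Phi> t else flow (t - \<tau>) (post (root \<Phi> \<tau>) q))"
  using trajectory_snoc[OF assms] by (simp add: root_def snoc_def)

lemma root_flow:
  assumes "\<And>c. c \<in> set (snd \<Phi>) \<Longrightarrow> fst c \<le> r" "r \<le> t"
  shows "root \<Phi> t = flow (t - r) (root \<Phi> r)"
  using trajectory_flow[OF assms] by (simp add: root_def)

lemma prune_snoc [simp]: "prune (snoc \<Phi> c) = \<Phi>"
  and tau_snoc [simp]: "tau (snoc \<Phi> c) = fst c"
  and ncoll_snoc [simp]: "ncoll (snoc \<Phi> c) = Suc (ncoll \<Phi>)"
  and fst_snoc [simp]: "fst (snoc \<Phi> c) = fst \<Phi>"
  and snd_snoc [simp]: "snd (snoc \<Phi> c) = snd \<Phi> @ [c]"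
  by (simp_all add: prune_def snoc_def tau_def ncoll_def)

lemma snoc_prune: "1 \<le> ncoll \<Phi> \<Longrightarrow> \<Phi> = snoc (prune \<Phi>) (last (snd \<Phi>))"
  by (cases \<Phi>) (auto simp: snoc_def prune_def ncoll_def Suc_le_eq)

lemma trees_le_tau:
  assumes "\<Phi> \<in> trees T" "c \<in> set (snd \<Phi>)"
  shows "fst c \<le> tau \<Phi>"
proof (cases "snd \<Phi>" rule: rev_cases)
  case (snoc cs d)
  then show ?thesis using assms by (cases \<Phi>) (auto simp: trees_def tau_def ncoll_def sorted_wrt_append less_imp_le)
qed (use assms in simp)

lemma trees_tau:
  assumes "\<Phi> \<in> trees T" "0 < T"
  shows "0 \<le> tau \<Phi>" "tau \<Phi> \<le> T"
proof -
  have "\<forall>c\<in>set (snd \<Phi>). 0 \<le> fst c \<and> fst c \<le> T" using assms by (auto simp: trees_def)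
  moreover have "last (snd \<Phi>) \<in> set (snd \<Phi>)" if "ncoll \<Phi> \<noteq> 0" using that by (simp add: ncoll_def)
  ultimately show "0 \<le> tau \<Phi>" "tau \<Phi> \<le> T" using assms(2) by (auto simp: tau_def)
qed

lemma trees_snocE:
  assumes "\<Phi> \<in> trees T" "1 \<le> ncoll \<Phi>"
  obtains \<Psi> \<tau> q where "\<Phi> = snoc \<Psi> (\<tau>, q)" "\<Psi> \<in> trees T" "\<tau> \<in> {0..T}" "norm (fst q) = 1"
    "ncoll \<Psi> = 0 \<or> tau \<Psi> < \<tau>" "tau \<Psi> \<le> \<tau>"
proof -
  obtain \<tau> q where c: "last (snd \<Phi>) = (\<tau>, q)" by (cases "last (snd \<Phi>)")
  have eq: "\<Phi> = snoc (prune \<Phi>) (\<tau>, q)" using snoc_prune[OF assms(2)] c by simp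
  have "last (snd \<Phi>) \<in> set (snd \<Phi>)" using assms(2) by (auto simp: ncoll_def intro!: last_in_set)
  then have "\<tau> \<in> {0..T}" "fst q \<in> sphere 0 1" using assms(1) c by (auto simp: trees_def)
  moreover from snoc_in_trees[OF this, of "prune \<Phi>"] assms(1) eq
  have "prune \<Phi> \<in> trees T" "ncoll (prune \<Phi>) = 0 \<or> tau (prune \<Phi>) < \<tau>" by auto
  moreover have "tau (prune \<Phi>) \<le> \<tau>" using calculation by (auto simp: tau_def)
  ultimately show thesis using that[OF eq] by simp
qed

lemma trajectory_measurable:
  assumes "\<And>i. i \<in> set is \<Longrightarrow> C i \<in> borel_measurable M"
    and "X \<in> borel_measurable M" "S \<in> borel_measurable M" and t: "t \<in> borel_measurable M"
  shows "(\<lambda>x. trajectory (X x) (S x) (map (\<lambda>i. C i x) is) (t x)) \<in> borel_measurable M"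
  using assms(1,2,3)
proof (induction "is" arbitrary: X S)
  case Nil
  note [measurable] = Nil.prems(2,3) t
  show ?case by (simp add: trajectory_Nil)
next
  case (Cons i "is")
  have [measurable]: "C i \<in> borel_measurable M" using Cons.prems by simp
  note [measurable] = Cons.prems(2,3) t
  have [measurable]: "(\<lambda>x. trajectory (post (flow (fst (C i x) - S x) (X x)) (snd (C i x))) (fst (C i x)) (map (\<lambda>i. C i x) is) (t x)) \<in> borel_measurable M"
    using Cons.prems(1) by (intro Cons.IH) (simp, measurable)
  show ?case unfolding list.map trajectory_Cons by measurable
qed

lemma root_measurable:
  assumes "\<And>i. i < n \<Longrightarrow> C i \<in> borel_measurable M" "Z \<in> borel_measurable M" "t \<in> borel_measurable M"
  shows "(\<lambda>x. root (Z x, map (\<lambda>i. C i x) [0..<n]) (t x)) \<in> borel_measurable M"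
  unfolding root_def fst_conv snd_conv by (rule trajectory_measurable) (use assms in auto)

lemma tau_map: "tau (z, map c [0..<n]) = (if n = 0 then 0 else fst (c (n - 1)))"
  by (auto simp: tau_def ncoll_def last_map)

lemma tau_measurable:
  assumes "\<And>i. i < n \<Longrightarrow> C i \<in> borel_measurable M"
  shows "(\<lambda>x. tau (Z x, map (\<lambda>i. C i x) [0..<n])) \<in> borel_measurable M"
proof (cases n)
  case (Suc m)
  then have [measurable]: "C m \<in> borel_measurable M" using assms by simp
  show ?thesis by (simp add: tau_map Suc del: upt_Suc)
qed (simp add: tau_def ncoll_def)

lemma tree_borelI:
  assumes "\<And>n Z C. Z \<in> borel_measurable (borel \<Otimes>\<^sub>M PiM {..<n} (\<lambda>_. borel) :: (phase \<times> (nat \<Rightarrow> collision)) measure) \<Longrightarrow>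
    (\<And>i. i < n \<Longrightarrow> C i \<in> borel_measurable (borel \<Otimes>\<^sub>M PiM {..<n} (\<lambda>_. borel))) \<Longrightarrow>
    (\<lambda>x. h (Z x, map (\<lambda>i. C i x) [0..<n])) \<in> borel_measurable (borel \<Otimes>\<^sub>M PiM {..<n} (\<lambda>_. borel))"
  shows "tree_borel h"
  unfolding tree_borel_def
proof
  fix n
  have "(\<lambda>x. h (fst x, map (\<lambda>i. snd x i) [0..<n])) \<in> borel_measurable (borel \<Otimes>\<^sub>M PiM {..<n} (\<lambda>_. borel))"
    by (rule assms) (auto intro: measurable_compose[OF measurable_snd measurable_component_singleton])
  then show "(\<lambda>x. h (fst x, map (snd x) [0..<n])) \<in> borel_measurable (borel \<Otimes>\<^sub>M PiM {..<n} (\<lambda>_. borel))" by simp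
qed

context transport_data
begin

text \<open>The value of the solution at the time of the last collision, or at time 0 if there is none.\<close>

primrec path_weight :: "real \<Rightarrow> nat \<Rightarrow> tree \<Rightarrow> real" where
  "path_weight \<epsilon> 0 \<Phi> = f0 (fst \<Phi>)"
| "path_weight \<epsilon> (Suc n) \<Phi> = path_weight \<epsilon> n (prune \<Phi>) * no_coll \<epsilon> (tau (prune \<Phi>)) (tau \<Phi>) (root (prune \<Phi>) (tau \<Phi>)) *
     kernel \<epsilon> (tau \<Phi>) (root (prune \<Phi>) (tau \<Phi>)) (snd (last (snd \<Phi>)))"

definition tree_P :: "real \<Rightarrow> real \<Rightarrow> tree \<Rightarrow> real" where
  "tree_P \<epsilon> t \<Phi> = (if t < tau \<Phi> then 0 else path_weight \<epsilon> (ncoll \<Phi>) \<Phi> * no_coll \<epsilon> (tau \<Phi>) t (root \<Phi> t))"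

lemma tree_P_snoc:
  assumes "tau \<Phi> \<le> \<tau>"
  shows "tree_P \<epsilon> t (snoc \<Phi> (\<tau>, q)) =
    (if t < \<tau> then 0 else tree_P \<epsilon> \<tau> \<Phi> * kernel \<epsilon> \<tau> (root \<Phi> \<tau>) q * no_coll \<epsilon> \<tau> t (root (snoc \<Phi> (\<tau>, q)) t))"
  using assms by (simp add: tree_P_def)

lemma tree_P_0: "ncoll \<Phi> = 0 \<Longrightarrow> tree_P \<epsilon> t \<Phi> = (if t < 0 then 0 else f0 (fst \<Phi>) * no_coll \<epsilon> 0 t (flow t (fst \<Phi>)))"
  by (simp add: tree_P_def tau_def root_def ncoll_def trajectory_Nil)

lemma path_weight_measurable:
  assumes C: "\<And>i. i < n \<Longrightarrow> C i \<in> borel_measurable M" and Z: "Z \<in> borel_measurable M"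
  shows "(\<lambda>x. path_weight \<epsilon> n (Z x, map (\<lambda>i. C i x) [0..<n])) \<in> borel_measurable M"
  using C
proof (induction n)
  case 0
  note [measurable] = Z
  show ?case by simp
next
  case (Suc n)
  have pr: "prune (Z x, map (\<lambda>i. C i x) [0..<Suc n]) = (Z x, map (\<lambda>i. C i x) [0..<n])" for x
    by (simp add: prune_def)
  have ta: "tau (Z x, map (\<lambda>i. C i x) [0..<Suc n]) = fst (C n x)" for x by (simp add: tau_map del: upt_Suc)
  have la: "last (snd (Z x, map (\<lambda>i. C i x) [0..<Suc n])) = C n x" for x by simp
  have [measurable]: "C n \<in> borel_measurable M" using Suc.prems by simp
  have [measurable]: "(\<lambda>x. path_weight \<epsilon> n (Z x, map (\<lambda>i. C i x) [0..<n])) \<in> borel_measurable M"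
    using Suc by simp
  have [measurable]: "(\<lambda>x. root (Z x, map (\<lambda>i. C i x) [0..<n]) (fst (C n x))) \<in> borel_measurable M"
    by (rule root_measurable[OF _ Z]) (use Suc.prems in simp, measurable)
  have [measurable]: "(\<lambda>x. tau (Z x, map (\<lambda>i. C i x) [0..<n])) \<in> borel_measurable M"
    by (rule tau_measurable) (use Suc.prems in simp)
  show ?case unfolding path_weight.simps pr ta la by measurable
qed

lemma tree_P_measurable:
  assumes C: "\<And>i. i < n \<Longrightarrow> C i \<in> borel_measurable M" and Z: "Z \<in> borel_measurable M"
    and t [measurable]: "t \<in> borel_measurable M"
  shows "(\<lambda>x. tree_P \<epsilon> (t x) (Z x, map (\<lambda>i. C i x) [0..<n])) \<in> borel_measurable M"
proof -
  have nc: "ncoll (Z x, map (\<lambda>i. C i x) [0..<n]) = n" for x by (simp add: ncoll_def)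
  note [measurable] = path_weight_measurable[OF C Z] root_measurable[OF C Z t] tau_measurable[OF C]
  show ?thesis unfolding tree_P_def nc by measurable
qed

lemma tree_borel_P: "tree_borel (tree_P \<epsilon> t)"
  by (rule tree_borelI) (rule tree_P_measurable, auto)

lemma tree_borel_P_root:
  assumes [measurable]: "\<phi> \<in> borel_measurable borel"
  shows "tree_borel (\<lambda>\<Phi>. ennreal (tree_P \<epsilon> t \<Phi>) * \<phi> (root \<Phi> t))"
proof (rule tree_borelI)
  fix n and Z :: "phase \<times> (nat \<Rightarrow> collision) \<Rightarrow> phase" and C :: "nat \<Rightarrow> phase \<times> (nat \<Rightarrow> collision) \<Rightarrow> collision"
  assume *: "Z \<in> borel_measurable (borel \<Otimes>\<^sub>M PiM {..<n} (\<lambda>_. borel))"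
    "\<And>i. i < n \<Longrightarrow> C i \<in> borel_measurable (borel \<Otimes>\<^sub>M PiM {..<n} (\<lambda>_. borel))"
  have [measurable]: "(\<lambda>x. tree_P \<epsilon> t (Z x, map (\<lambda>i. C i x) [0..<n])) \<in> borel_measurable (borel \<Otimes>\<^sub>M PiM {..<n} (\<lambda>_. borel))"
    by (rule tree_P_measurable[OF *(2) *(1)]) auto
  have [measurable]: "(\<lambda>x. root (Z x, map (\<lambda>i. C i x) [0..<n]) t) \<in> borel_measurable (borel \<Otimes>\<^sub>M PiM {..<n} (\<lambda>_. borel))"
    by (rule root_measurable[OF *(2) *(1)]) auto
  show "(\<lambda>x. ennreal (tree_P \<epsilon> t (Z x, map (\<lambda>i. C i x) [0..<n])) * \<phi> (root (Z x, map (\<lambda>i. C i x) [0..<n]) t))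
    \<in> borel_measurable (borel \<Otimes>\<^sub>M PiM {..<n} (\<lambda>_. borel))" by measurable
qed

text \<open>Integrating out the last collision replaces the test function at time t by
  \<open>scatter \<epsilon> \<tau> (propagate \<epsilon> \<tau> t \<phi>)\<close> at time \<tau>, as
  in \<open>F_Suc_dual\<close>. Hence the induction runs over all times and all periodic test
  functions.\<close>

lemma tree_int_P:
  assumes [measurable]: "\<phi> \<in> borel_measurable borel" and per: "x_periodic \<phi>" and "0 \<le> t" "t \<le> T"
  shows "tree_int T n (\<lambda>\<Phi>. ennreal (tree_P \<epsilon> t \<Phi>) * \<phi> (root \<Phi> t)) = pairing \<epsilon> (\<lambda>z. ennreal (f0 z)) n t \<phi>"
  using assms
proof (induction n arbitrary: t \<phi>)
  case 0
  have "tree_int T 0 (\<lambda>\<Phi>. ennreal (tree_P \<epsilon> t \<Phi>) * \<phi> (root \<Phi> t)) =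
    (\<integral>\<^sup>+z. ennreal (tree_P \<epsilon> t (z, [])) * \<phi> (root (z, []) t) \<partial>ph)"
    by (rule tree_int_0[OF tree_borel_P_root[OF 0(1)]])
  also have "\<dots> = (\<integral>\<^sup>+z. ennreal (f0 z) * propagate \<epsilon> 0 t \<phi> z \<partial>ph)"
    using 0(3) by (simp add: tree_P_0 ncoll_def root_def trajectory_Nil propagate_def ennreal_mult'' no_coll_pos less_imp_le mult.assoc)
  also have "\<dots> = pairing \<epsilon> (\<lambda>z. ennreal (f0 z)) 0 t \<phi>"
    by (rule F_0_dual[OF ef0_measurable 0(1) ef0_periodic 0(2), symmetric])
  finally show ?case .
next
  case (Suc n)
  note [measurable] = Suc.prems(1)
  interpret c: sigma_finite_measure "component_measure T n" by (rule sigma_finite_component)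
  interpret cl: pair_sigma_finite "component_measure T n" "lborel :: real measure" ..
  let ?B = "\<lambda>\<tau>. scatter \<epsilon> \<tau> (propagate \<epsilon> \<tau> t \<phi>)"
  let ?h = "\<lambda>\<Phi>. ennreal (tree_P \<epsilon> t \<Phi>) * \<phi> (root \<Phi> t)"
  have ind: "indicator {0..t} s = (if 0 \<le> s \<and> s \<le> t then 1 else 0 :: ennreal)" for s :: real
    by (simp add: indicator_def)
  have step: "(\<integral>\<^sup>+\<tau>. (\<integral>\<^sup>+q. ?h (snoc \<Phi> (\<tau>, q)) \<partial>(sph \<Otimes>\<^sub>M lborel)) *
      indicator {\<tau>. 0 \<le> \<tau> \<and> \<tau> \<le> T \<and> (ncoll \<Phi> = 0 \<or> tau \<Phi> < \<tau>)} \<tau> \<partial>lborel) =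
    (\<integral>\<^sup>+\<tau>. ennreal (tree_P \<epsilon> \<tau> \<Phi>) * ?B \<tau> (root \<Phi> \<tau>) * indicator {0..t} \<tau> \<partial>lborel)"
    if \<Phi>: "\<Phi> \<in> trees T" for \<Phi>
  \<comment> \<open>At \<open>\<tau> = tau \<Phi>\<close> no further collision may be appended to a
    tree with collisions, but \<open>tree_P\<close> may be positive there; a single time is
    negligible.\<close>
  proof (rule nn_integral_cong_AE, use AE_lborel_singleton[of "tau \<Phi>"] in eventually_elim)
    case (elim \<tau>)
    let ?J = "{\<tau>. 0 \<le> \<tau> \<and> \<tau> \<le> T \<and> (ncoll \<Phi> = 0 \<or> tau \<Phi> < \<tau>)}"
    show ?case
    proof (cases "\<tau> \<in> ?J")
      case J: True
      then have le: "tau \<Phi> \<le> \<tau>" by (auto simp: tau_def)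
      show ?thesis
      proof (cases "\<tau> \<le> t")
        case True
        have root: "root (snoc \<Phi> (\<tau>, q)) t = flow (t - \<tau>) (post (root \<Phi> \<tau>) q)" for q
          using True trees_le_tau[OF \<Phi>] le by (subst root_snoc) (auto intro: order_trans)
        have "(\<integral>\<^sup>+q. ?h (snoc \<Phi> (\<tau>, q)) \<partial>(sph \<Otimes>\<^sub>M lborel)) =
          (\<integral>\<^sup>+q. ennreal (tree_P \<epsilon> \<tau> \<Phi>) * (ennreal (kernel \<epsilon> \<tau> (root \<Phi> \<tau>) q) * propagate \<epsilon> \<tau> t \<phi> (post (root \<Phi> \<tau>) q)) \<partial>(sph \<Otimes>\<^sub>M lborel))"
        proof (rule nn_integral_cong_AE, use AE_params in eventually_elim)
          case (elim q)
          then have "0 \<le> kernel \<epsilon> \<tau> (root \<Phi> \<tau>) q" by (intro kernel_nonneg) simp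
          then show ?case
            using True by (simp add: tree_P_snoc[OF le] root propagate_def ennreal_mult'' no_coll_pos less_imp_le mult.assoc)
        qed
        also have "\<dots> = ennreal (tree_P \<epsilon> \<tau> \<Phi>) * ?B \<tau> (root \<Phi> \<tau>)"
          unfolding scatter_def by (rule nn_integral_cmult) measurable
        finally show ?thesis using J True by (simp add: indicator_def)
      next
        case False
        then have "tree_P \<epsilon> t (snoc \<Phi> (\<tau>, q)) = 0" for q by (simp add: tree_P_snoc[OF le])
        then show ?thesis using False by (simp add: indicator_def)
      qed
    next
      case False
      \<comment> \<open>Outside \<open>?J\<close>, either \<tau> lies outside [0, t], because t
        \<le> T, or it precedes the last collision of \<Phi>, where \<open>tree_P\<close>
        vanishes.\<close>
      then have "tree_P \<epsilon> \<tau> \<Phi> = 0 \<or> \<tau> \<notin> {0..t}"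
        using Suc.prems(4) elim by (auto simp: tree_P_def)
      then show ?thesis using False by (auto simp: indicator_def)
    qed
  qed
  define g where "g \<tau> \<Phi> = ennreal (tree_P \<epsilon> \<tau> \<Phi>) * ?B \<tau> (root \<Phi> \<tau>) * indicator {0..t} \<tau>" for \<tau> \<Phi>
  have gm: "(\<lambda>p. g (snd p) (mk_tree n (fst p)) * indicator (trees T) (mk_tree n (fst p))) \<in> borel_measurable (component_measure T n \<Otimes>\<^sub>M lborel)"
  proof -
    let ?M = "component_measure T n \<Otimes>\<^sub>M (lborel :: real measure)"
    let ?tr = "\<lambda>p :: (phase \<times> (nat \<Rightarrow> collision)) \<times> real. (fst (fst p), map (\<lambda>i. snd (fst p) i) [0..<n])"
    have Z: "(\<lambda>p. fst (fst p)) \<in> borel_measurable ?M" by (rule measurable_compose[OF measurable_fst component_fst])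
    have C: "i < n \<Longrightarrow> (\<lambda>p. snd (fst p) i) \<in> borel_measurable ?M" for i
      by (rule measurable_compose[OF measurable_fst component_snd])
    have [measurable]: "(\<lambda>p. tree_P \<epsilon> (snd p) (?tr p)) \<in> borel_measurable ?M"
      by (rule tree_P_measurable[OF C Z]) auto
    have [measurable]: "(\<lambda>p. root (?tr p) (snd p)) \<in> borel_measurable ?M"
      by (rule root_measurable[OF C Z]) auto
    have [measurable]: "(\<lambda>p. indicator (trees T) (mk_tree n (fst p)) :: ennreal) \<in> borel_measurable ?M"
      by (rule measurable_compose[OF measurable_fst tree_ind_mk_tree])
    have mk: "mk_tree n (fst p) = ?tr p" for p :: "(phase \<times> (nat \<Rightarrow> collision)) \<times> real"
      by (simp add: mk_tree_def case_prod_unfold)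
    have B: "(\<lambda>q. ?B (fst q) (snd q)) \<in> borel_measurable (borel \<Otimes>\<^sub>M borel)" by measurable
    have [measurable]: "(\<lambda>p. ?B (snd p) (root (?tr p) (snd p))) \<in> borel_measurable ?M"
      by (rule measurable_compose[OF _ B, of "\<lambda>p. (snd p, root (?tr p) (snd p))", simplified fst_conv snd_conv]) measurable
    have "(\<lambda>p. ennreal (tree_P \<epsilon> (snd p) (?tr p)) * ?B (snd p) (root (?tr p) (snd p)) * indicator {0..t} (snd p) *
      indicator (trees T) (mk_tree n (fst p))) \<in> borel_measurable ?M" by measurable
    then show ?thesis unfolding g_def mk .
  qed
  have "tree_int T (Suc n) ?h = tree_int T n (\<lambda>\<Phi>. \<integral>\<^sup>+\<tau>. g \<tau> \<Phi> \<partial>lborel)"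
    unfolding tree_int_Suc[OF tree_borel_P_root[OF Suc.prems(1)]] g_def by (rule tree_int_cong) (rule step)
  also have "\<dots> = (\<integral>\<^sup>+x. (\<integral>\<^sup>+\<tau>. g \<tau> (mk_tree n x) * indicator (trees T) (mk_tree n x) \<partial>lborel) \<partial>component_measure T n)"
    unfolding tree_int_def
  proof (rule nn_integral_cong)
    fix x
    show "(\<integral>\<^sup>+\<tau>. g \<tau> (mk_tree n x) \<partial>lborel) * indicator (trees T) (mk_tree n x) =
      (\<integral>\<^sup>+\<tau>. g \<tau> (mk_tree n x) * indicator (trees T) (mk_tree n x) \<partial>lborel)"
      by (cases "mk_tree n x \<in> trees T") simp_all
  qed
  also have "\<dots> = (\<integral>\<^sup>+\<tau>. tree_int T n (g \<tau>) \<partial>lborel)"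
    unfolding tree_int_def by (rule cl.Fubini'[symmetric]) (use gm in \<open>simp add: case_prod_unfold\<close>)
  also have "\<dots> = (\<integral>\<^sup>+\<tau>. pairing \<epsilon> (\<lambda>z. ennreal (f0 z)) n \<tau> (?B \<tau>) * indicator {0..t} \<tau> \<partial>lborel)"
  proof (rule nn_integral_cong)
    fix \<tau> :: real
    show "tree_int T n (g \<tau>) = pairing \<epsilon> (\<lambda>z. ennreal (f0 z)) n \<tau> (?B \<tau>) * indicator {0..t} \<tau>"
    proof (cases "\<tau> \<in> {0..t}")
      case True
      then have "tree_int T n (g \<tau>) = tree_int T n (\<lambda>\<Phi>. ennreal (tree_P \<epsilon> \<tau> \<Phi>) * ?B \<tau> (root \<Phi> \<tau>))"
        by (intro tree_int_cong) (simp add: g_def)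
      also have "\<dots> = pairing \<epsilon> (\<lambda>z. ennreal (f0 z)) n \<tau> (?B \<tau>)"
      proof (rule Suc.IH)
        show "?B \<tau> \<in> borel_measurable borel" by measurable
        show "x_periodic (?B \<tau>)" by (intro scatter_periodic propagate_periodic Suc.prems(2))
      qed (use True Suc.prems in auto)
      finally show ?thesis using True by simp
    next
      case False
      then show ?thesis by (simp add: g_def tree_int_def)
    qed
  qed
  also have "\<dots> = pairing \<epsilon> (\<lambda>z. ennreal (f0 z)) (Suc n) t \<phi>"
    by (rule F_Suc_dual[OF ef0_measurable Suc.prems(1) ef0_periodic Suc.prems(2), symmetric])
  finally show ?case .
qed

lemma nn_integral_tree_P:
  assumes [measurable]: "\<phi> \<in> borel_measurable borel" and per: "x_periodic \<phi>" and "0 \<le> t" "t \<le> T"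
  shows "(\<integral>\<^sup>+\<Phi>. ennreal (tree_P \<epsilon> t \<Phi>) * \<phi> (root \<Phi> t) \<partial>tree_measure T) = (\<integral>\<^sup>+z. D \<epsilon> t z * \<phi> z \<partial>ph)"
proof -
  have "(\<integral>\<^sup>+\<Phi>. ennreal (tree_P \<epsilon> t \<Phi>) * \<phi> (root \<Phi> t) \<partial>tree_measure T) = (\<Sum>n. tree_int T n (\<lambda>\<Phi>. ennreal (tree_P \<epsilon> t \<Phi>) * \<phi> (root \<Phi> t)))"
    by (rule nn_integral_tree[OF tree_borel_measurable[OF tree_borel_P_root[OF assms(1)]]])
  also have "\<dots> = (\<integral>\<^sup>+z. D \<epsilon> t z * \<phi> z \<partial>ph)"
    unfolding tree_int_P[OF assms] by (rule Ft_pairing[symmetric]) measurable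
  finally show ?thesis .
qed

end

section \<open>Properties of the solution\<close>

text \<open>On a finite grid pointwise convergence is uniform, and any t is compared with the grid
  point to its left, at a cost of at most L times the spacing T / n.\<close>

lemma uniform_limit_equi_Lipschitz:
  fixes d :: "real \<Rightarrow> real \<Rightarrow> real"
  assumes T: "0 < T" and L: "0 \<le> L"
    and lim: "\<And>t. t \<in> {0..T} \<Longrightarrow> ((\<lambda>e. d e t) \<longlongrightarrow> 0) F"
    and nonneg: "\<And>e t. 0 \<le> d e t"
    and lip: "\<forall>\<^sub>F e in F. \<forall>s t. 0 \<le> s \<longrightarrow> s \<le> t \<longrightarrow> t \<le> T \<longrightarrow> d e t \<le> d e s + L * (t - s)"
  shows "uniform_limit {0..T} d (\<lambda>_. 0) F"
proof (rule uniform_limitI)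
  fix r :: real assume r: "0 < r"
  \<comment> \<open>Makes the cost between neighbouring grid points less than half of r.\<close>
  obtain n :: nat where n: "2 * L * T / r < real n" using reals_Archimedean2 by blast
  then have n0: "0 < real n" using r L T by (smt (verit) divide_nonneg_pos mult_nonneg_nonneg)
  have small: "L * (T / n) < r / 2"
    using n n0 r by (simp add: field_simps)
  have "\<forall>\<^sub>F e in F. \<forall>i\<in>{..n}. d e (real i * (T / n)) < r / 2"
  proof (rule eventually_ball_finite, simp, rule ballI)
    fix i assume "i \<in> {..n}"
    then have "real i * (T / n) \<in> {0..T}"
      using T n0 by (auto simp: field_simps)
    from order_tendstoD(2)[OF lim[OF this], of "r / 2"] r
    show "\<forall>\<^sub>F e in F. d e (real i * (T / n)) < r / 2" by simp
  qed
  with lip show "\<forall>\<^sub>F e in F. \<forall>t\<in>{0..T}. dist (d e t) 0 < r"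
  proof eventually_elim
    case (elim e)
    show ?case
    proof
      fix t assume t: "t \<in> {0..T}"
      \<comment> \<open>The grid point to the left of t. The value i = n occurs at t = T, so the
        grid includes both ends.\<close>
      define i where "i = nat \<lfloor>t * n / T\<rfloor>"
      have i: "real i \<le> t * n / T" "t * n / T < real i + 1"
        using t T n0 by (auto simp: i_def)
      have "t * n / T \<le> n" using t T n0 by (simp add: field_simps)
      then have "i \<le> n" using i(1) by simp
      have "real i * (T / n) \<le> t" "t < (real i + 1) * (T / n)"
        using i T n0 by (simp_all add: field_simps)
      then have le: "real i * (T / n) \<le> t" "t - real i * (T / n) \<le> T / n"
        using distrib_right[of "real i" 1 "T / real n"] by linarith+
      have "d e t \<le> d e (real i * (T / n)) + L * (t - real i * (T / n))"
        using elim(1) le(1) t T n0 by auto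
      also have "\<dots> \<le> d e (real i * (T / n)) + L * (T / n)"
        using le(2) L by (intro add_left_mono mult_left_mono)
      also have "\<dots> < r / 2 + r / 2"
        using elim(2) \<open>i \<le> n\<close> small by (intro add_strict_mono) auto
      finally show "dist (d e t) 0 < r" using nonneg by (simp add: dist_real_def)
    qed
  qed
qed

lemma torus_rep_cell: "x \<in> cell \<Longrightarrow> torus_rep x = x"
  by (auto simp: cell_def torus_rep_def vec_eq_iff frac_eq)

context transport_data
begin

lemma tree_P_solves:
  assumes "\<Phi> \<in> trees T" and t: "t \<in> {tau \<Phi>..T}"
  shows "((\<lambda>s. tree_P \<epsilon> s \<Phi>) has_real_derivative - tree_loss g0 \<epsilon> t (tree_P \<epsilon> t) \<Phi>) (at t within {tau \<Phi>..T})"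
proof -
  \<comment> \<open>After the last collision the root moves on a straight line, and y is the point
    where this line starts when it is extended back to time 0.\<close>
  define y v w where "y = fst (root \<Phi> (tau \<Phi>)) - tau \<Phi> *\<^sub>R snd (root \<Phi> (tau \<Phi>))"
    and "v = snd (root \<Phi> (tau \<Phi>))" and "w = path_weight \<epsilon> (ncoll \<Phi>) \<Phi>"
  have root: "root \<Phi> s = (y + s *\<^sub>R v, v)" if "tau \<Phi> \<le> s" for s
    using root_flow[of \<Phi> "tau \<Phi>" s] trees_le_tau[OF assms(1)] that
    by (simp add: flow_def y_def v_def scaleR_diff_left)
  have P: "tree_P \<epsilon> s \<Phi> = w * no_coll \<epsilon> (tau \<Phi>) s (y + s *\<^sub>R v, v)" if "tau \<Phi> \<le> s" for s
    using that by (simp add: tree_P_def root w_def)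
  have "((\<lambda>s. w * no_coll \<epsilon> (tau \<Phi>) s (y + s *\<^sub>R v, v)) has_real_derivative
      w * - (no_coll \<epsilon> (tau \<Phi>) t (y + t *\<^sub>R v, v) * Sigma_rate g0 \<epsilon> t (y + t *\<^sub>R v, v))) (at t within {tau \<Phi>..T})"
    using t by (intro DERIV_cmult no_coll_has_derivative) auto
  moreover have "w * - (no_coll \<epsilon> (tau \<Phi>) t (y + t *\<^sub>R v, v) * Sigma_rate g0 \<epsilon> t (y + t *\<^sub>R v, v)) = - tree_loss g0 \<epsilon> t (tree_P \<epsilon> t) \<Phi>"
    using t by (simp add: tree_loss_def loss_rate_def Sigma_rate_def root_pos_def root_vel_def P root)
  ultimately have "((\<lambda>s. w * no_coll \<epsilon> (tau \<Phi>) s (y + s *\<^sub>R v, v)) has_real_derivative - tree_loss g0 \<epsilon> t (tree_P \<epsilon> t) \<Phi>) (at t within {tau \<Phi>..T})"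
    by simp
  then show ?thesis
    by (rule has_field_derivative_transform_within[OF _ zero_less_one t]) (simp add: P)
qed

text \<open>At the collision time the new survival factor is 1, and the position of the root is
  continuous there, so it may be taken from either tree.\<close>

lemma tree_P_gain:
  assumes "\<Phi> \<in> trees T" "1 \<le> ncoll \<Phi>"
  shows "tree_P \<epsilon> (tau \<Phi>) \<Phi> = tree_gain g0 \<epsilon> (tree_P \<epsilon> (tau \<Phi>)) \<Phi>"
proof -
  obtain \<Psi> \<tau> q where \<Phi>: "\<Phi> = snoc \<Psi> (\<tau>, q)" and \<Psi>: "\<Psi> \<in> trees T" and le: "tau \<Psi> \<le> \<tau>"
    by (rule trees_snocE[OF assms])
  have "fst c \<le> \<tau>" if "c \<in> set (snd \<Psi>)" for c using trees_le_tau[OF \<Psi> that] le by simp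
  then have "root \<Phi> \<tau> = post (root \<Psi> \<tau>) q" unfolding \<Phi> by (subst root_snoc) auto
  then have "root_pos \<Phi> \<tau> = fst (root \<Psi> \<tau>)" by (simp add: root_pos_def)
  then show ?thesis
    by (cases q) (simp add: \<Phi> tree_P_snoc[OF le] no_coll_refl tree_gain_def kernel_def root_vel_def transport_def)
qed

text \<open>Almost all trees are good. On the others the representatives of \<open>f0\<close> and \<open>g0\<close> may be negative
  or discontinuous, or a collision takes place at time 0.\<close>

definition good :: "tree \<Rightarrow> bool" where
  "good \<Phi> \<longleftrightarrow> 0 \<le> f0 (fst \<Phi>) \<and> (\<forall>c\<in>set (snd \<Phi>). fst c \<noteq> 0 \<and> snd (snd c) \<notin> N)"

lemma tree_borel_good: "tree_borel (\<lambda>\<Phi>. if good \<Phi> then 0 else \<infinity> :: ennreal)"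
proof (rule tree_borelI)
  fix n and Z :: "phase \<times> (nat \<Rightarrow> collision) \<Rightarrow> phase" and C :: "nat \<Rightarrow> phase \<times> (nat \<Rightarrow> collision) \<Rightarrow> collision"
  let ?M = "borel \<Otimes>\<^sub>M PiM {..<n} (\<lambda>_. borel) :: (phase \<times> (nat \<Rightarrow> collision)) measure"
  assume [measurable]: "Z \<in> borel_measurable ?M" and C: "\<And>i. i < n \<Longrightarrow> C i \<in> borel_measurable ?M"
  have "Measurable.pred ?M (\<lambda>x. \<forall>i\<in>{..<n}. fst (C i x) \<noteq> 0 \<and> snd (snd (C i x)) \<notin> N)"
  proof (rule pred_intros_finite(3))
    fix i assume "i \<in> {..<n}"
    then have [measurable]: "C i \<in> borel_measurable ?M" using C by simp
    show "Measurable.pred ?M (\<lambda>x. fst (C i x) \<noteq> 0 \<and> snd (snd (C i x)) \<notin> N)" by measurable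
  qed simp
  then have [measurable]: "Measurable.pred ?M (\<lambda>x. good (Z x, map (\<lambda>i. C i x) [0..<n]))"
    unfolding good_def by (simp add: atLeast0LessThan)
  show "(\<lambda>x. if good (Z x, map (\<lambda>i. C i x) [0..<n]) then 0 else \<infinity> :: ennreal) \<in> borel_measurable ?M" by measurable
qed

text \<open>The value \<infinity> on bad trees makes the bound trivial when the shorter tree is bad.
  When it is good, the added collision spoils it only at time 0 or for a velocity in
  \<open>N\<close>, and both are null sets.\<close>

lemma tree_int_good: "tree_int T n (\<lambda>\<Phi>. if good \<Phi> then 0 else \<infinity>) = 0"
proof (induction n)
  case 0
  have "tree_int T 0 (\<lambda>\<Phi>. if good \<Phi> then 0 else \<infinity>) = (\<integral>\<^sup>+z. (if 0 \<le> f0 z then 0 else \<infinity>) \<partial>ph)"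
    by (subst tree_int_0[OF tree_borel_good]) (simp add: good_def)
  also have "\<dots> = 0"
    by (subst nn_integral_0_iff_AE) (measurable, use f0_nonneg in eventually_elim, simp)
  finally show ?case .
next
  case (Suc n)
  let ?h = "\<lambda>\<Phi>. if good \<Phi> then 0 else \<infinity> :: ennreal"
  have "tree_int T (Suc n) ?h \<le> tree_int T n ?h"
    unfolding tree_int_Suc[OF tree_borel_good]
  proof (rule tree_int_mono)
    fix \<Phi>
    let ?J = "{\<tau>. 0 \<le> \<tau> \<and> \<tau> \<le> T \<and> (ncoll \<Phi> = 0 \<or> tau \<Phi> < \<tau>)}"
    show "(\<integral>\<^sup>+\<tau>. (\<integral>\<^sup>+q. ?h (snoc \<Phi> (\<tau>, q)) \<partial>(sph \<Otimes>\<^sub>M lborel)) * indicator ?J \<tau> \<partial>lborel) \<le> ?h \<Phi>"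
    proof (cases "good \<Phi>")
      case True
      have "(\<integral>\<^sup>+\<tau>. (\<integral>\<^sup>+q. ?h (snoc \<Phi> (\<tau>, q)) \<partial>(sph \<Otimes>\<^sub>M lborel)) * indicator ?J \<tau> \<partial>lborel) = (\<integral>\<^sup>+\<tau>. 0 \<partial>(lborel :: real measure))"
      proof (rule nn_integral_cong_AE, use AE_lborel_singleton[of 0] in eventually_elim)
        case (elim \<tau>)
        have "(\<integral>\<^sup>+q. ?h (snoc \<Phi> (\<tau>, q)) \<partial>(sph \<Otimes>\<^sub>M lborel)) = (\<integral>\<^sup>+q. 0 \<partial>(sph \<Otimes>\<^sub>M (lborel :: r3 measure)))"
          by (rule nn_integral_cong_AE, use AE_params in eventually_elim)
             (use True elim in \<open>auto simp: good_def\<close>)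
        then show ?case by simp
      qed
      then show ?thesis using True by simp
    qed simp
  qed
  with Suc show ?case by simp
qed

lemma AE_good: "AE \<Phi> in tree_measure T. good \<Phi>"
proof -
  have m: "(\<lambda>\<Phi>. if good \<Phi> then 0 else \<infinity> :: ennreal) \<in> borel_measurable (tree_measure T)"
    by (rule tree_borel_measurable[OF tree_borel_good])
  have "(\<integral>\<^sup>+\<Phi>. (if good \<Phi> then 0 else \<infinity>) \<partial>tree_measure T) = 0"
    unfolding nn_integral_tree[OF m] tree_int_good by simp
  then have "AE \<Phi> in tree_measure T. (if good \<Phi> then 0 else \<infinity>) = (0 :: ennreal)"
    using m by (simp add: nn_integral_0_iff_AE)
  then show ?thesis by eventually_elim (auto split: if_splits)
qed

lemma good_prune: "good \<Phi> \<Longrightarrow> good (prune \<Phi>)"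
  by (auto simp: good_def prune_def dest: in_set_butlastD)

lemma good_last: "good \<Phi> \<Longrightarrow> ncoll \<Phi> = Suc n \<Longrightarrow> snd (snd (last (snd \<Phi>))) \<notin> N"
proof -
  assume "good \<Phi>" and n: "ncoll \<Phi> = Suc n"
  moreover from n have "last (snd \<Phi>) \<in> set (snd \<Phi>)" by (intro last_in_set) (auto simp: ncoll_def)
  ultimately show ?thesis by (simp add: good_def)
qed

lemma ncoll_prune: "ncoll \<Phi> = Suc n \<Longrightarrow> ncoll (prune \<Phi>) = n"
  by (simp add: ncoll_def prune_def)

lemma path_weight_nonneg: "good \<Phi> \<Longrightarrow> ncoll \<Phi> = n \<Longrightarrow> 0 \<le> path_weight \<epsilon> n \<Phi>"
proof (induction n arbitrary: \<Phi>)
  case (Suc n)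
  then show ?case
    using kernel_nonneg[OF good_last[OF Suc.prems]]
    by (simp add: good_prune ncoll_prune no_coll_pos less_imp_le)
qed (simp add: good_def)

lemma tree_P_nonneg: "good \<Phi> \<Longrightarrow> 0 \<le> tree_P \<epsilon> t \<Phi>"
  by (simp add: tree_P_def path_weight_nonneg no_coll_pos less_imp_le)

section \<open>Continuity in \<epsilon> on good trees\<close>

lemma kernel_tendsto:
  assumes "snd q \<notin> N" "e \<longlonglongrightarrow> \<epsilon>"
  shows "(\<lambda>n. kernel (e n) s z q) \<longlonglongrightarrow> kernel \<epsilon> s z q"
proof -
  have "isCont (\<lambda>x. g0 (x, snd q)) (fst z + \<epsilon> *\<^sub>R fst q - s *\<^sub>R snd q)"
    using g0_continuous[OF assms(1)] by (simp add: continuous_on_eq_continuous_at)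
  then have "(\<lambda>n. g0 (fst z + e n *\<^sub>R fst q - s *\<^sub>R snd q, snd q)) \<longlonglongrightarrow> g0 (fst z + \<epsilon> *\<^sub>R fst q - s *\<^sub>R snd q, snd q)"
    by (rule isCont_tendsto_compose) (intro tendsto_intros assms)
  then show ?thesis unfolding kernel_def by (auto intro!: tendsto_intros)
qed

lemma path_weight_tendsto:
  assumes "e \<longlonglongrightarrow> \<epsilon>"
  shows "good \<Phi> \<Longrightarrow> ncoll \<Phi> = n \<Longrightarrow> (\<lambda>k. path_weight (e k) n \<Phi>) \<longlonglongrightarrow> path_weight \<epsilon> n \<Phi>"
proof (induction n arbitrary: \<Phi>)
  case (Suc n)
  show ?case unfolding path_weight.simps
    by (intro tendsto_mult no_coll_tendsto kernel_tendsto assms Suc.IH good_prune ncoll_prune good_last[OF Suc.prems] Suc.prems)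
qed simp

lemma tree_P_tendsto: "e \<longlonglongrightarrow> \<epsilon> \<Longrightarrow> good \<Phi> \<Longrightarrow> (\<lambda>k. tree_P (e k) t \<Phi>) \<longlonglongrightarrow> tree_P \<epsilon> t \<Phi>"
  unfolding tree_P_def by (auto intro!: tendsto_mult path_weight_tendsto no_coll_tendsto)

section \<open>Normalisation and the idealised equation\<close>

lemma tree_P_measurable_tree [measurable]: "tree_P \<epsilon> t \<in> borel_measurable (tree_measure T)"
  by (rule tree_borel_measurable[OF tree_borel_P])

lemma AE_tree_P_nonneg: "AE \<Phi> in tree_measure T. 0 \<le> tree_P \<epsilon> t \<Phi>"
  using AE_good by eventually_elim (rule tree_P_nonneg)

lemma nn_integral_tree_P_one:
  assumes "t \<in> {0..T}"
  shows "(\<integral>\<^sup>+\<Phi>. ennreal (tree_P \<epsilon> t \<Phi>) \<partial>tree_measure T) = 1"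
  using nn_integral_tree_P[of "\<lambda>_. 1" t T \<epsilon>] assms by (simp add: D_mass x_periodic_iff)

lemma integrable_tree_P: "t \<in> {0..T} \<Longrightarrow> integrable (tree_measure T) (tree_P \<epsilon> t)"
  by (rule integrableI_nonneg) (simp_all add: AE_tree_P_nonneg nn_integral_tree_P_one)

lemma integral_tree_P: "t \<in> {0..T} \<Longrightarrow> (\<integral>\<Phi>. tree_P \<epsilon> t \<Phi> \<partial>tree_measure T) = 1"
  by (subst integral_eq_nn_integral) (simp_all add: AE_tree_P_nonneg nn_integral_tree_P_one)

lemma tree_P_prob_density: "t \<in> {0..T} \<Longrightarrow> prob_density (tree_measure T) (tree_P \<epsilon> t)"
  by (simp add: prob_density_def integrable_tree_P AE_tree_P_nonneg integral_tree_P)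

lemma tree_P_idealised_solution:
  assumes "0 < T"
  shows "idealised_solution T \<epsilon> f0 g0 (tree_P \<epsilon>)"
  unfolding idealised_solution_def
proof (intro conjI ballI impI)
  show "integrable (tree_measure T) (tree_P \<epsilon> t)" if "t \<in> {0..T}" for t
    by (rule integrable_tree_P[OF that])
  show "AE \<Phi> in tree_measure T. tree_P \<epsilon> 0 \<Phi> = (if ncoll \<Phi> = 0 then f0 (fst \<Phi>) else 0)"
  proof (rule AE_mp[OF AE_good], rule AE_I2, rule impI)
    fix \<Phi> assume \<Phi>: "\<Phi> \<in> space (tree_measure T)" and good: "good \<Phi>"
    show "tree_P \<epsilon> 0 \<Phi> = (if ncoll \<Phi> = 0 then f0 (fst \<Phi>) else 0)"
    proof (cases "ncoll \<Phi> = 0")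
      case False
      \<comment> \<open>Good trees have no collision at time 0; the exceptional trees with a
        prescribed value at time 0 are thereby excluded.\<close>
      then have "tau \<Phi> \<noteq> 0" using good last_in_set[of "snd \<Phi>"] by (auto simp: good_def tau_def ncoll_def)
      then have "0 < tau \<Phi>" using trees_tau(1)[of \<Phi> T] \<Phi> assms by (simp add: tree_measure(1))
      then show ?thesis using False by (simp add: tree_P_def)
    qed (simp add: tree_P_0 no_coll_refl)
  qed
  fix \<Phi> assume \<Phi>: "\<Phi> \<in> trees T"
  show "tree_P \<epsilon> 0 \<Phi> = f0 (fst \<Phi>)" if "ncoll \<Phi> = 0"
    using that by (simp add: tree_P_0 no_coll_refl)
  show "tree_P \<epsilon> t \<Phi> = 0" if "t \<in> {0..<tau \<Phi>}" for t
    using that by (simp add: tree_P_def)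
  show "tree_P \<epsilon> (tau \<Phi>) \<Phi> = tree_gain g0 \<epsilon> (tree_P \<epsilon> (tau \<Phi>)) \<Phi>" if "1 \<le> ncoll \<Phi>"
    by (rule tree_P_gain[OF \<Phi> that])
  show "((\<lambda>s. tree_P \<epsilon> s \<Phi>) has_real_derivative - tree_loss g0 \<epsilon> t (tree_P \<epsilon> t) \<Phi>) (at t within {tau \<Phi>..T})"
    if "t \<in> {tau \<Phi>..T}" for t
    by (rule tree_P_solves[OF \<Phi> that])
qed

section \<open>First moment at the last collision\<close>

abbreviation tau_speed :: "tree \<Rightarrow> real" where
  "tau_speed \<Phi> \<equiv> 1 + norm (root_vel \<Phi> (tau \<Phi>))"

lemma tau_speed_measurable [measurable]: "tau_speed \<in> borel_measurable (tree_measure T)"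
proof (rule tree_borel_measurable, rule tree_borelI)
  fix n and Z :: "phase \<times> (nat \<Rightarrow> collision) \<Rightarrow> phase" and C :: "nat \<Rightarrow> phase \<times> (nat \<Rightarrow> collision) \<Rightarrow> collision"
  let ?M = "borel \<Otimes>\<^sub>M PiM {..<n} (\<lambda>_. borel) :: (phase \<times> (nat \<Rightarrow> collision)) measure"
  assume Z: "Z \<in> borel_measurable ?M" and C: "\<And>i. i < n \<Longrightarrow> C i \<in> borel_measurable ?M"
  have [measurable]: "(\<lambda>x. root (Z x, map (\<lambda>i. C i x) [0..<n]) (tau (Z x, map (\<lambda>i. C i x) [0..<n]))) \<in> borel_measurable ?M"
    by (rule root_measurable[OF C Z tau_measurable[OF C]])
  show "(\<lambda>x. tau_speed (Z x, map (\<lambda>i. C i x) [0..<n])) \<in> borel_measurable ?M"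
    unfolding root_vel_def by measurable
qed

text \<open>The velocity is constant after the last collision and \<open>tree_P\<close> vanishes
  before it. So v(\<tau>) may be replaced by v(t), and the moment bound for the density of the root
  applies.\<close>

lemma nn_integral_tree_P_speed:
  assumes t: "t \<in> {0..T}"
  shows "(\<integral>\<^sup>+\<Phi>. ennreal (tree_P \<epsilon> t \<Phi> * tau_speed \<Phi>) \<partial>tree_measure T) \<le> moment_bound T"
proof -
  have "(\<integral>\<^sup>+\<Phi>. ennreal (tree_P \<epsilon> t \<Phi> * tau_speed \<Phi>) \<partial>tree_measure T) =
    (\<integral>\<^sup>+\<Phi>. ennreal (tree_P \<epsilon> t \<Phi>) * speed_weight (root \<Phi> t) \<partial>tree_measure T)"
  proof (rule nn_integral_cong)
    fix \<Phi> assume "\<Phi> \<in> space (tree_measure T)"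
    then have \<Phi>: "\<Phi> \<in> trees T" by (simp add: tree_measure(1))
    show "ennreal (tree_P \<epsilon> t \<Phi> * tau_speed \<Phi>) = ennreal (tree_P \<epsilon> t \<Phi>) * speed_weight (root \<Phi> t)"
    proof (cases "t < tau \<Phi>")
      case False
      then have "snd (root \<Phi> t) = root_vel \<Phi> (tau \<Phi>)"
        using root_flow[of \<Phi> "tau \<Phi>" t] trees_le_tau[OF \<Phi>] by (simp add: root_vel_def)
      then show ?thesis by (simp only:) (rule ennreal_mult'', simp)
    qed (simp add: tree_P_def)
  qed
  also have "\<dots> = (\<integral>\<^sup>+z. D \<epsilon> t z * speed_weight z \<partial>ph)"
    using t by (intro nn_integral_tree_P) (auto simp: x_periodic_iff)
  also have "\<dots> \<le> moment_bound T"
    using t by (intro order_trans[OF D_moment moment_bound_mono]) auto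
  finally show ?thesis .
qed

lemma integrable_tree_P_speed:
  assumes "t \<in> {0..T}"
  shows "integrable (tree_measure T) (\<lambda>\<Phi>. tree_P \<epsilon> t \<Phi> * tau_speed \<Phi>)"
proof (rule integrableI_nonneg)
  show "AE \<Phi> in tree_measure T. 0 \<le> tree_P \<epsilon> t \<Phi> * tau_speed \<Phi>"
    using AE_tree_P_nonneg[where \<epsilon>=\<epsilon> and t=t] by eventually_elim simp
  show "(\<integral>\<^sup>+\<Phi>. ennreal (tree_P \<epsilon> t \<Phi> * tau_speed \<Phi>) \<partial>tree_measure T) < \<infinity>"
    by (rule le_less_trans[OF nn_integral_tree_P_speed[OF assms] moment_bound_finite])
qed measurable

lemma integral_tree_P_speed_le:
  assumes "t \<in> {0..T}"
  shows "(\<integral>\<Phi>. tree_P \<epsilon> t \<Phi> * tau_speed \<Phi> \<partial>tree_measure T) \<le> enn2real (moment_bound T)"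
proof -
  have "AE \<Phi> in tree_measure T. 0 \<le> tree_P \<epsilon> t \<Phi> * tau_speed \<Phi>"
    using AE_tree_P_nonneg[where \<epsilon>=\<epsilon> and t=t] by eventually_elim simp
  then have "(\<integral>\<Phi>. tree_P \<epsilon> t \<Phi> * tau_speed \<Phi> \<partial>tree_measure T) =
    enn2real (\<integral>\<^sup>+\<Phi>. ennreal (tree_P \<epsilon> t \<Phi> * tau_speed \<Phi>) \<partial>tree_measure T)"
    by (intro integral_eq_nn_integral) measurable
  also have "\<dots> \<le> enn2real (moment_bound T)"
    using moment_bound_finite by (intro enn2real_mono nn_integral_tree_P_speed assms) simp
  finally show ?thesis .
qed

section \<open>The law of the root\<close>

lemma S_set_measurable:
  assumes "\<Omega> \<in> sets borel"
  shows "S_set T t \<Omega> \<in> sets (tree_measure T)"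
proof -
  have "tree_borel (\<lambda>\<Phi>. (torus_rep (root_pos \<Phi> t), root_vel \<Phi> t))"
  proof (rule tree_borelI)
    fix n and Z :: "phase \<times> (nat \<Rightarrow> collision) \<Rightarrow> phase" and C :: "nat \<Rightarrow> phase \<times> (nat \<Rightarrow> collision) \<Rightarrow> collision"
    let ?M = "borel \<Otimes>\<^sub>M PiM {..<n} (\<lambda>_. borel) :: (phase \<times> (nat \<Rightarrow> collision)) measure"
    assume Z: "Z \<in> borel_measurable ?M" and C: "\<And>i. i < n \<Longrightarrow> C i \<in> borel_measurable ?M"
    have [measurable]: "(\<lambda>x. root (Z x, map (\<lambda>i. C i x) [0..<n]) t) \<in> borel_measurable ?M"
      by (rule root_measurable[OF C Z]) auto
    show "(\<lambda>x. (torus_rep (root_pos (Z x, map (\<lambda>i. C i x) [0..<n]) t), root_vel (Z x, map (\<lambda>i. C i x) [0..<n]) t)) \<in> borel_measurable ?M"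
      unfolding root_vel_def root_pos_def by measurable
  qed
  from measurable_sets[OF tree_borel_measurable[OF this] assms, of T]
  show ?thesis by (simp add: S_set_def tree_measure(1) vimage_def Int_def conj_commute)
qed

lemma density_eq:
  assumes t: "t \<in> {0..T}" and \<Omega>: "\<Omega> \<in> sets phase_measure"
  shows "S_set T t \<Omega> \<in> sets (tree_measure T)"
    and "(LINT z:\<Omega>|phase_measure. boltzmann_sol \<epsilon> t z) = (LINT \<Phi>:S_set T t \<Omega>|tree_measure T. tree_P \<epsilon> t \<Phi>)"
proof -
  have [measurable]: "\<Omega> \<in> sets borel"
    using \<Omega> cell_UNIV unfolding phase_measure_def by (auto simp: sets_restrict_space_iff)
  show S [measurable]: "S_set T t \<Omega> \<in> sets (tree_measure T)" by (rule S_set_measurable) fact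
  \<comment> \<open>Positions of roots are not reduced to the cell, so the indicator is folded with
    \<open>torus_rep\<close>. This also makes it an admissible periodic test function.\<close>
  define \<phi> where "\<phi> z = (indicator \<Omega> (torus_rep (fst z), snd z) :: ennreal)" for z :: phase
  have [measurable]: "\<phi> \<in> borel_measurable borel"
  proof -
    have "(\<lambda>z. (torus_rep (fst z), snd z)) \<in> borel \<rightarrow>\<^sub>M (borel :: phase measure)" by measurable
    from measurable_compose[OF this borel_measurable_indicator[of \<Omega> borel]] show ?thesis unfolding \<phi>_def by simp
  qed
  have per: "x_periodic \<phi>" by (simp add: x_periodic_iff \<phi>_def torus_rep_shift)
  have "(LINT \<Phi>:S_set T t \<Omega>|tree_measure T. tree_P \<epsilon> t \<Phi>) =
    enn2real (\<integral>\<^sup>+\<Phi>. ennreal (indicator (S_set T t \<Omega>) \<Phi> *\<^sub>R tree_P \<epsilon> t \<Phi>) \<partial>tree_measure T)"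
    unfolding set_lebesgue_integral_def
  proof (rule integral_eq_nn_integral)
    show "AE \<Phi> in tree_measure T. 0 \<le> indicator (S_set T t \<Omega>) \<Phi> *\<^sub>R tree_P \<epsilon> t \<Phi>"
      using AE_tree_P_nonneg[where \<epsilon>=\<epsilon> and t=t] by eventually_elim simp
  qed measurable
  also have "(\<integral>\<^sup>+\<Phi>. ennreal (indicator (S_set T t \<Omega>) \<Phi> *\<^sub>R tree_P \<epsilon> t \<Phi>) \<partial>tree_measure T) =
    (\<integral>\<^sup>+\<Phi>. ennreal (tree_P \<epsilon> t \<Phi>) * \<phi> (root \<Phi> t) \<partial>tree_measure T)"
    by (intro nn_integral_cong) (simp add: \<phi>_def S_set_def tree_measure(1) root_pos_def root_vel_def indicator_def)
  also have "\<dots> = (\<integral>\<^sup>+z. D \<epsilon> t z * \<phi> z \<partial>ph)"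
    using t by (intro nn_integral_tree_P per) auto
  also have "\<dots> = (\<integral>\<^sup>+z. D \<epsilon> t z * \<phi> z \<partial>phase_measure)"
    by (rule nn_integral_phase[symmetric]) measurable
  also have "\<dots> = (\<integral>\<^sup>+z. ennreal (indicator \<Omega> z *\<^sub>R boltzmann_sol \<epsilon> t z) \<partial>phase_measure)"
  proof (rule nn_integral_cong_AE, rule AE_mp[OF AE_phaseI[OF D_finite[of t \<epsilon>]]])
    show "AE z in phase_measure. D \<epsilon> t z \<noteq> \<infinity> \<longrightarrow> D \<epsilon> t z * \<phi> z = ennreal (indicator \<Omega> z *\<^sub>R boltzmann_sol \<epsilon> t z)"
    proof (rule AE_I2, rule impI)
      fix z assume "z \<in> space phase_measure" and fin: "D \<epsilon> t z \<noteq> \<infinity>"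
      then have "torus_rep (fst z) = fst z"
        by (auto simp: phase_measure_def space_restrict_space torus_rep_cell)
      then show "D \<epsilon> t z * \<phi> z = ennreal (indicator \<Omega> z *\<^sub>R boltzmann_sol \<epsilon> t z)"
        using fin by (simp add: \<phi>_def boltzmann_sol_def indicator_def less_top)
    qed
  qed (use t in simp)
  also have "enn2real \<dots> = (LINT z:\<Omega>|phase_measure. boltzmann_sol \<epsilon> t z)"
    unfolding set_lebesgue_integral_def
  proof (rule integral_eq_nn_integral[symmetric])
    show "(\<lambda>z. indicator \<Omega> z *\<^sub>R boltzmann_sol \<epsilon> t z) \<in> borel_measurable phase_measure"
      by (rule measurable_phase_measureI) measurable
  qed (simp add: boltzmann_sol_def)
  finally show "(LINT z:\<Omega>|phase_measure. boltzmann_sol \<epsilon> t z) = (LINT \<Phi>:S_set T t \<Omega>|tree_measure T. tree_P \<epsilon> t \<Phi>)" by simp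
qed

text \<open>On a fixed tree the value decreases only through the survival factor. The appearance of
  a tree at its last collision is an increase, so it does not enter this one-sided bound.\<close>

lemma tree_P_decay:
  assumes \<Phi>: "\<Phi> \<in> trees T" "good \<Phi>" and "s \<le> t"
  shows "tree_P \<epsilon> s \<Phi> - tree_P \<epsilon> t \<Phi> \<le> 4 * pi * C0 * (t - s) * (tree_P \<epsilon> s \<Phi> * tau_speed \<Phi>)"
    and "0 \<le> 4 * pi * C0 * (t - s) * (tree_P \<epsilon> s \<Phi> * tau_speed \<Phi>)"
proof -
  show nonneg: "0 \<le> 4 * pi * C0 * (t - s) * (tree_P \<epsilon> s \<Phi> * tau_speed \<Phi>)"
    using C0_nonneg assms by (simp add: tree_P_nonneg)
  show "tree_P \<epsilon> s \<Phi> - tree_P \<epsilon> t \<Phi> \<le> 4 * pi * C0 * (t - s) * (tree_P \<epsilon> s \<Phi> * tau_speed \<Phi>)"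
  proof (cases "s < tau \<Phi>")
    case True
    then have "tree_P \<epsilon> s \<Phi> = 0" by (simp add: tree_P_def)
    then show ?thesis using tree_P_nonneg[OF \<Phi>(2), of \<epsilon> t] by simp
  next
    case False
    define y v where "y = fst (root \<Phi> (tau \<Phi>)) - tau \<Phi> *\<^sub>R snd (root \<Phi> (tau \<Phi>))"
      and "v = snd (root \<Phi> (tau \<Phi>))"
    have root: "root \<Phi> r = (y + r *\<^sub>R v, v)" if "tau \<Phi> \<le> r" for r
      using root_flow[of \<Phi> "tau \<Phi>" r] trees_le_tau[OF \<Phi>(1)] that
      by (simp add: flow_def y_def v_def scaleR_diff_left)
    have P: "tree_P \<epsilon> t \<Phi> = tree_P \<epsilon> s \<Phi> * no_coll \<epsilon> s t (y + t *\<^sub>R v, v)"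
      using False assms(3) no_coll_split[of "tau \<Phi>" s t \<epsilon> y v] by (simp add: tree_P_def root)
    have "tree_P \<epsilon> s \<Phi> * (1 - no_coll \<epsilon> s t (y + t *\<^sub>R v, v)) \<le> tree_P \<epsilon> s \<Phi> * (4 * pi * C0 * (1 + norm v) * (t - s))"
      using no_coll_ge[OF assms(3), of "(y + t *\<^sub>R v, v)" \<epsilon>]
      by (intro mult_left_mono tree_P_nonneg \<Phi>) simp
    then show ?thesis by (simp add: P root_vel_def v_def algebra_simps)
  qed
qed

text \<open>Both distributions have mass one, so the positive part of \<open>P\<^sub>s - P\<^sub>t\<close> controls its modulus. The
  constant does not depend on \<open>\<epsilon>\<close>, which makes the limit in \<open>\<epsilon>\<close> uniform in time.\<close>

lemma tree_P_Lipschitz: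
  assumes s: "0 \<le> s" "s \<le> t" "t \<le> T"
  shows "(\<integral>\<Phi>. \<bar>tree_P \<epsilon> t \<Phi> - tree_P \<epsilon> s \<Phi>\<bar> \<partial>tree_measure T) \<le> 8 * pi * C0 * enn2real (moment_bound T) * (t - s)"
proof -
  have st: "s \<in> {0..T}" "t \<in> {0..T}" using s by auto
  note int = integrable_tree_P[OF st(1), of \<epsilon>] integrable_tree_P[OF st(2), of \<epsilon>] integrable_tree_P_speed[OF st(1), of \<epsilon>]
  let ?b = "\<lambda>\<Phi>. 4 * pi * C0 * (t - s) * (tree_P \<epsilon> s \<Phi> * tau_speed \<Phi>)"
  have "(\<integral>\<Phi>. \<bar>tree_P \<epsilon> t \<Phi> - tree_P \<epsilon> s \<Phi>\<bar> \<partial>tree_measure T) \<le>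
    (\<integral>\<Phi>. (tree_P \<epsilon> t \<Phi> - tree_P \<epsilon> s \<Phi>) + 2 * ?b \<Phi> \<partial>tree_measure T)"
  proof (rule integral_mono_AE)
    show "AE \<Phi> in tree_measure T. \<bar>tree_P \<epsilon> t \<Phi> - tree_P \<epsilon> s \<Phi>\<bar> \<le> (tree_P \<epsilon> t \<Phi> - tree_P \<epsilon> s \<Phi>) + 2 * ?b \<Phi>"
    proof (rule AE_mp[OF AE_good], rule AE_I2, rule impI)
      fix \<Phi> assume "\<Phi> \<in> space (tree_measure T)" "good \<Phi>"
      then have "\<Phi> \<in> trees T" by (simp add: tree_measure(1))
      from tree_P_decay[OF this \<open>good \<Phi>\<close> s(2), of \<epsilon>]
      show "\<bar>tree_P \<epsilon> t \<Phi> - tree_P \<epsilon> s \<Phi>\<bar> \<le> (tree_P \<epsilon> t \<Phi> - tree_P \<epsilon> s \<Phi>) + 2 * ?b \<Phi>" by linarith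
    qed
  qed (use int in auto)
  \<comment> \<open>The difference of two probability densities integrates to 0, so only twice the
    decay bound remains.\<close>
  also have "\<dots> = 2 * (4 * pi * C0 * (t - s) * (\<integral>\<Phi>. tree_P \<epsilon> s \<Phi> * tau_speed \<Phi> \<partial>tree_measure T))"
    using int by (simp add: integral_tree_P[OF st(1)] integral_tree_P[OF st(2)])
  also have "\<dots> \<le> 2 * (4 * pi * C0 * (t - s) * enn2real (moment_bound T))"
    using s C0_nonneg by (intro mult_left_mono integral_tree_P_speed_le st) auto
  finally show ?thesis by (simp add: algebra_simps)
qed

lemma tree_P_limit:
  assumes t: "t \<in> {0..T}"
  shows "((\<lambda>\<epsilon>. \<integral>\<Phi>. \<bar>tree_P 0 t \<Phi> - tree_P \<epsilon> t \<Phi>\<bar> \<partial>tree_measure T) \<longlongrightarrow> 0) (at_right 0)"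
  unfolding tendsto_at_iff_sequentially comp_def
proof (intro allI impI)
  fix e :: "nat \<Rightarrow> real" assume e: "e \<longlonglongrightarrow> 0"
  have abs: "(\<integral>\<^sup>+\<Phi>. ennreal (norm (tree_P \<epsilon> t \<Phi>)) \<partial>tree_measure T) = 1" for \<epsilon>
  proof -
    have "(\<integral>\<^sup>+\<Phi>. ennreal (norm (tree_P \<epsilon> t \<Phi>)) \<partial>tree_measure T) = (\<integral>\<^sup>+\<Phi>. ennreal (tree_P \<epsilon> t \<Phi>) \<partial>tree_measure T)"
      by (rule nn_integral_cong_AE, use AE_tree_P_nonneg[where \<epsilon>=\<epsilon> and t=t] in eventually_elim) simp
    then show ?thesis by (simp add: nn_integral_tree_P_one[OF t])
  qed
  have "(\<lambda>k. \<integral>\<^sup>+\<Phi>. ennreal (norm (tree_P (e k) t \<Phi> - tree_P 0 t \<Phi>)) \<partial>tree_measure T) \<longlonglongrightarrow> 0"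
  proof (rule Scheffe_lemma2)
    show "AE \<Phi> in tree_measure T. (\<lambda>k. tree_P (e k) t \<Phi>) \<longlonglongrightarrow> tree_P 0 t \<Phi>"
      using AE_good by eventually_elim (rule tree_P_tendsto[OF e])
    \<comment> \<open>The comparison of norms required for Scheffe's lemma is an equality, since no
      mass is lost for any \<epsilon>.\<close>
    show "(\<integral>\<^sup>+\<Phi>. ennreal (norm (tree_P (e k) t \<Phi>)) \<partial>tree_measure T) \<le> (\<integral>\<^sup>+\<Phi>. ennreal (norm (tree_P 0 t \<Phi>)) \<partial>tree_measure T)" for k
      unfolding abs ..
  qed (simp_all add: integrable_tree_P[OF t])
  moreover have "(\<integral>\<^sup>+\<Phi>. ennreal (norm (tree_P (e k) t \<Phi> - tree_P 0 t \<Phi>)) \<partial>tree_measure T) =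
    ennreal (\<integral>\<Phi>. \<bar>tree_P 0 t \<Phi> - tree_P (e k) t \<Phi>\<bar> \<partial>tree_measure T)" for k
    using integrable_tree_P[OF t]
    by (subst nn_integral_eq_integral[symmetric]) (auto simp: abs_minus_commute)
  ultimately show "(\<lambda>k. \<integral>\<Phi>. \<bar>tree_P 0 t \<Phi> - tree_P (e k) t \<Phi>\<bar> \<partial>tree_measure T) \<longlonglongrightarrow> 0"
    by (simp add: ennreal_tendsto_0_iff)
qed

lemma tree_P_uniform_limit:
  assumes T: "0 < T"
  shows "uniform_limit {0..T} (\<lambda>\<epsilon> t. \<integral>\<Phi>. \<bar>tree_P 0 t \<Phi> - tree_P \<epsilon> t \<Phi>\<bar> \<partial>tree_measure T) (\<lambda>_. 0) (at_right 0)"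
proof (rule uniform_limit_equi_Lipschitz[OF T])
  let ?L = "8 * pi * C0 * enn2real (moment_bound T)"
  \<comment> \<open>One Lipschitz constant each for the solutions at 0 and at \<epsilon>.\<close>
  show "0 \<le> 2 * ?L" using C0_nonneg by simp
  show "\<forall>\<^sub>F \<epsilon> in at_right 0. \<forall>s t. 0 \<le> s \<longrightarrow> s \<le> t \<longrightarrow> t \<le> T \<longrightarrow>
    (\<integral>\<Phi>. \<bar>tree_P 0 t \<Phi> - tree_P \<epsilon> t \<Phi>\<bar> \<partial>tree_measure T) \<le>
    (\<integral>\<Phi>. \<bar>tree_P 0 s \<Phi> - tree_P \<epsilon> s \<Phi>\<bar> \<partial>tree_measure T) + 2 * ?L * (t - s)"
  proof (intro always_eventually allI impI)
    fix \<epsilon> s t :: real assume s: "0 \<le> s" "s \<le> t" "t \<le> T"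
    then have st: "s \<in> {0..T}" "t \<in> {0..T}" by auto
    note int [simp] = integrable_tree_P[OF st(1)] integrable_tree_P[OF st(2)]
    have "(\<integral>\<Phi>. \<bar>tree_P 0 t \<Phi> - tree_P \<epsilon> t \<Phi>\<bar> \<partial>tree_measure T) \<le>
      (\<integral>\<Phi>. \<bar>tree_P 0 s \<Phi> - tree_P \<epsilon> s \<Phi>\<bar> + \<bar>tree_P 0 t \<Phi> - tree_P 0 s \<Phi>\<bar> + \<bar>tree_P \<epsilon> t \<Phi> - tree_P \<epsilon> s \<Phi>\<bar> \<partial>tree_measure T)"
      by (rule integral_mono) auto
    also have "\<dots> = (\<integral>\<Phi>. \<bar>tree_P 0 s \<Phi> - tree_P \<epsilon> s \<Phi>\<bar> \<partial>tree_measure T) +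
      (\<integral>\<Phi>. \<bar>tree_P 0 t \<Phi> - tree_P 0 s \<Phi>\<bar> \<partial>tree_measure T) + (\<integral>\<Phi>. \<bar>tree_P \<epsilon> t \<Phi> - tree_P \<epsilon> s \<Phi>\<bar> \<partial>tree_measure T)"
      by simp
    also have "\<dots> \<le> (\<integral>\<Phi>. \<bar>tree_P 0 s \<Phi> - tree_P \<epsilon> s \<Phi>\<bar> \<partial>tree_measure T) + ?L * (t - s) + ?L * (t - s)"
      by (intro add_mono tree_P_Lipschitz s order_refl)
    finally show "(\<integral>\<Phi>. \<bar>tree_P 0 t \<Phi> - tree_P \<epsilon> t \<Phi>\<bar> \<partial>tree_measure T) \<le>
      (\<integral>\<Phi>. \<bar>tree_P 0 s \<Phi> - tree_P \<epsilon> s \<Phi>\<bar> \<partial>tree_measure T) + 2 * ?L * (t - s)" by (simp add: algebra_simps)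
  qed
qed (auto intro: tree_P_limit)

end

lemma transport_data_of_admissible:
  assumes f0: "tagged_admissible f0" and g0: "background_admissible g0"
  obtains G N C where "transport_data g0 G N C f0"
proof (rule background_admissible_envelope[OF g0])
  fix G N C
  assume *: "g0 \<in> borel_measurable borel" "x_periodic g0" "G \<in> borel_measurable borel" "\<And>w. 0 \<le> G w"
    "N \<in> null_sets lborel" "\<And>w. w \<notin> N \<Longrightarrow> continuous_on UNIV (\<lambda>x. g0 (x, w))"
    "\<And>x w. w \<notin> N \<Longrightarrow> 0 \<le> g0 (x, w)" "\<And>x w. w \<notin> N \<Longrightarrow> g0 (x, w) \<le> G w"
    "0 \<le> C" "(\<integral>\<^sup>+w. ennreal (G w * (1 + (norm w)\<^sup>2)) \<partial>lborel) \<le> ennreal C"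
  from f0 have per: "x_periodic f0" and pd: "integrable phase_measure f0" "AE z in phase_measure. 0 \<le> f0 z" "(\<integral>z. f0 z \<partial>phase_measure) = 1"
    and mom: "integrable phase_measure (\<lambda>(x, v). f0 (x, v) * (1 + (norm v)\<^sup>2))"
    by (auto simp: tagged_admissible_def prob_density_def)
  have m [measurable]: "f0 \<in> borel_measurable borel"
    using pd(1) by (intro x_periodic_borel_measurable per) auto
  have "transport_data g0 G N C f0"
  proof
    show "AE z in ph. 0 \<le> f0 z"
      unfolding distr_phase_measure[symmetric] using pd(2) by (subst AE_distr_iff) auto
    have "(\<integral>\<^sup>+z. ennreal (f0 z) \<partial>ph) = (\<integral>\<^sup>+z. ennreal (f0 z) \<partial>phase_measure)"
      by (rule nn_integral_phase[symmetric]) measurable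
    also have "\<dots> = 1" using nn_integral_eq_integral[OF pd(1,2)] pd(3) by simp
    finally show "(\<integral>\<^sup>+z. ennreal (f0 z) \<partial>ph) = 1" .
    have "(\<integral>\<^sup>+z. ennreal (f0 z) * ennreal (1 + norm (snd z)) \<partial>ph) = (\<integral>\<^sup>+z. ennreal (f0 z) * ennreal (1 + norm (snd z)) \<partial>phase_measure)"
      by (rule nn_integral_phase[symmetric]) measurable
    also have "\<dots> \<le> (\<integral>\<^sup>+z. ennreal (norm (2 * (case z of (x, v) \<Rightarrow> f0 (x, v) * (1 + (norm v)\<^sup>2)))) \<partial>phase_measure)"
    proof (rule nn_integral_mono_AE, use pd(2) in eventually_elim)
      case (elim z)
      let ?n = "norm (snd z)"
      \<comment> \<open>Completing the square explains the factor 2 with which the first moment is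
        bounded by the given second moment.\<close>
      have "2 * (1 + ?n\<^sup>2) - (1 + ?n) = (?n - 1 / 2)\<^sup>2 + ?n\<^sup>2 + 3 / 4"
        by (simp add: power2_eq_square algebra_simps)
      moreover have "0 \<le> (?n - 1 / 2)\<^sup>2 + ?n\<^sup>2 + 3 / 4" by (intro add_nonneg_nonneg) auto
      ultimately have "1 + ?n \<le> 2 * (1 + ?n\<^sup>2)" by (metis diff_ge_0_iff_ge)
      then have "f0 z * (1 + ?n) \<le> f0 z * (2 * (1 + ?n\<^sup>2))" using elim by (rule mult_left_mono)
      then have "ennreal (f0 z) * ennreal (1 + ?n) \<le> ennreal (f0 z * (2 * (1 + ?n\<^sup>2)))"
        by (subst ennreal_mult''[symmetric]) (auto intro: ennreal_leI)
      also have "f0 z * (2 * (1 + ?n\<^sup>2)) = norm (2 * (case z of (x, v) \<Rightarrow> f0 (x, v) * (1 + (norm v)\<^sup>2)))"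
        using elim by (cases z) (simp add: abs_mult)
      finally show ?case .
    qed
    also have "\<dots> < \<infinity>"
      using integrable_mult_right[OF mom, of 2] unfolding integrable_iff_bounded by blast
    finally show "(\<integral>\<^sup>+z. ennreal (f0 z) * ennreal (1 + norm (snd z)) \<partial>ph) < \<infinity>" .
  qed (use * per m in auto)
  then show thesis by (rule that)
qed

theorem theorem3p1:
  fixes T :: real and f0 g0 :: "phase \<Rightarrow> real"
  assumes "0 < T" and "tagged_admissible f0" and "background_admissible g0"
  shows "\<exists>P :: real \<Rightarrow> real \<Rightarrow> tree \<Rightarrow> real.
    (\<forall>\<epsilon>\<ge>0. idealised_solution T \<epsilon> f0 g0 (P \<epsilon>) \<and>
            (\<forall>t\<in>{0..T}. prob_density (tree_measure T) (P \<epsilon> t))) \<and>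
    (\<exists>K>0. \<forall>\<epsilon>\<ge>0. \<forall>t\<in>{0..T}.
        integrable (tree_measure T) (\<lambda>\<Phi>. P \<epsilon> t \<Phi> * (1 + norm (root_vel \<Phi> (tau \<Phi>)))) \<and>
        (\<integral>\<Phi>. P \<epsilon> t \<Phi> * (1 + norm (root_vel \<Phi> (tau \<Phi>))) \<partial>tree_measure T) \<le> K) \<and>
    (\<forall>\<epsilon>\<ge>0. \<exists>f. mild_solution T \<epsilon> f0 g0 f \<and>
        (\<forall>t\<in>{0..T}. \<forall>\<Omega>\<in>sets phase_measure.
           S_set T t \<Omega> \<in> sets (tree_measure T) \<and>
           (LINT z:\<Omega>|phase_measure. f t z) = (LINT \<Phi>:S_set T t \<Omega>|tree_measure T. P \<epsilon> t \<Phi>))) \<and>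
    uniform_limit {0..T} (\<lambda>\<epsilon> t. \<integral>\<Phi>. \<bar>P 0 t \<Phi> - P \<epsilon> t \<Phi>\<bar> \<partial>tree_measure T) (\<lambda>_. 0) (at_right 0)"
proof -
  obtain G N C where "transport_data g0 G N C f0"
    by (rule transport_data_of_admissible[OF assms(2,3)])
  then interpret transport_data g0 G N C f0 .
  show ?thesis
  proof (rule exI[of _ tree_P], intro conjI allI impI ballI)
    \<comment> \<open>The summand 1 only makes K strictly positive; \<open>moment_bound T\<close>
      does not involve \<epsilon>.\<close>
    let ?K = "enn2real (moment_bound T) + 1"
    have "0 < ?K" using enn2real_nonneg[of "moment_bound T"] by linarith
    moreover have "integrable (tree_measure T) (\<lambda>\<Phi>. tree_P \<epsilon> t \<Phi> * tau_speed \<Phi>) \<and>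
        (\<integral>\<Phi>. tree_P \<epsilon> t \<Phi> * tau_speed \<Phi> \<partial>tree_measure T) \<le> ?K" if "t \<in> {0..T}" for \<epsilon> t
      using integrable_tree_P_speed[OF that, of \<epsilon>] integral_tree_P_speed_le[OF that, of \<epsilon>] by simp
    ultimately show "\<exists>K>0. \<forall>\<epsilon>\<ge>0. \<forall>t\<in>{0..T}.
        integrable (tree_measure T) (\<lambda>\<Phi>. tree_P \<epsilon> t \<Phi> * tau_speed \<Phi>) \<and>
        (\<integral>\<Phi>. tree_P \<epsilon> t \<Phi> * tau_speed \<Phi> \<partial>tree_measure T) \<le> K"
      by blast
    show "\<exists>f. mild_solution T \<epsilon> f0 g0 f \<and>
        (\<forall>t\<in>{0..T}. \<forall>\<Omega>\<in>sets phase_measure.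
           S_set T t \<Omega> \<in> sets (tree_measure T) \<and>
           (LINT z:\<Omega>|phase_measure. f t z) = (LINT \<Phi>:S_set T t \<Omega>|tree_measure T. tree_P \<epsilon> t \<Phi>))" for \<epsilon>
      using boltzmann_sol_mild_solution[OF assms(1), of \<epsilon>] density_eq by blast
  qed (use assms(1) in \<open>simp_all add: tree_P_idealised_solution tree_P_prob_density tree_P_uniform_limit\<close>)
qed

end
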